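(* Let $n\ge1$ and let $h\in L^1(p)$ be such that $h^{(n-1)}$ is locally absolutely continuous. Assume that the kernel hypotheses $\mathrm H$ (see context) hold at every index used: $\mathrm H(0,0;h)$; $\mathrm H(k,k-1;h^{(k-1)})$ for $1\le k\le n$; and $\mathrm H(k+1,k-1;h^{(k-1)})$ for $1\le k\le n-1$. Assume also that the correction coefficients displayed below possess the indicated derivatives. Then for $x\in\mathcal I_p$ \begin{align*} f_{p,w,h}^{(n)}(x)&=\mathbb E[K_{p,w}^{n,n-1}(x,Z)h^{(n-1)}(Z)]-M_{p,w}^{1,0}(x)h^{(n-1)}(x)+\sum_{r=0}^{n-2}\Big[\big(M_{p,w}^{r+1,r}-M_{p,w}^{1,0}\big)'h^{(r)}\Big]^{(n-2-r)}(x),\\ f_{p,w,h}^{(n)}(x)&=\mathbb E[K_{p,w}^{n,n}(x,Z)h^{(n)}(Z)]+\big(M_{p,w}^{n,n-1}(x)-M_{p,w}^{1,0}(x)\big)h^{(n-1)}(x)+\sum_{r=0}^{n-2}\Big[\big(M_{p,w}^{r+1,r}-M_{p,w}^{1,0}\big)'h^{(r)}\Big]^{(n-2-r)}(x). \end{align*} If, in addition, $h^{(n)}$ is locally absolutely continuous and $\mathrm H(n,n;h^{(n)})$ holds, then $$f_{p,w,h}^{(n)}(x)=\mathbb E[K_{p,w}^{n,n+1}(x,Z)h^{(n+1)}(Z)]+M_{p,w}^{n,n}(x)h^{(n)}(x)+\sum_{r=0}^{n-1}\Big[\big(M_{p,w}^{r,r}\big)'h^{(r)}\Big]^{(n-1-r)}(x).$$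 Empty sums are zero.
   Context: Setting. $p$ is a probability density on $\mathbb R$ and $Z$ a random variable with density $p$. There are $m\ge1$ and $-\infty\le l=e_0<e_1<\dots<e_m=u\le\infty$ with $\{p>0\}=\mathcal I_p:=\bigcup_{r=1}^m(e_{r-1},e_r)$, and $p$ is locally absolutely continuous on each $(e_{r-1},e_r)$. The weight $w:\mathbb R\to\mathbb R$ is nonzero on $\mathcal I_p$ and $wp$ is locally absolutely continuous on each $(e_{r-1},e_r)$. Put $P(x)=\int_l^xp$, $\overline P(x)=\int_x^up$, $\mathcal Ph=\mathbb E[h(Z)]$. For $h\in L^1(p)$, $f_{p,w,h}(x)=\frac1{w(x)p(x)}\int_l^x(h(t)-\mathcal Ph)p(t)\,dt$, $x\in\mathcal I_p$. Kernels. $\underline m_{p,w}=P/(wp)$ and $\overline m_{p,w}=\overline P/(wp)$ on $\mathcal I_p$; $\underline P_0=\overline P_0=p$ and, for $j\ge1$, $\underline P_j(x)=\int_l^x\underline P_{j-1}(t)\,dt$, $\overline P_j(x)=\int_x^u\overline P_{j-1}(t)\,dt$. For $i,j\ge0$ and $x,v\in\mathcal I_p$, $$K_{p,w}^{i,j}(x,v)=\frac1{p(v)}\Big[(-1)^j\overline m_{p,w}^{(i)}(x)\underline P_j(v)\mathbf 1_{\{v\le x\}}-\underline m_{p,w}^{(i)}(x)\overline P_j(v)\mathbf 1_{\{v>x\}}\Big],$$ and for $i\ge0$, $j\ge-1$, $M_{p,w}^{i,j}=(-1)^j\overline m_{p,w}^{(i)}\underline P_{j+1}-\underline m_{p,w}^{(i)}\overline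 P_{j+1}$. Superscripts in parentheses are ordinary derivatives. Kernel hypotheses $\mathrm H(i,j;g)$, for integers $i,j\ge0$ and $g:\mathbb R\to\mathbb R$: for every $x\in\mathcal I_p$, (a) $\underline P_{j+1}(x),\overline P_{j+1}(x)$ are finite; (b) the derivatives of $\underline m_{p,w},\overline m_{p,w}$ through order $i+1$ are finite and locally absolutely continuous near $x$; (c) $g$ is locally absolutely continuous and $\mathbb E[|K_{p,w}^{i,j}(x,Z)g(Z)|+|K_{p,w}^{i,j+1}(x,Z)g'(Z)|+|K_{p,w}^{i+1,j}(x,Z)g(Z)|]<\infty$; (d) $g(v)P(v)\to0$ and $g(v)\underline P_{j+1}(v)\to0$ as $v\downarrow l$, and $g(v)\overline P(v)\to0$ and $g(v)\overline P_{j+1}(v)\to0$ as $v\uparrow u$. *)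

theory Defs
  imports "HOL-Probability.Probability"
begin

text \<open>Absolute continuity on \<open>[a, b]\<close>: the usual epsilon-delta condition over finite systems of
  non-overlapping subintervals, a subinterval being the pair of its endpoints.\<close>

definition abs_cont_on_Icc :: "real \<Rightarrow> real \<Rightarrow> (real \<Rightarrow> real) \<Rightarrow> bool" where
  "abs_cont_on_Icc a b f \<longleftrightarrow>
    (\<forall>\<epsilon>>0. \<exists>\<delta>>0. \<forall>D :: (real \<times> real) set.
      finite D \<longrightarrow>
      (\<forall>(c, d)\<in>D. a \<le> c \<and> c \<le> d \<and> d \<le> b) \<longrightarrow>
      disjoint_family_on (\<lambda>(c, d). {c<..<d}) D \<longrightarrow>
      (\<Sum>(c, d)\<in>D. d - c) < \<delta> \<longrightarrow>
      (\<Sum>(c, d)\<in>D. \<bar>f d - f c\<bar>) < \<epsilon>)"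

definition locally_abs_cont_on :: "real set \<Rightarrow> (real \<Rightarrow> real) \<Rightarrow> bool" where
  "locally_abs_cont_on S f \<longleftrightarrow> (\<forall>a b. a \<le> b \<and> {a..b} \<subseteq> S \<longrightarrow> abs_cont_on_Icc a b f)"

text \<open>The \<open>k\<close>-th derivative is \<open>(deriv ^^ k) f\<close>.  Since \<^const>\<open>deriv\<close> is total, existence of the
  derivatives is recorded separately; the following is meant for open \<open>S\<close>.\<close>

definition times_differentiable_on :: "nat \<Rightarrow> (real \<Rightarrow> real) \<Rightarrow> real set \<Rightarrow> bool" where
  "times_differentiable_on n f S \<longleftrightarrow>
    (\<forall>k<n. \<forall>x\<in>S. (deriv ^^ k) f field_differentiable (at x))"

text \<open>The iterated tail integrals take values in \<open>[0, \<infinity>]\<close>, so that their finiteness can be stated;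
  \<^const>\<open>enn2real\<close> is applied where they enter real-valued formulas.\<close>

primrec lower_tail :: "ereal \<Rightarrow> (real \<Rightarrow> real) \<Rightarrow> nat \<Rightarrow> real \<Rightarrow> ennreal" where
  "lower_tail l p 0 x = ennreal (p x)"
| "lower_tail l p (Suc j) x = (\<integral>\<^sup>+ t\<in>einterval l (ereal x). lower_tail l p j t \<partial>lborel)"

primrec upper_tail :: "ereal \<Rightarrow> (real \<Rightarrow> real) \<Rightarrow> nat \<Rightarrow> real \<Rightarrow> ennreal" where
  "upper_tail u p 0 x = ennreal (p x)"
| "upper_tail u p (Suc j) x = (\<integral>\<^sup>+ t\<in>einterval (ereal x) u. upper_tail u p j t \<partial>lborel)"

definition m_lower :: "ereal \<Rightarrow> (real \<Rightarrow> real) \<Rightarrow> (real \<Rightarrow> real) \<Rightarrow> real \<Rightarrow> real" where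
  "m_lower l p w x = enn2real (lower_tail l p 1 x) / (w x * p x)"

definition m_upper :: "ereal \<Rightarrow> (real \<Rightarrow> real) \<Rightarrow> (real \<Rightarrow> real) \<Rightarrow> real \<Rightarrow> real" where
  "m_upper u p w x = enn2real (upper_tail u p 1 x) / (w x * p x)"

definition stein_kernel ::
  "ereal \<Rightarrow> ereal \<Rightarrow> (real \<Rightarrow> real) \<Rightarrow> (real \<Rightarrow> real) \<Rightarrow> nat \<Rightarrow> nat \<Rightarrow> real \<Rightarrow> real \<Rightarrow> real" where
  "stein_kernel l u p w i j x v =
    1 / p v *
    ((-1) ^ j * (deriv ^^ i) (m_upper u p w) x * enn2real (lower_tail l p j v) * indicator {..x} v
     - (deriv ^^ i) (m_lower l p w) x * enn2real (upper_tail u p j v) * indicator {x<..} v)"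

text \<open>The second index ranges over the integers \<open>j \<ge> -1\<close>.\<close>

definition stein_coeff ::
  "ereal \<Rightarrow> ereal \<Rightarrow> (real \<Rightarrow> real) \<Rightarrow> (real \<Rightarrow> real) \<Rightarrow> nat \<Rightarrow> int \<Rightarrow> real \<Rightarrow> real" where
  "stein_coeff l u p w i j x =
    (-1) powi j * (deriv ^^ i) (m_upper u p w) x * enn2real (lower_tail l p (nat (j + 1)) x)
    - (deriv ^^ i) (m_lower l p w) x * enn2real (upper_tail u p (nat (j + 1)) x)"

definition stein_solution ::
  "'a measure \<Rightarrow> ('a \<Rightarrow> real) \<Rightarrow> ereal \<Rightarrow> (real \<Rightarrow> real) \<Rightarrow> (real \<Rightarrow> real) \<Rightarrow> (real \<Rightarrow> real) \<Rightarrow> real \<Rightarrow> real" where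
  "stein_solution M Z l p w h x =
    1 / (w x * p x) * (LBINT t=l..ereal x. (h t - (\<integral>\<omega>. h (Z \<omega>) \<partial>M)) * p t)"

text \<open>Limits at the possibly infinite endpoints are taken along filters on \<^typ>\<open>ereal\<close>, as in the
  fundamental theorem for interval integrals.  The derivative of the locally absolutely continuous
  \<open>g\<close> exists almost everywhere; the values of \<open>deriv g\<close> on the exceptional null set are irrelevant.\<close>

definition kernel_hyp ::
  "'a measure \<Rightarrow> ('a \<Rightarrow> real) \<Rightarrow> ereal \<Rightarrow> ereal \<Rightarrow> (real \<Rightarrow> real) \<Rightarrow> (real \<Rightarrow> real) \<Rightarrow>
    nat \<Rightarrow> nat \<Rightarrow> (real \<Rightarrow> real) \<Rightarrow> bool" where
  "kernel_hyp M Z l u p w i j g \<longleftrightarrow>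
    (\<forall>x\<in>{x. 0 < p x}. lower_tail l p (j + 1) x < \<infinity> \<and> upper_tail u p (j + 1) x < \<infinity>) \<and>
    (\<forall>x\<in>{x. 0 < p x}. \<exists>\<epsilon>>0. \<forall>\<mu>\<in>{m_lower l p w, m_upper u p w}.
       times_differentiable_on (i + 1) \<mu> (ball x \<epsilon>) \<and>
       (\<forall>k\<le>i + 1. locally_abs_cont_on (ball x \<epsilon>) ((deriv ^^ k) \<mu>))) \<and>
    locally_abs_cont_on UNIV g \<and>
    (\<forall>x\<in>{x. 0 < p x}.
       integrable M (\<lambda>\<omega>. stein_kernel l u p w i j x (Z \<omega>) * g (Z \<omega>)) \<and>
       integrable M (\<lambda>\<omega>. stein_kernel l u p w i (j + 1) x (Z \<omega>) * deriv g (Z \<omega>)) \<and>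
       integrable M (\<lambda>\<omega>. stein_kernel l u p w (i + 1) j x (Z \<omega>) * g (Z \<omega>))) \<and>
    (((\<lambda>v. g v * enn2real (lower_tail l p 1 v)) \<circ> real_of_ereal) \<longlongrightarrow> 0) (at_right l) \<and>
    (((\<lambda>v. g v * enn2real (lower_tail l p (j + 1) v)) \<circ> real_of_ereal) \<longlongrightarrow> 0) (at_right l) \<and>
    (((\<lambda>v. g v * enn2real (upper_tail u p 1 v)) \<circ> real_of_ereal) \<longlongrightarrow> 0) (at_left u) \<and>
    (((\<lambda>v. g v * enn2real (upper_tail u p (j + 1) v)) \<circ> real_of_ereal) \<longlongrightarrow> 0) (at_left u)"

end

(* The solution f is the kernel expectation E[K^{0,0}(x,Z) h(Z)].  Two moves generate everything.
   Differentiating in x gives (E[K^{i,j}(x,Z) g(Z)])' = E[K^{i+1,j}(x,Z) g(Z)] - M^{i,j-1}(x) g(x), and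
   integrating by parts in v gives E[K^{i,j}(x,Z) g(Z)] = E[K^{i,j+1}(x,Z) g'(Z)] + M^{i,j}(x) g(x).
   Alternating them proves the first two formulas by induction on n, starting from
   M^{0,-1} = M^{1,0} = -1/w.  With D_r = M^{r+1,r} - M^{1,0} one has (M^{r,r})' = D_r - D_{r-1} and
   D_r' h^{(r)} = (D_r h^{(r)})' - D_r h^{(r+1)}, so the correction terms of the third formula
   telescope to those of the second.
   Integration by parts needs the fundamental theorem of calculus for absolutely continuous g.  It is
   obtained by writing g as a difference of monotone absolutely continuous functions (via the
   variation), whose Stieltjes measures have Radon-Nikodym densities, and by the Lebesgue
   differentiation theorem. *)

theory Submission
  imports Defs
begin

section \<open>Absolutely continuous functions and their variation\<close>

text \<open>Three obstacles shape the proof. A kernel expectation converges as a whole; split at x,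
  it is a derivative of the upper m times a lower integral, minus a derivative of the lower m times
  an upper integral, and convergence of either integral is known only where its factor is nonzero.
  Hence identities are proved for the products, a vanishing factor being treated apart.
  Differentiation in x never goes under the integral, since x sits only in the factors and in the
  limits of integration. Next, p may jump at the finitely many points e_r inside (l,u). The tails
  are continuous across them, so integration by parts runs over all of (l,x) and (x,u), while
  derivatives are taken only on the open set {p > 0}. Finally, \<open>deriv g\<close> is arbitrary
  where g has no derivative, so a Borel function equal to it almost everywhere replaces it under the
  integral. D_r is measured from M^{1,0} because -M^{1,0} is the boundary coefficient that every
  order retains: integration by parts completes it to D_k, and the next derivative in x cancels D_k
  again, up to the term D_k' h^{(k)}.\<close>

definition interval_system :: "real \<Rightarrow> real \<Rightarrow> (real \<times> real) set \<Rightarrow> bool" where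
  "interval_system a b D \<longleftrightarrow> finite D \<and> (\<forall>(s, t)\<in>D. a \<le> s \<and> s < t \<and> t \<le> b) \<and>
    disjoint_family_on (\<lambda>(s, t). {s<..<t}) D"

definition increment_sum :: "(real \<Rightarrow> real) \<Rightarrow> (real \<times> real) set \<Rightarrow> real" where
  "increment_sum g D = (\<Sum>(s, t)\<in>D. \<bar>g t - g s\<bar>)"

text \<open>The supremum runs over systems that may leave gaps, so that systems on adjacent
  intervals can be united and members can be removed freely. It is meaningful only when the
  increment sums are bounded, since \<open>SUP\<close> on \<open>real\<close> is otherwise
  unspecified.\<close>

definition variation_between :: "(real \<Rightarrow> real) \<Rightarrow> real \<Rightarrow> real \<Rightarrow> real" where
  "variation_between g a b = (SUP D\<in>{D. interval_system a b D}. increment_sum g D)"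

lemma Ioo_disjoint_iff:
  fixes s t s' t' :: real
  assumes "s < t" "s' < t'"
  shows "{s<..<t} \<inter> {s'<..<t'} = {} \<longleftrightarrow> t \<le> s' \<or> t' \<le> s"
proof
  assume "{s<..<t} \<inter> {s'<..<t'} = {}"
  \<comment> \<open>If neither ordering held, the larger left end would lie below the smaller right
    end, and their midpoint would be common to both intervals.\<close>
  then have "(max s s' + min t t') / 2 \<notin> {s<..<t} \<inter> {s'<..<t'}" by blast
  then show "t \<le> s' \<or> t' \<le> s" using assms by (auto simp: max_def min_def split: if_splits)
qed auto

lemma interval_system_iff:
  "interval_system a b D \<longleftrightarrow> finite D \<and> (\<forall>(s, t)\<in>D. a \<le> s \<and> s < t \<and> t \<le> b) \<and>
    (\<forall>(s, t)\<in>D. \<forall>(s', t')\<in>D. (s, t) \<noteq> (s', t') \<longrightarrow> t \<le> s' \<or> t' \<le> s)"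
proof -
  have "disjoint_family_on (\<lambda>(s, t). {s<..<t}) D \<longleftrightarrow>
    (\<forall>(s, t)\<in>D. \<forall>(s', t')\<in>D. (s, t) \<noteq> (s', t') \<longrightarrow> t \<le> s' \<or> t' \<le> s)"
    if *: "\<forall>(s, t)\<in>D. a \<le> s \<and> s < t \<and> t \<le> b"
    unfolding disjoint_family_on_def
  proof (intro ball_cong refl, clarify)
    fix s t assume "(s, t) \<in> D"
    then show "(\<forall>n\<in>D. (s, t) \<noteq> n \<longrightarrow> {s<..<t} \<inter> (case n of (s, t) \<Rightarrow> {s<..<t}) = {}) \<longleftrightarrow>
        (\<forall>(s', t')\<in>D. (s, t) \<noteq> (s', t') \<longrightarrow> t \<le> s' \<or> t' \<le> s)"
      using * by (intro ball_cong refl, clarify) (subst Ioo_disjoint_iff, auto)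
  qed
  then show ?thesis unfolding interval_system_def by blast
qed

lemma interval_systemI:
  "finite D \<Longrightarrow> (\<And>s t. (s, t) \<in> D \<Longrightarrow> a \<le> s \<and> s < t \<and> t \<le> b) \<Longrightarrow>
    (\<And>s t s' t'. (s, t) \<in> D \<Longrightarrow> (s', t') \<in> D \<Longrightarrow> (s, t) \<noteq> (s', t') \<Longrightarrow> t \<le> s' \<or> t' \<le> s) \<Longrightarrow>
    interval_system a b D"
  unfolding interval_system_iff by blast

lemma interval_system_separated:
  "interval_system a b D \<Longrightarrow> (s, t) \<in> D \<Longrightarrow> (s', t') \<in> D \<Longrightarrow> (s, t) \<noteq> (s', t') \<Longrightarrow> t \<le> s' \<or> t' \<le> s"
  unfolding interval_system_iff by blast

lemma abs_cont_on_Icc_iff: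
  "abs_cont_on_Icc a b g \<longleftrightarrow> (\<forall>\<epsilon>>0. \<exists>\<delta>>0. \<forall>D. interval_system a b D \<longrightarrow>
    (\<Sum>(s, t)\<in>D. t - s) < \<delta> \<longrightarrow> increment_sum g D < \<epsilon>)"
proof
  assume ac: "abs_cont_on_Icc a b g"
  show "\<forall>\<epsilon>>0. \<exists>\<delta>>0. \<forall>D. interval_system a b D \<longrightarrow>
    (\<Sum>(s, t)\<in>D. t - s) < \<delta> \<longrightarrow> increment_sum g D < \<epsilon>"
  proof (intro allI impI)
    fix \<epsilon> :: real assume "0 < \<epsilon>"
    then obtain \<delta> where \<delta>: "\<delta> > 0" "\<forall>D. finite D \<longrightarrow> (\<forall>(c, d)\<in>D. a \<le> c \<and> c \<le> d \<and> d \<le> b) \<longrightarrow>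
        disjoint_family_on (\<lambda>(c, d). {c<..<d}) D \<longrightarrow> (\<Sum>(c, d)\<in>D. d - c) < \<delta> \<longrightarrow>
        (\<Sum>(c, d)\<in>D. \<bar>g d - g c\<bar>) < \<epsilon>"
      using ac[unfolded abs_cont_on_Icc_def, rule_format, of \<epsilon>] by auto
    show "\<exists>\<delta>>0. \<forall>D. interval_system a b D \<longrightarrow> (\<Sum>(s, t)\<in>D. t - s) < \<delta> \<longrightarrow> increment_sum g D < \<epsilon>"
    proof (intro exI[of _ \<delta>] conjI allI impI)
      fix D assume D: "interval_system a b D" "(\<Sum>(s, t)\<in>D. t - s) < \<delta>"
      then have "\<forall>(c, d)\<in>D. a \<le> c \<and> c \<le> d \<and> d \<le> b" by (auto simp: interval_system_def)
      then show "increment_sum g D < \<epsilon>"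
        using \<delta>(2)[rule_format, of D] D by (simp add: interval_system_def increment_sum_def)
    qed (fact \<delta>(1))
  qed
next
  assume ac: "\<forall>\<epsilon>>0. \<exists>\<delta>>0. \<forall>D. interval_system a b D \<longrightarrow>
    (\<Sum>(s, t)\<in>D. t - s) < \<delta> \<longrightarrow> increment_sum g D < \<epsilon>"
  show "abs_cont_on_Icc a b g"
    unfolding abs_cont_on_Icc_def
  proof (intro allI impI)
    fix \<epsilon> :: real assume "0 < \<epsilon>"
    with ac obtain \<delta> where \<delta>: "\<delta> > 0" "\<And>D. interval_system a b D \<Longrightarrow>
      (\<Sum>(s, t)\<in>D. t - s) < \<delta> \<Longrightarrow> increment_sum g D < \<epsilon>"
      by blast
    show "\<exists>\<delta>>0. \<forall>D. finite D \<longrightarrow> (\<forall>(c, d)\<in>D. a \<le> c \<and> c \<le> d \<and> d \<le> b) \<longrightarrow>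
        disjoint_family_on (\<lambda>(c, d). {c<..<d}) D \<longrightarrow> (\<Sum>(c, d)\<in>D. d - c) < \<delta> \<longrightarrow>
        (\<Sum>(c, d)\<in>D. \<bar>g d - g c\<bar>) < \<epsilon>"
    proof (intro exI[of _ \<delta>] conjI allI impI)
      fix D0 :: "(real \<times> real) set"
      assume D0: "finite D0" "\<forall>(c, d)\<in>D0. a \<le> c \<and> c \<le> d \<and> d \<le> b"
        "disjoint_family_on (\<lambda>(c, d). {c<..<d}) D0" "(\<Sum>(c, d)\<in>D0. d - c) < \<delta>"
      define D where "D = {(c, d)\<in>D0. c < d}"
      have "D \<subseteq> D0" by (auto simp: D_def)
      have sysD: "interval_system a b D"
        unfolding interval_system_def
      proof (intro conjI)
        show "finite D" using \<open>D \<subseteq> D0\<close> D0(1) by (rule finite_subset)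
        show "\<forall>(s, t)\<in>D. a \<le> s \<and> s < t \<and> t \<le> b" using D0(2) by (auto simp: D_def)
        show "disjoint_family_on (\<lambda>(s, t). {s<..<t}) D"
          using \<open>D \<subseteq> D0\<close> D0(3) by (rule disjoint_family_on_mono)
      qed
      have "(\<Sum>(c, d)\<in>D. d - c) = (\<Sum>(c, d)\<in>D0. d - c)"
        using D0 by (intro sum.mono_neutral_left) (auto simp: D_def)
      moreover have "(\<Sum>(c, d)\<in>D0. \<bar>g d - g c\<bar>) = increment_sum g D"
        unfolding increment_sum_def using D0 by (intro sum.mono_neutral_right) (fastforce simp: D_def order_less_le)+
      ultimately show "(\<Sum>(c, d)\<in>D0. \<bar>g d - g c\<bar>) < \<epsilon>"
        using \<delta>(2)[OF sysD] D0(4) by simp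
    qed (fact \<delta>(1))
  qed
qed

lemma interval_system_empty [simp]: "interval_system a b {}"
  by (simp add: interval_system_def disjoint_family_on_def)

lemma interval_system_mono:
  "interval_system a b D \<Longrightarrow> a' \<le> a \<Longrightarrow> b \<le> b' \<Longrightarrow> interval_system a' b' D"
  unfolding interval_system_def by fastforce

lemma interval_system_subset:
  "interval_system a b D \<Longrightarrow> D' \<subseteq> D \<Longrightarrow> interval_system a b D'"
  unfolding interval_system_def by (meson disjoint_family_on_mono finite_subset subsetD)

lemma interval_system_single: "a \<le> s \<Longrightarrow> s < t \<Longrightarrow> t \<le> b \<Longrightarrow> interval_system a b {(s, t)}"
  by (auto simp: interval_system_def disjoint_family_on_def)

text \<open>Turns lengths into measures, so that comparing two systems reduces to an inclusion of
  their unions, without matching intervals one by one.\<close>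

lemma interval_system_length:
  assumes "interval_system a b D"
  shows "(\<Sum>(s, t)\<in>D. t - s) = measure lborel (\<Union>(s, t)\<in>D. {s<..<t})"
proof -
  have "measure lborel (\<Union>i\<in>D. case i of (s, t) \<Rightarrow> {s<..<t}) =
      (\<Sum>i\<in>D. measure lborel (case i of (s, t) \<Rightarrow> {s<..<t}))"
    using assms by (intro measure_finite_Union)
      (auto simp: interval_system_def emeasure_lborel_Ioo split: if_splits)
  also have "\<dots> = (\<Sum>(s, t)\<in>D. t - s)"
    using assms by (intro sum.cong) (auto simp: interval_system_def)
  finally show ?thesis by simp
qed

lemma interval_system_length_le:
  assumes "interval_system a b D" "interval_system a' b' D'"
    and "(\<Union>(s, t)\<in>D. {s<..<t}) \<subseteq> (\<Union>(s, t)\<in>D'. {s<..<t})"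
  shows "(\<Sum>(s, t)\<in>D. t - s) \<le> (\<Sum>(s, t)\<in>D'. t - s)"
  unfolding interval_system_length[OF assms(1)] interval_system_length[OF assms(2)]
proof (rule measure_mono_fmeasurable[OF assms(3)])
  show "(\<Union>(s, t)\<in>D. {s<..<t}) \<in> sets lborel"
    using assms(1) by (auto simp: interval_system_def intro!: sets.finite_UN)
  show "(\<Union>(s, t)\<in>D'. {s<..<t}) \<in> fmeasurable lborel"
    using assms(2)
    by (intro fmeasurable.finite_UN) (auto simp: interval_system_def fmeasurable_def emeasure_lborel_Ioo)
qed

lemma interval_system_length_le_diff:
  assumes "interval_system a b D" "a \<le> b"
  shows "(\<Sum>(s, t)\<in>D. t - s) \<le> b - a"
proof (cases "a < b")
  case True
  have "(\<Sum>(s, t)\<in>D. t - s) \<le> (\<Sum>(s, t)\<in>{(a, b)}. t - s)"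
    using assms True
    by (intro interval_system_length_le[where a=a and b=b and a'=a and b'=b] interval_system_single)
       (fastforce simp: interval_system_def)+
  then show ?thesis by simp
next
  case False
  then have "D = {}" using assms by (fastforce simp: interval_system_def)
  then show ?thesis using assms by simp
qed

lemma interval_system_join:
  assumes "interval_system a b D1" "interval_system b c D2" "a \<le> b" "b \<le> c"
  shows "interval_system a c (D1 \<union> D2)" "D1 \<inter> D2 = {}"
proof -
  show "D1 \<inter> D2 = {}" using assms by (fastforce simp: interval_system_def)
  show "interval_system a c (D1 \<union> D2)"
  proof (rule interval_systemI)
    show "finite (D1 \<union> D2)" using assms by (simp add: interval_system_def)
    show "a \<le> s \<and> s < t \<and> t \<le> c" if "(s, t) \<in> D1 \<union> D2" for s t
      using assms that unfolding interval_system_def by fastforce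
    show "t \<le> s' \<or> t' \<le> s"
      if *: "(s, t) \<in> D1 \<union> D2" "(s', t') \<in> D1 \<union> D2" "(s, t) \<noteq> (s', t')" for s t s' t'
    proof -
      have "t \<le> b" if "(s, t) \<in> D1" for s t using that assms(1) by (auto simp: interval_system_def)
      moreover have "b \<le> s" if "(s, t) \<in> D2" for s t using that assms(2) by (auto simp: interval_system_def)
      ultimately consider "(s, t) \<in> D1" "(s', t') \<in> D1" | "(s, t) \<in> D2" "(s', t') \<in> D2" | "t \<le> b" "b \<le> s'" | "t' \<le> b" "b \<le> s"
        using * by blast
      then show ?thesis
      proof cases
        case 1
        then show ?thesis using interval_system_separated[OF assms(1), of s t s' t'] * by blast
      next
        case 2
        then show ?thesis using interval_system_separated[OF assms(2), of s t s' t'] * by blast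
      qed (use * in auto)
    qed
  qed
qed

text \<open>At most one member contains \<open>b\<close> in its interior, as two such would overlap.
  Cutting it at \<open>b\<close> cannot lower the increment sum, by the triangle inequality; all
  other members lie on one side.\<close>

lemma interval_system_split:
  assumes D: "interval_system a c D" and "a \<le> b" "b \<le> c"
  obtains D1 D2 where "interval_system a b D1" "interval_system b c D2"
    "increment_sum g D \<le> increment_sum g D1 + increment_sum g D2"
proof -
  define L where "L = {(s, t)\<in>D. t \<le> b}"
  define R where "R = {(s, t)\<in>D. b \<le> s}"
  define S where "S = {(s, t)\<in>D. s < b \<and> b < t}"
  have fin: "finite D" using D by (simp add: interval_system_def)
  have DU: "D = L \<union> R \<union> S" unfolding L_def R_def S_def by auto
  have disj: "L \<inter> R = {}" "(L \<union> R) \<inter> S = {}"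
    using D by (fastforce simp: L_def R_def S_def interval_system_def)+
  have finLRS: "finite L" "finite R" "finite S"
    unfolding L_def R_def S_def using fin by (auto intro: rev_finite_subset)
  have sum: "increment_sum g D = increment_sum g L + increment_sum g R + increment_sum g S"
    unfolding increment_sum_def DU using finLRS disj by (simp add: sum.union_disjoint)
  have L: "interval_system a b L"
    using interval_system_subset[OF D, of L] by (auto simp: interval_system_def L_def)
  have R: "interval_system b c R"
    using interval_system_subset[OF D, of R] by (auto simp: interval_system_def R_def)
  show ?thesis
  proof (cases "S = {}")
    case True
    then show ?thesis using that[OF L R] sum by (simp add: increment_sum_def)
  next
    case False
    then obtain s t where st: "(s, t) \<in> S" by auto
    have stD: "(s, t) \<in> D" "s < b" "b < t" "a \<le> s" "t \<le> c"
      using st D by (auto simp: S_def interval_system_def)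
    have sep: "(s', t') = (s, t) \<or> t \<le> s' \<or> t' \<le> s" if "(s', t') \<in> D" for s' t'
      using interval_system_separated[OF D stD(1)] that by metis
    have S: "S = {(s, t)}"
      using st sep by (fastforce simp: S_def)
    have Lt: "t' \<le> s" if "(s', t') \<in> L" for s' t'
      using sep[of s' t'] that stD D by (auto simp: L_def interval_system_def)
    have Rt: "t \<le> s'" if "(s', t') \<in> R" for s' t'
      using sep[of s' t'] that stD D by (auto simp: R_def interval_system_def)
    have L': "interval_system a s L"
      using L Lt unfolding interval_system_def by blast
    have R': "interval_system t c R"
      using R Rt unfolding interval_system_def by blast
    have 1: "interval_system a b (L \<union> {(s, b)})" "L \<inter> {(s, b)} = {}"
      using interval_system_join[OF L' interval_system_single[of s s b b]] stD by auto
    have 2: "interval_system b c ({(b, t)} \<union> R)" "{(b, t)} \<inter> R = {}"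
      using interval_system_join[OF interval_system_single[of b b t t] R'] stD by auto
    have "increment_sum g D \<le> increment_sum g (L \<union> {(s, b)}) + increment_sum g ({(b, t)} \<union> R)"
      unfolding sum S using 1(2) 2(2) finLRS by (auto simp: increment_sum_def)
    then show ?thesis using that[OF 1(1) 2(1)] by blast
  qed
qed

section \<open>Variation of a function with bounded increment sums\<close>

context
  fixes g :: "real \<Rightarrow> real" and a b B :: real
  assumes increment_sum_bound: "\<And>D. interval_system a b D \<Longrightarrow> increment_sum g D \<le> B"
begin

text \<open>The bound \<open>B\<close> is what makes \<open>variation_between\<close> a true
  supremum. It will be supplied on short intervals, where absolute continuity with \<epsilon> = 1
  gives \<open>B\<close> = 1.\<close>

lemma increment_sum_bdd_above:
  "a \<le> x \<Longrightarrow> y \<le> b \<Longrightarrow> bdd_above (increment_sum g ` {D. interval_system x y D})"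
  using increment_sum_bound interval_system_mono by (intro bdd_aboveI[where M=B]) blast

lemma increment_sum_le_variation:
  "a \<le> x \<Longrightarrow> y \<le> b \<Longrightarrow> interval_system x y D \<Longrightarrow> increment_sum g D \<le> variation_between g x y"
  unfolding variation_between_def using increment_sum_bdd_above by (intro cSUP_upper) auto

lemma variation_less_increment_sum:
  assumes "a \<le> x" "y \<le> b" "0 < \<epsilon>"
  obtains D where "interval_system x y D" "variation_between g x y - \<epsilon> < increment_sum g D"
proof -
  have "variation_between g x y - \<epsilon> < (SUP D\<in>{D. interval_system x y D}. increment_sum g D)"
    using assms by (simp add: variation_between_def)
  then show ?thesis
    using increment_sum_bdd_above[OF assms(1,2)] that
    by (subst (asm) less_cSUP_iff) (auto intro: interval_system_empty)
qed

text \<open>Cutting a system at \<open>y\<close> gives one inequality; uniting two nearly optimal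
  systems gives the other.\<close>

lemma variation_add:
  assumes "a \<le> x" "x \<le> y" "y \<le> z" "z \<le> b"
  shows "variation_between g x z = variation_between g x y + variation_between g y z"
proof (rule antisym)
  show "variation_between g x z \<le> variation_between g x y + variation_between g y z"
    unfolding variation_between_def[of g x z]
  proof (rule cSUP_least)
    show "{D. interval_system x z D} \<noteq> {}" using interval_system_empty by blast
    fix D assume "D \<in> {D. interval_system x z D}"
    then obtain D1 D2 where "interval_system x y D1" "interval_system y z D2"
      "increment_sum g D \<le> increment_sum g D1 + increment_sum g D2"
      using interval_system_split[of x z D y g] assms by auto
    then show "increment_sum g D \<le> variation_between g x y + variation_between g y z"
      using increment_sum_le_variation[of x y D1] increment_sum_le_variation[of y z D2] assms by simp
  qed
  show "variation_between g x y + variation_between g y z \<le> variation_between g x z"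
  proof (rule field_le_epsilon)
    fix \<epsilon> :: real assume "0 < \<epsilon>"
    then obtain D1 D2 where D: "interval_system x y D1" "interval_system y z D2"
      "variation_between g x y - \<epsilon> / 2 < increment_sum g D1"
      "variation_between g y z - \<epsilon> / 2 < increment_sum g D2"
      using variation_less_increment_sum[of x y "\<epsilon>/2"] variation_less_increment_sum[of y z "\<epsilon>/2"] assms
      by (metis half_gt_zero order_trans)
    have "increment_sum g D1 + increment_sum g D2 = increment_sum g (D1 \<union> D2)"
      unfolding increment_sum_def using interval_system_join(2)[OF D(1,2)] D assms
      by (subst sum.union_disjoint) (auto simp: interval_system_def)
    also have "\<dots> \<le> variation_between g x z"
      using interval_system_join(1)[OF D(1,2)] assms by (intro increment_sum_le_variation) auto
    finally show "variation_between g x y + variation_between g y z \<le> variation_between g x z + \<epsilon>"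
      using D by simp
  qed
qed

lemma abs_diff_le_variation:
  assumes "a \<le> x" "x \<le> y" "y \<le> b"
  shows "\<bar>g y - g x\<bar> \<le> variation_between g x y"
proof (cases "x = y")
  case True
  then show ?thesis using increment_sum_le_variation[of x y "{}"] assms by (simp add: increment_sum_def)
next
  case False
  then show ?thesis
    using increment_sum_le_variation[of x y "{(x, y)}"] interval_system_single[of x x y y] assms
    by (simp add: increment_sum_def)
qed

text \<open>Every interval of a short system is replaced by a nearly optimal system inside it. The
  refined system is no longer than the original one, so the \<delta> that belongs to
  \<open>g\<close> and \<epsilon>/2 controls it, and its increment sum under \<open>g\<close> nearly
  attains the total variation over the original intervals.\<close>

lemma abs_cont_variation:
  assumes ac: "abs_cont_on_Icc a b g"
  shows "abs_cont_on_Icc a b (variation_between g a)"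
  unfolding abs_cont_on_Icc_iff
proof (intro allI impI)
  fix \<epsilon> :: real assume "0 < \<epsilon>"
  then obtain \<delta> where "\<delta> > 0" and \<delta>: "\<And>D. interval_system a b D \<Longrightarrow> (\<Sum>(s, t)\<in>D. t - s) < \<delta> \<Longrightarrow>
      increment_sum g D < \<epsilon> / 2"
    using ac[unfolded abs_cont_on_Icc_iff, rule_format, of "\<epsilon> / 2"] by auto
  show "\<exists>\<delta>>0. \<forall>D. interval_system a b D \<longrightarrow> (\<Sum>(s, t)\<in>D. t - s) < \<delta> \<longrightarrow>
      increment_sum (variation_between g a) D < \<epsilon>"
  proof (intro exI[of _ \<delta>] conjI allI impI)
    fix D assume sysD: "interval_system a b D" and lenD: "(\<Sum>(s, t)\<in>D. t - s) < \<delta>"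
    have finD: "finite D" using sysD by (simp add: interval_system_def)
    have varD: "increment_sum (variation_between g a) D = (\<Sum>(c, d)\<in>D. variation_between g c d)"
      unfolding increment_sum_def
    proof (intro sum.cong refl, clarify)
      fix c d assume "(c, d) \<in> D"
      then have "a \<le> c" "c < d" "d \<le> b" using sysD by (auto simp: interval_system_def)
      then show "\<bar>variation_between g a d - variation_between g a c\<bar> = variation_between g c d"
        using variation_add[of a c d] abs_diff_le_variation[of c d] by simp
    qed
    \<comment> \<open>The loss allowed on each interval: \<open>card D\<close> such losses cost at
      most \<epsilon>/2, and the \<open>+ 1\<close> covers an empty \<open>D\<close>.\<close>
    define \<eta> where "\<eta> = \<epsilon> / (2 * (real (card D) + 1))"
    have "\<eta> > 0" using \<open>0 < \<epsilon>\<close> by (simp add: \<eta>_def)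
    have "\<forall>i\<in>D. \<exists>E. interval_system (fst i) (snd i) E \<and>
        variation_between g (fst i) (snd i) - \<eta> < increment_sum g E"
    proof
      fix i assume "i \<in> D"
      then have "a \<le> fst i" "snd i \<le> b" using sysD by (auto simp: interval_system_def)
      then show "\<exists>E. interval_system (fst i) (snd i) E \<and>
        variation_between g (fst i) (snd i) - \<eta> < increment_sum g E"
        using variation_less_increment_sum[of "fst i" "snd i" \<eta>] \<open>\<eta> > 0\<close> by metis
    qed
    then obtain E where E: "\<And>i. i \<in> D \<Longrightarrow> interval_system (fst i) (snd i) (E i)"
      "\<And>i. i \<in> D \<Longrightarrow> variation_between g (fst i) (snd i) - \<eta> < increment_sum g (E i)"
      by metis
    have Efin: "\<And>i. i \<in> D \<Longrightarrow> finite (E i)" using E by (auto simp: interval_system_def)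
    have Esub: "s < t \<and> fst i \<le> s \<and> t \<le> snd i" if "i \<in> D" "(s, t) \<in> E i" for i s t
      using E(1)[OF that(1)] that(2) by (auto simp: interval_system_def)
    have Edisj: "t \<le> s' \<or> t' \<le> s" if "i \<in> D" "j \<in> D" "i \<noteq> j" "(s, t) \<in> E i" "(s', t') \<in> E j"
      for i j s t s' t'
    proof -
      have "snd i \<le> fst j \<or> snd j \<le> fst i"
        using interval_system_separated[OF sysD, of "fst i" "snd i" "fst j" "snd j"] that(1-3)
        by (simp add: prod_eq_iff)
      then show ?thesis using Esub[OF that(1,4)] Esub[OF that(2,5)] by auto
    qed
    have Edisj': "E i \<inter> E j = {}" if "i \<in> D" "j \<in> D" "i \<noteq> j" for i j
    proof (rule ccontr)
      assume "E i \<inter> E j \<noteq> {}"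
      then obtain s t where st: "(s, t) \<in> E i" "(s, t) \<in> E j" by auto
      then show False using Edisj[OF that st] Esub[OF that(1) st(1)] by simp
    qed
    define D' where "D' = (\<Union>i\<in>D. E i)"
    have sys': "interval_system a b D'"
    proof (rule interval_systemI)
      show "finite D'" using finD Efin by (simp add: D'_def)
      show "a \<le> s \<and> s < t \<and> t \<le> b" if "(s, t) \<in> D'" for s t
      proof -
        from that obtain i where "i \<in> D" "(s, t) \<in> E i" by (auto simp: D'_def)
        then show "a \<le> s \<and> s < t \<and> t \<le> b"
          using Esub[of i s t] sysD by (fastforce simp: interval_system_def)
      qed
      show "t \<le> s' \<or> t' \<le> s"
        if "(s, t) \<in> D'" "(s', t') \<in> D'" and mn: "(s, t) \<noteq> (s', t')" for s t s' t'
      proof -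
        from that obtain i j where ij: "i \<in> D" "j \<in> D" "(s, t) \<in> E i" "(s', t') \<in> E j" by (auto simp: D'_def)
        show ?thesis
        proof (cases "i = j")
          case True
          then show ?thesis using interval_system_separated[OF E(1)[OF ij(1)]] ij mn by blast
        next
          case False
          then show ?thesis using Edisj[OF ij(1,2) False ij(3,4)] mn by simp
        qed
      qed
    qed
    have "(\<Sum>(s, t)\<in>D'. t - s) \<le> (\<Sum>(s, t)\<in>D. t - s)"
    proof (rule interval_system_length_le[OF sys' sysD], rule UN_least)
      fix q assume "q \<in> D'"
      then obtain i where i: "i \<in> D" "q \<in> E i" by (auto simp: D'_def)
      then have "(case q of (s, t) \<Rightarrow> {s<..<t}) \<subseteq> (case i of (s, t) \<Rightarrow> {s<..<t})"
        using Esub[of i "fst q" "snd q"] by (auto simp: case_prod_beta)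
      also have "\<dots> \<subseteq> (\<Union>(s, t)\<in>D. {s<..<t})"
        using i(1) by (rule UN_upper)
      finally show "(case q of (s, t) \<Rightarrow> {s<..<t}) \<subseteq> (\<Union>(s, t)\<in>D. {s<..<t})" .
    qed
    then have "increment_sum g D' < \<epsilon> / 2"
      using \<delta>[OF sys'] lenD by linarith
    moreover have "increment_sum g D' = (\<Sum>i\<in>D. increment_sum g (E i))"
      unfolding increment_sum_def D'_def using finD Efin Edisj' by (intro sum.UNION_disjoint) auto
    moreover have "(\<Sum>(c, d)\<in>D. variation_between g c d) \<le> (\<Sum>i\<in>D. increment_sum g (E i) + \<eta>)"
      using E(2) by (intro sum_mono) (fastforce simp: case_prod_beta)
    moreover have "card D * \<eta> \<le> \<epsilon> / 2"
      using \<open>0 < \<epsilon>\<close> by (simp add: \<eta>_def field_simps)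
    ultimately show "increment_sum (variation_between g a) D < \<epsilon>"
      unfolding varD by (simp add: sum.distrib)
  qed (fact \<open>\<delta> > 0\<close>)
qed

end

section \<open>The fundamental theorem for absolutely continuous functions\<close>

text \<open>The boxes may overlap, so their union is first retiled by a \<open>division_of\<close>.
  The pieces with interior form an interval system whose total length is the measure of the union,
  hence below \<delta>, while the Stieltjes measures of the pieces add up to its increment
  sum.\<close>

lemma emeasure_interval_measure_finite_union_less:
  assumes mono: "\<And>x y. x \<le> y \<Longrightarrow> F x \<le> F y" and cont: "continuous_on UNIV F"
    and \<delta>: "\<And>D. interval_system a b D \<Longrightarrow> (\<Sum>(s, t)\<in>D. t - s) < \<delta> \<Longrightarrow> increment_sum F D < \<epsilon>"
    and \<F>: "finite \<F>" "\<And>s. s \<in> \<F> \<Longrightarrow> \<exists>c d. s = cbox c (d::real)"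
    and sub: "\<Union>\<F> \<subseteq> {a..b}" and small: "emeasure lborel (\<Union>\<F>) < ennreal \<delta>"
  shows "emeasure (interval_measure F) (\<Union>\<F>) \<le> ennreal \<epsilon>"
proof -
  obtain p where p: "p division_of (\<Union>\<F>)"
    using elementary_unions_intervals[OF \<F>] by blast
  have pfin: "finite p" and pU: "\<Union>p = \<Union>\<F>" using division_ofD(1,6)[OF p] .
  have pI: "K = {Inf K..Sup K} \<and> Inf K \<le> Sup K \<and> a \<le> Inf K \<and> Sup K \<le> b" if K: "K \<in> p" for K
  proof -
    obtain c d where "K = {c..d}" "K \<noteq> {}"
      using division_ofD(3,4)[OF p K] by (metis box_real(2))
    moreover have "K \<subseteq> {a..b}" using sub pU that by blast
    ultimately show ?thesis by auto
  qed
  have Kb: "K \<in> sets borel" if "K \<in> p" for K using pI[OF that] by (metis atLeastAtMost_borel)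
  \<comment> \<open>One-point pieces have length and increment zero; they are removed because an
    interval system admits no degenerate pair.\<close>
  define p' where "p' = {K\<in>p. Inf K < Sup K}"
  define D where "D = (\<lambda>K. (Inf K, Sup K)) ` p'"
  have inj: "inj_on (\<lambda>K. (Inf K, Sup K)) p'"
    by (rule inj_onI) (metis (no_types, lifting) mem_Collect_eq p'_def pI prod.inject)
  have D: "interval_system a b D"
  proof (rule interval_systemI)
    show "finite D" using pfin by (simp add: D_def p'_def)
    show "a \<le> s \<and> s < t \<and> t \<le> b" if "(s, t) \<in> D" for s t
      using that pI by (auto simp: D_def p'_def)
    show "t \<le> s' \<or> t' \<le> s" if "(s, t) \<in> D" "(s', t') \<in> D" "(s, t) \<noteq> (s', t')" for s t s' t'
    proof -
      obtain K K' where K: "K \<in> p" "K' \<in> p" "s < t" "s' < t'" "s = Inf K" "t = Sup K" "s' = Inf K'" "t' = Sup K'"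
        using \<open>(s, t) \<in> D\<close> \<open>(s', t') \<in> D\<close> by (auto simp: D_def p'_def)
      then have "K = {s..t}" "K' = {s'..t'}" "K \<noteq> K'" using pI that by (blast, blast, auto)
      then have "{s<..<t} \<inter> {s'<..<t'} = {}"
        using division_ofD(5)[OF p K(1,2)] by simp
      then show ?thesis using Ioo_disjoint_iff[OF K(3,4)] by simp
    qed
  qed
  have sum_p: "(\<Sum>K\<in>p. f (Sup K) - f (Inf K)) = (\<Sum>(s, t)\<in>D. f t - f s)" for f :: "real \<Rightarrow> real"
  proof -
    have "(\<Sum>K\<in>p. f (Sup K) - f (Inf K)) = (\<Sum>K\<in>p'. f (Sup K) - f (Inf K))"
    proof (rule sum.mono_neutral_right[OF pfin])
      show "p' \<subseteq> p" by (auto simp: p'_def)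
      show "\<forall>K\<in>p - p'. f (Sup K) - f (Inf K) = 0"
      proof
        fix K assume "K \<in> p - p'"
        then have "Inf K = Sup K"
          using pI[of K] unfolding p'_def by (metis (no_types, lifting) DiffD1 DiffD2 mem_Collect_eq order_le_less)
        then show "f (Sup K) - f (Inf K) = 0" by simp
      qed
    qed
    then show ?thesis
      unfolding D_def by (subst sum.reindex[OF inj]) simp
  qed
  have "ennreal (\<Sum>(s, t)\<in>D. t - s) = ennreal (\<Sum>K\<in>p. measure lborel K)"
    unfolding sum_p[of "\<lambda>x. x", symmetric]
    by (intro arg_cong[where f=ennreal] sum.cong refl) (metis content_real pI)
  also have "\<dots> = emeasure lborel (\<Union>\<F>)"
  proof -
    have "measure lborel (\<Union>\<F>) = (\<Sum>K\<in>p. measure lborel K)"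
    proof -
      have "\<Union>p \<in> sets borel" using pfin Kb by (intro sets.finite_Union) auto
      then have "measure lborel (\<Union>\<F>) = measure lebesgue (\<Union>\<F>)" by (simp add: pU)
      also have "\<dots> = (\<Sum>K\<in>p. measure lebesgue K)" using content_division[OF p] by simp
      also have "\<dots> = (\<Sum>K\<in>p. measure lborel K)" using Kb by (intro sum.cong) simp_all
      finally show ?thesis .
    qed
    moreover have "emeasure lborel (\<Union>\<F>) \<noteq> \<infinity>" using small by auto
    ultimately show ?thesis by (simp add: emeasure_eq_ennreal_measure)
  qed
  finally have "(\<Sum>(s, t)\<in>D. t - s) < \<delta>"
    using small by (metis ennreal_less_iff interval_system_length[OF D] measure_nonneg)
  then have less: "increment_sum F D < \<epsilon>" by (rule \<delta>[OF D])
  have "emeasure (interval_measure F) (\<Union>\<F>) \<le> (\<Sum>K\<in>p. emeasure (interval_measure F) K)"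
    using emeasure_subadditive_finite[OF pfin, of "\<lambda>K. K" "interval_measure F"] Kb
    by (simp add: pU image_subset_iff subset_iff)
  also have "\<dots> = (\<Sum>K\<in>p. ennreal (F (Sup K) - F (Inf K)))"
  proof (rule sum.cong[OF refl])
    fix K assume "K \<in> p"
    have K: "K = {Inf K..Sup K}" "Inf K \<le> Sup K" using pI[OF \<open>K \<in> p\<close>] by (blast, blast)
    have "emeasure (interval_measure F) {Inf K..Sup K} = ennreal (F (Sup K) - F (Inf K))"
      by (rule emeasure_interval_measure_Icc[of "Inf K" "Sup K" F, OF K(2) mono cont])
    with arg_cong[OF K(1), of "emeasure (interval_measure F)"]
    show "emeasure (interval_measure F) K = ennreal (F (Sup K) - F (Inf K))"
      by (rule trans)
  qed
  also have "\<dots> = ennreal (\<Sum>K\<in>p. F (Sup K) - F (Inf K))"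
    using pI mono by (intro sum_ennreal) (simp add: mono)
  also have "\<dots> = ennreal (increment_sum F D)"
    unfolding sum_p increment_sum_def
    using D mono by (intro arg_cong[where f=ennreal] sum.cong) (auto simp: interval_system_def less_imp_le)
  also have "\<dots> \<le> ennreal \<epsilon>" using less by (intro ennreal_leI) simp
  finally show ?thesis .
qed

text \<open>Outer regularity covers \<open>N\<close> by an open set of measure below \<delta>. That
  set is exhausted by finite unions of boxes, each of Stieltjes measure at most \<epsilon>, and
  continuity from below passes the bound to the limit.\<close>

lemma null_set_interval_measure:
  assumes mono: "\<And>x y. x \<le> y \<Longrightarrow> F x \<le> F y" and cont: "continuous_on UNIV F"
    and ac: "abs_cont_on_Icc a b F"
    and N: "N \<in> null_sets lborel" "N \<subseteq> {a<..<b}"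
  shows "N \<in> null_sets (interval_measure F)"
proof -
  let ?\<mu> = "interval_measure F"
  have Nb: "N \<in> sets borel" using N by auto
  have le: "emeasure ?\<mu> N \<le> ennreal \<epsilon>" if \<epsilon>: "0 < \<epsilon>" for \<epsilon>
  proof -
    obtain \<delta> where "\<delta> > 0" and \<delta>: "\<And>D. interval_system a b D \<Longrightarrow> (\<Sum>(s, t)\<in>D. t - s) < \<delta> \<Longrightarrow>
        increment_sum F D < \<epsilon>"
      using ac[unfolded abs_cont_on_Icc_iff, rule_format, OF \<epsilon>] by auto
    obtain U where U: "open U" "N \<subseteq> U" "emeasure lborel (U - N) < ennreal \<delta>"
      using outer_regular_lborel[OF Nb \<open>\<delta> > 0\<close>] by metis
    \<comment> \<open>The cut keeps every box inside \<open>{a..b}\<close>, where \<open>F\<close>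
      is assumed to be absolutely continuous.\<close>
    define U' where "U' = U \<inter> {a<..<b}"
    have U'_sub: "U' \<subseteq> {a..b}" by (auto simp: U'_def)
    have "open U'" "N \<subseteq> U'" using U N by (auto simp: U'_def)
    have "emeasure lborel U' \<le> emeasure lborel (U - N \<union> N)"
      using U Nb by (intro emeasure_mono) (auto simp: U'_def)
    also have "\<dots> \<le> emeasure lborel (U - N) + emeasure lborel N"
      using U Nb by (intro emeasure_subadditive) auto
    also have "\<dots> < ennreal \<delta>" using U(3) N(1) by (simp add: null_setsD1)
    finally have U'small: "emeasure lborel U' < ennreal \<delta>" .
    obtain \<D> where \<D>: "countable \<D>" "\<D> \<subseteq> Pow U'" "\<And>X. X \<in> \<D> \<Longrightarrow> \<exists>a b. X = cbox a b" "\<Union>\<D> = U'"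
      using open_countable_Union_open_cbox[OF \<open>open U'\<close>] by metis
    \<comment> \<open>\<open>from_nat_into\<close> enumerates only a nonempty family, so the empty
      one is treated apart.\<close>
    show ?thesis
    proof (cases "\<D> = {}")
      case True
      then have "N = {}" using \<D>(4) \<open>N \<subseteq> U'\<close> by auto
      then show ?thesis by simp
    next
      case False
      define A where "A k = \<Union>(from_nat_into \<D> ` {..k})" for k :: nat
      have AD: "from_nat_into \<D> ` {..k} \<subseteq> \<D>" for k
        using from_nat_into[OF False] by blast
      have A_sub: "A k \<subseteq> U'" for k
        using AD[of k] \<D>(4) unfolding A_def by blast
      have AU: "(\<Union>k. A k) = U'"
      proof
        show "(\<Union>k. A k) \<subseteq> U'" using A_sub by blast
        show "U' \<subseteq> (\<Union>k. A k)"
        proof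
          fix x assume "x \<in> U'"
          then obtain X where "X \<in> \<D>" "x \<in> X" using \<D>(4) by blast
          then show "x \<in> (\<Union>k. A k)"
            using from_nat_into_surj[OF \<D>(1)] unfolding A_def by blast
        qed
      qed
      have Ab: "A k \<in> sets borel" for k
      proof -
        have "X \<in> sets borel" if "X \<in> \<D>" for X using \<D>(3)[OF that] by auto
        then show ?thesis
          unfolding A_def using AD[of k] by (intro sets.finite_Union) auto
      qed
      have "emeasure ?\<mu> (A k) \<le> ennreal \<epsilon>" for k
        unfolding A_def
      proof (rule emeasure_interval_measure_finite_union_less[of F a b \<delta> \<epsilon>, OF mono cont \<delta>])
        show "\<Union> (from_nat_into \<D> ` {..k}) \<subseteq> {a..b}"
          using order_trans[OF A_sub[of k] U'_sub] unfolding A_def .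
        have "emeasure lborel (A k) \<le> emeasure lborel U'"
          by (rule emeasure_mono[OF A_sub]) (use \<open>open U'\<close> in simp)
        then show "emeasure lborel (\<Union> (from_nat_into \<D> ` {..k})) < ennreal \<delta>"
          using U'small unfolding A_def by simp
        show "\<exists>c d. s = cbox c d" if "s \<in> from_nat_into \<D> ` {..k}" for s
          using that AD \<D>(3) by blast
      qed simp_all
      moreover have "emeasure ?\<mu> U' = (SUP k. emeasure ?\<mu> (A k))"
        unfolding AU[symmetric] using Ab
        by (intro SUP_emeasure_incseq[symmetric])
          (auto simp: incseq_def A_def, meson atMost_iff order_trans)
      ultimately have "emeasure ?\<mu> U' \<le> ennreal \<epsilon>" by (simp add: SUP_least)
      moreover have "emeasure ?\<mu> N \<le> emeasure ?\<mu> U'"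
        using \<open>N \<subseteq> U'\<close> \<open>open U'\<close> by (intro emeasure_mono) auto
      ultimately show ?thesis by simp
    qed
  qed
  have "emeasure ?\<mu> N \<le> 0"
    by (rule ennreal_le_epsilon) (simp add: le)
  then show ?thesis using Nb by (simp add: null_sets_def)
qed

text \<open>The Stieltjes measure restricted to the open interval is absolutely continuous, and its
  Radon-Nikodym density is finite almost everywhere because the restricted mass is finite. The
  restriction leaves out \<open>b\<close>, hence \<open>y < b\<close>; it also leaves out
  \<open>a\<close>, which \<open>{x<..y}\<close> avoids even for \<open>x = a\<close>.\<close>

lemma abs_cont_mono_density:
  assumes mono: "\<And>x y. x \<le> y \<Longrightarrow> F x \<le> F y" and cont: "continuous_on UNIV F"
    and ac: "abs_cont_on_Icc a b F"
  obtains \<phi> :: "real \<Rightarrow> real" where "integrable lborel \<phi>"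
    "\<And>x y. a \<le> x \<Longrightarrow> x \<le> y \<Longrightarrow> y < b \<Longrightarrow> F y - F x = (LINT t:{x..y}|lborel. \<phi> t)"
proof -
  have right_cont: "continuous (at_right x) F" for x
    using cont by (simp add: continuous_on_eq_continuous_at continuous_at_imp_continuous_within)
  have Ioc: "emeasure (interval_measure F) {x<..y} = ennreal (F y - F x)" if "x \<le> y" for x y
    using emeasure_interval_measure_Ioc[OF that mono right_cont] .
  define \<nu> where "\<nu> = density (interval_measure F) (indicator {a<..<b})"
  have \<nu>: "emeasure \<nu> A = emeasure (interval_measure F) (A \<inter> {a<..<b})" if "A \<in> sets borel" for A
  proof -
    have "emeasure \<nu> A = (\<integral>\<^sup>+x. indicator {a<..<b} x * indicator A x \<partial>interval_measure F)"
      unfolding \<nu>_def using that by (intro emeasure_density) auto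
    also have "\<dots> = (\<integral>\<^sup>+x. indicator (A \<inter> {a<..<b}) x \<partial>interval_measure F)"
      by (intro nn_integral_cong) (auto split: split_indicator)
    also have "\<dots> = emeasure (interval_measure F) (A \<inter> {a<..<b})"
      using that by (intro nn_integral_indicator) auto
    finally show ?thesis .
  qed
  have "absolutely_continuous lborel \<nu>"
    unfolding absolutely_continuous_def
  proof
    fix N :: "real set" assume N: "N \<in> null_sets lborel"
    then have "N \<inter> {a<..<b} \<in> null_sets lborel" by (intro null_set_Int2) auto
    then have "N \<inter> {a<..<b} \<in> null_sets (interval_measure F)"
      by (intro null_set_interval_measure[of F a b, OF mono cont ac]) auto
    then show "N \<in> null_sets \<nu>" using N \<nu>[of N] by (auto simp: null_sets_def \<nu>_def)
  qed
  moreover have "sets \<nu> = sets lborel" by (simp add: \<nu>_def)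
  ultimately obtain f where f [measurable]: "f \<in> borel_measurable borel" and fd: "density lborel f = \<nu>"
    using sigma_finite_measure.Radon_Nikodym[OF sigma_finite_lborel, of \<nu>] by auto
  have "integral\<^sup>N lborel f = emeasure \<nu> UNIV"
    using f by (simp add: fd[symmetric] emeasure_density)
  \<comment> \<open>\<open>max a b\<close> gives a correctly ordered interval also when
    \<open>b < a\<close>.\<close>
  also have "\<dots> \<le> emeasure (interval_measure F) {a<..max a b}"
    by (subst \<nu>) (auto intro!: emeasure_mono)
  also have "\<dots> < \<infinity>" by (simp add: Ioc)
  finally have fin: "integral\<^sup>N lborel f < \<infinity>" .
  then have AEf: "AE x in lborel. f x \<noteq> \<infinity>" using f by (intro nn_integral_noteq_infinite) auto
  have nn: "(\<integral>\<^sup>+x. ennreal (enn2real (f x)) * indicator A x \<partial>lborel) = (\<integral>\<^sup>+x. f x * indicator A x \<partial>lborel)" for A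
    using AEf by (intro nn_integral_cong_AE) (auto simp: less_top)
  have int: "integrable lborel (\<lambda>x. enn2real (f x))"
    using fin nn[of UNIV] by (intro integrableI_nonneg) auto
  show ?thesis
  proof (rule that[OF int])
    fix x y assume xy: "a \<le> x" "x \<le> y" "y < b"
    have "ennreal (LINT t:{x..y}|lborel. enn2real (f t)) = (\<integral>\<^sup>+t. ennreal (enn2real (f t)) * indicator {x..y} t \<partial>lborel)"
    proof -
      have "integrable lborel (\<lambda>t. indicator {x..y} t *\<^sub>R enn2real (f t))"
        using int by (intro integrable_mult_indicator) auto
      then have "ennreal (LINT t:{x..y}|lborel. enn2real (f t)) = (\<integral>\<^sup>+t. ennreal (indicator {x..y} t *\<^sub>R enn2real (f t)) \<partial>lborel)"
        unfolding set_lebesgue_integral_def by (intro nn_integral_eq_integral[symmetric]) auto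
      also have "\<dots> = (\<integral>\<^sup>+t. ennreal (enn2real (f t)) * indicator {x..y} t \<partial>lborel)"
        by (intro nn_integral_cong) (auto split: split_indicator)
      finally show ?thesis .
    qed
    \<comment> \<open>The left endpoint is a Lebesgue null set; the half-open interval is the one
      whose Stieltjes measure is the increment of \<open>F\<close>.\<close>
    also have "\<dots> = (\<integral>\<^sup>+t. f t * indicator {x<..y} t \<partial>lborel)"
      unfolding nn using AE_lborel_singleton[of x]
      by (intro nn_integral_cong_AE) (auto split: split_indicator)
    also have "\<dots> = emeasure \<nu> {x<..y}" by (simp add: fd[symmetric] emeasure_density)
    also have "\<dots> = ennreal (F y - F x)"
      using xy Ioc[OF xy(2)] by (subst \<nu>) (auto simp: Int_absorb2 subset_eq)
    finally show "F y - F x = (LINT t:{x..y}|lborel. enn2real (f t))"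
      using mono[OF xy(2)] by (subst (asm) ennreal_inj) (auto simp: set_lebesgue_integral_def intro!: Bochner_Integration.integral_nonneg)
  qed
qed

section \<open>From monotone to general absolutely continuous functions\<close>

lemma abs_cont_on_Icc_continuous:
  assumes ac: "abs_cont_on_Icc a b g"
  shows "continuous_on {a..b} g"
proof (rule continuous_onI)
  fix x \<epsilon> :: real assume x: "x \<in> {a..b}" and "0 < \<epsilon>"
  then obtain \<delta> where "\<delta> > 0" and \<delta>: "\<And>D. interval_system a b D \<Longrightarrow> (\<Sum>(s, t)\<in>D. t - s) < \<delta> \<Longrightarrow>
      increment_sum g D < \<epsilon>"
    using ac[unfolded abs_cont_on_Icc_iff, rule_format, of \<epsilon>] by auto
  have less: "\<bar>g t - g s\<bar> < \<epsilon>" if "a \<le> s" "s < t" "t \<le> b" "t - s < \<delta>" for s t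
    using \<delta>[of "{(s, t)}"] interval_system_single[of a s t b] that by (simp add: increment_sum_def)
  show "\<exists>d>0. \<forall>x'\<in>{a..b}. dist x' x < d \<longrightarrow> dist (g x') (g x) \<le> \<epsilon>"
  proof (intro exI[of _ \<delta>] conjI ballI impI)
    fix x' assume "x' \<in> {a..b}" "dist x' x < \<delta>"
    then show "dist (g x') (g x) \<le> \<epsilon>"
      using less[of x x'] less[of x' x] x \<open>0 < \<epsilon>\<close>
      by (cases x x' rule: linorder_cases) (auto simp: dist_real_def abs_minus_commute)
  qed (fact \<open>\<delta> > 0\<close>)
qed

lemma locally_abs_cont_on_continuous:
  assumes "locally_abs_cont_on S g" "open S"
  shows "continuous_on S g"
proof (rule continuous_at_imp_continuous_on, rule ballI)
  fix x assume "x \<in> S"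
  then obtain e where "e > 0" "cball x e \<subseteq> S" using \<open>open S\<close> open_contains_cball by blast
  then have "abs_cont_on_Icc (x - e) (x + e) g"
    using assms(1) by (simp add: locally_abs_cont_on_def cball_eq_atLeastAtMost)
  then have "continuous_on {x - e..x + e} g" by (rule abs_cont_on_Icc_continuous)
  then show "isCont g x"
    using \<open>e > 0\<close> by (simp add: continuous_on_interior)
qed

lemma abs_cont_on_Icc_cong:
  assumes "abs_cont_on_Icc a b f" "\<And>x. a \<le> x \<Longrightarrow> x \<le> b \<Longrightarrow> f x = g x"
  shows "abs_cont_on_Icc a b g"
proof -
  have "increment_sum f D = increment_sum g D" if "interval_system a b D" for D
    unfolding increment_sum_def
    using that assms(2) by (intro sum.cong refl) (fastforce simp: interval_system_def)
  then show ?thesis using assms(1) unfolding abs_cont_on_Icc_iff by metis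
qed

lemma abs_cont_on_Icc_diff:
  assumes f: "abs_cont_on_Icc a b f" and g: "abs_cont_on_Icc a b g"
  shows "abs_cont_on_Icc a b (\<lambda>x. f x - g x)"
  unfolding abs_cont_on_Icc_iff
proof (intro allI impI)
  fix \<epsilon> :: real assume "0 < \<epsilon>"
  then have e2: "0 < \<epsilon> / 2" by simp
  obtain \<delta>1 where d1: "\<delta>1 > 0" "\<And>D. interval_system a b D \<Longrightarrow> (\<Sum>(s, t)\<in>D. t - s) < \<delta>1 \<Longrightarrow>
      increment_sum f D < \<epsilon> / 2"
    using f[unfolded abs_cont_on_Icc_iff, rule_format, OF e2] by blast
  obtain \<delta>2 where d2: "\<delta>2 > 0" "\<And>D. interval_system a b D \<Longrightarrow> (\<Sum>(s, t)\<in>D. t - s) < \<delta>2 \<Longrightarrow>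
      increment_sum g D < \<epsilon> / 2"
    using g[unfolded abs_cont_on_Icc_iff, rule_format, OF e2] by blast
  show "\<exists>\<delta>>0. \<forall>D. interval_system a b D \<longrightarrow> (\<Sum>(s, t)\<in>D. t - s) < \<delta> \<longrightarrow>
      increment_sum (\<lambda>x. f x - g x) D < \<epsilon>"
  proof (intro exI[of _ "min \<delta>1 \<delta>2"] conjI allI impI)
    fix D assume D: "interval_system a b D" "(\<Sum>(s, t)\<in>D. t - s) < min \<delta>1 \<delta>2"
    have "increment_sum (\<lambda>x. f x - g x) D \<le> increment_sum f D + increment_sum g D"
      unfolding increment_sum_def sum.distrib[symmetric] by (intro sum_mono) auto
    also have "\<dots> < \<epsilon>" using d1(2)[of D] d2(2)[of D] D by simp
    finally show "increment_sum (\<lambda>x. f x - g x) D < \<epsilon>" .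
  qed (use d1 d2 in simp)
qed

lemma integrable_imp_set_integrable:
  fixes f :: "real \<Rightarrow> real"
  assumes "integrable M f" "A \<in> sets M"
  shows "set_integrable M A f"
  unfolding set_integrable_def using assms by (intro integrable_mult_indicator)

text \<open>Jordan decomposition: \<open>g\<close> is \<open>V\<close> minus \<open>V - g\<close>,
  and both are increasing since the increments of \<open>g\<close> are dominated by those of its
  variation function \<open>V\<close>. The two densities are subtracted.\<close>

lemma abs_cont_bounded_variation_density:
  assumes ac: "abs_cont_on_Icc a b g" and "a \<le> b"
    and bound: "\<And>D. interval_system a b D \<Longrightarrow> increment_sum g D \<le> B"
  obtains \<phi> :: "real \<Rightarrow> real" where "integrable lborel \<phi>"
    "\<And>x y. a \<le> x \<Longrightarrow> x \<le> y \<Longrightarrow> y < b \<Longrightarrow> g y - g x = (LINT t:{x..y}|lborel. \<phi> t)"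
proof -
  \<comment> \<open>Projects the line onto \<open>[a, b]\<close>. Composed with it, the two
    functions become monotone and continuous on the whole line, as a Stieltjes measure requires, and
    keep their values on \<open>[a, b]\<close>.\<close>
  define clamp where "clamp = (\<lambda>x. max a (min b x))"
  define V where "V = variation_between g a"
  have clamp: "a \<le> clamp x" "clamp x \<le> b" for x using \<open>a \<le> b\<close> by (auto simp: clamp_def)
  have clamp_mono: "clamp x \<le> clamp y" if "x \<le> y" for x y using that by (auto simp: clamp_def)
  have clamp_id: "clamp x = x" if "a \<le> x" "x \<le> b" for x using that by (auto simp: clamp_def)
  have clamp_cont: "continuous_on UNIV clamp" unfolding clamp_def by (intro continuous_intros)
  have cont_clamp: "continuous_on UNIV (\<lambda>x. f (clamp x))" if "abs_cont_on_Icc a b f" for f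
    using abs_cont_on_Icc_continuous[OF that] clamp_cont clamp
    by (intro continuous_on_compose2[of "{a..b}" f UNIV clamp]) auto
  have incr: "\<bar>g y - g x\<bar> \<le> V y - V x" if "a \<le> x" "x \<le> y" "y \<le> b" for x y
    using abs_diff_le_variation[of a b g B x y] variation_add[of a b g B a x y] bound that
    by (simp add: V_def)
  have acV: "abs_cont_on_Icc a b V" unfolding V_def by (rule abs_cont_variation[OF bound ac])
  have acV': "abs_cont_on_Icc a b (\<lambda>x. V x - g x)" by (rule abs_cont_on_Icc_diff[OF acV ac])
  have mono1: "V (clamp x) \<le> V (clamp y)" if "x \<le> y" for x y
    using incr[OF clamp(1) clamp_mono[OF that] clamp(2)] by linarith
  have mono2: "V (clamp x) - g (clamp x) \<le> V (clamp y) - g (clamp y)" if "x \<le> y" for x y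
    using incr[OF clamp(1) clamp_mono[OF that] clamp(2)] by linarith
  obtain \<phi>1 :: "real \<Rightarrow> real" where \<phi>1: "integrable lborel \<phi>1"
    "\<And>x y. a \<le> x \<Longrightarrow> x \<le> y \<Longrightarrow> y < b \<Longrightarrow> V (clamp y) - V (clamp x) = (LINT t:{x..y}|lborel. \<phi>1 t)"
    using abs_cont_mono_density[of "\<lambda>x. V (clamp x)" a b, OF mono1 cont_clamp[OF acV]
      abs_cont_on_Icc_cong[OF acV]] clamp_id by auto
  obtain \<phi>2 :: "real \<Rightarrow> real" where \<phi>2: "integrable lborel \<phi>2"
    "\<And>x y. a \<le> x \<Longrightarrow> x \<le> y \<Longrightarrow> y < b \<Longrightarrow> (V (clamp y) - g (clamp y)) - (V (clamp x) - g (clamp x))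
      = (LINT t:{x..y}|lborel. \<phi>2 t)"
    using abs_cont_mono_density[of "\<lambda>x. V (clamp x) - g (clamp x)" a b, OF mono2 cont_clamp[OF acV']
      abs_cont_on_Icc_cong[OF acV']] clamp_id by auto
  show ?thesis
  proof (rule that[of "\<lambda>t. \<phi>1 t - \<phi>2 t"])
    show "integrable lborel (\<lambda>t. \<phi>1 t - \<phi>2 t)" using \<phi>1(1) \<phi>2(1) by simp
    fix x y assume xy: "a \<le> x" "x \<le> y" "y < b"
    have "set_integrable lborel {x..y} \<phi>1" "set_integrable lborel {x..y} \<phi>2"
      using \<phi>1(1) \<phi>2(1) by (simp_all add: integrable_imp_set_integrable)
    then show "g y - g x = (LINT t:{x..y}|lborel. \<phi>1 t - \<phi>2 t)"
      using \<phi>1(2)[OF xy] \<phi>2(2)[OF xy] clamp_id xy by simp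
  qed
qed

lemma set_integral_Icc_combine:
  fixes f :: "real \<Rightarrow> real"
  assumes "a \<le> b" "b \<le> c" "set_integrable lborel {a..c} f"
  shows "(LINT t:{a..c}|lborel. f t) = (LINT t:{a..b}|lborel. f t) + (LINT t:{b..c}|lborel. f t)"
proof -
  have 1: "set_integrable lborel {a..b} f" "set_integrable lborel {b..c} f"
    using assms by (auto intro: set_integrable_subset[OF assms(3)])
  have "(LINT t:{a..b} \<union> {b..c}|lborel. f t) = (LINT t:{a..b}|lborel. f t) + (LINT t:{b..c}|lborel. f t)"
    using AE_lborel_singleton[of b] 1 by (intro set_integral_Un_AE) auto
  moreover have "{a..b} \<union> {b..c} = {a..c}" using assms by auto
  ultimately show ?thesis by simp
qed

text \<open>Increment sums are bounded at once on intervals shorter than the \<delta> that goes with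
  \<epsilon> = 1. The Bolzano principle therefore asks for densities on short intervals around each
  point and for a way to glue those of adjacent intervals.\<close>

lemma locally_abs_cont_density:
  assumes g: "locally_abs_cont_on UNIV g" and "a \<le> b"
  shows "\<exists>\<phi> :: real \<Rightarrow> real. integrable lborel \<phi> \<and>
    (\<forall>x y. a \<le> x \<and> x \<le> y \<and> y \<le> b \<longrightarrow> g y - g x = (LINT t:{x..y}|lborel. \<phi> t))"
  using \<open>a \<le> b\<close>
proof (induction rule: Bolzano)
  case (trans a b c)
  obtain \<phi>1 :: "real \<Rightarrow> real" where \<phi>1: "integrable lborel \<phi>1"
    "\<And>x y. a \<le> x \<Longrightarrow> x \<le> y \<Longrightarrow> y \<le> b \<Longrightarrow> g y - g x = (LINT t:{x..y}|lborel. \<phi>1 t)"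
    using trans(1) by blast
  obtain \<phi>2 :: "real \<Rightarrow> real" where \<phi>2: "integrable lborel \<phi>2"
    "\<And>x y. b \<le> x \<Longrightarrow> x \<le> y \<Longrightarrow> y \<le> c \<Longrightarrow> g y - g x = (LINT t:{x..y}|lborel. \<phi>2 t)"
    using trans(2) by blast
  \<comment> \<open>Both densities are valid at the common endpoint \<open>b\<close> only; which one
    is chosen there is immaterial, a point being null.\<close>
  define \<phi> where "\<phi> t = indicator {..b} t *\<^sub>R \<phi>1 t + indicator {b<..} t *\<^sub>R \<phi>2 t" for t
  have int: "integrable lborel \<phi>"
    unfolding \<phi>_def using \<phi>1(1) \<phi>2(1)
    by (intro Bochner_Integration.integrable_add integrable_mult_indicator) auto
  have \<phi>_eq: "\<phi> t = \<phi>2 t" if "b < t" for t using that by (simp add: \<phi>_def)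
  have left: "g y - g x = (LINT t:{x..y}|lborel. \<phi> t)" if "a \<le> x" "x \<le> y" "y \<le> b" for x y
    unfolding \<phi>1(2)[OF that] using that
    by (intro set_lebesgue_integral_cong) (auto simp: \<phi>_def)
  have right: "g y - g x = (LINT t:{x..y}|lborel. \<phi> t)" if "b \<le> x" "x \<le> y" "y \<le> c" for x y
    unfolding \<phi>2(2)[OF that] using that AE_lborel_singleton[of b] \<phi>2(1) borel_measurable_integrable[OF int]
    by (intro set_lebesgue_integral_cong_AE) (auto simp: \<phi>_eq)
  have "g y - g x = (LINT t:{x..y}|lborel. \<phi> t)" if "a \<le> x" "x \<le> y" "y \<le> c" for x y
  proof -
    consider "y \<le> b" | "b \<le> x" | "x \<le> b" "b \<le> y" by linarith
    then show ?thesis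
    proof cases
      case 3
      then show ?thesis
        using left[of x b] right[of b y] that
          set_integral_Icc_combine[OF 3 integrable_imp_set_integrable[OF int]] by simp
    qed (use left right that in auto)
  qed
  with int show ?case by blast
next
  case (local x)
  \<comment> \<open>One unit of room on each side, so that a window of length
    \<open>d \<le> 1\<close> containing a point of \<open>[a, b]\<close> stays inside.\<close>
  have "abs_cont_on_Icc (a - 1) (b + 1) g"
    using g \<open>a \<le> b\<close> by (simp add: locally_abs_cont_on_def)
  then obtain \<delta> where \<delta>: "\<delta> > 0" "\<And>D. interval_system (a - 1) (b + 1) D \<Longrightarrow> (\<Sum>(s, t)\<in>D. t - s) < \<delta> \<Longrightarrow>
      increment_sum g D < 1"
    unfolding abs_cont_on_Icc_iff by (metis zero_less_one)
  define d where "d = min 1 (\<delta> / 2)"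
  have d: "0 < d" "d \<le> 1" "d < \<delta>" using \<delta>(1) by (auto simp: d_def)
  show ?case
  proof (intro exI[of _ d] conjI allI impI)
    fix c e assume ce: "c \<le> x \<and> x \<le> e \<and> e - c < d"
    \<comment> \<open>The window reaches past \<open>e\<close>, since the density obtained from it
      covers only \<open>y < c + d\<close>.\<close>
    have "abs_cont_on_Icc c (c + d) g"
      using g d by (simp add: locally_abs_cont_on_def)
    moreover have "increment_sum g D \<le> 1" if D: "interval_system c (c + d) D" for D
    proof -
      have "(\<Sum>(s, t)\<in>D. t - s) < \<delta>"
        using interval_system_length_le_diff[OF D] d by simp
      moreover have "interval_system (a - 1) (b + 1) D"
        using interval_system_mono[OF D, of "a - 1" "b + 1"] ce local d by simp
      ultimately show ?thesis using \<delta>(2)[of D] by simp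
    qed
    ultimately obtain \<phi> :: "real \<Rightarrow> real" where "integrable lborel \<phi>"
      "\<And>x y. c \<le> x \<Longrightarrow> x \<le> y \<Longrightarrow> y < c + d \<Longrightarrow> g y - g x = (LINT t:{x..y}|lborel. \<phi> t)"
      using abs_cont_bounded_variation_density[of c "c + d" g 1] d by auto
    then show "\<exists>\<phi> :: real \<Rightarrow> real. integrable lborel \<phi> \<and>
      (\<forall>x y. c \<le> x \<and> x \<le> y \<and> y \<le> e \<longrightarrow> g y - g x = (LINT t:{x..y}|lborel. \<phi> t))"
      using ce by (intro exI[of _ \<phi>]) auto
  qed (fact d(1))
qed

section \<open>Differentiation of indefinite integrals almost everywhere\<close>

lemma AE_right_difference_quotient:
  fixes \<phi> :: "real \<Rightarrow> real"
  assumes "integrable lborel \<phi>"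
  shows "AE x in lborel. \<forall>e>0. \<exists>d>0. \<forall>h. 0 < h \<and> h < d \<longrightarrow>
    \<bar>(LINT t:{x..x + h}|lborel. \<phi> t) / h - \<phi> x\<bar> < e"
proof -
  have int: "set_integrable lborel {a..b} \<phi>" for a b
    using assms by (rule integrable_imp_set_integrable) simp
  have "\<phi> integrable_on cbox a b" for a b
    using set_borel_integral_eq_integral(1)[OF int[of a b]] by simp
  \<comment> \<open>The differentiation theorem averages over the box with lower corner
    \<open>x\<close>, which on the line is the interval to the right of \<open>x\<close>. Its
    exceptional set is null for the completed measure, from which the statement descends to
    \<open>lborel\<close>.\<close>
  then obtain N where N: "negligible N" "\<And>x e. x \<notin> N \<Longrightarrow> 0 < e \<Longrightarrow> \<exists>d>0. \<forall>h. 0 < h \<and> h < d \<longrightarrow>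
      norm (integral (cbox x (x + h *\<^sub>R One)) \<phi> /\<^sub>R h ^ DIM(real) - \<phi> x) < e"
    using integrable_ccontinuous_explicit[of \<phi>] by metis
  have "AE x in lebesgue. x \<notin> N"
    using N(1) by (intro AE_not_in) (simp add: negligible_iff_null_sets)
  then have "AE x in lborel. x \<notin> N" by (simp add: AE_completion_iff)
  then show ?thesis
  proof (eventually_elim, intro allI impI)
    fix x e :: real assume "x \<notin> N" "0 < e"
    from N(2)[OF this] show "\<exists>d>0. \<forall>h. 0 < h \<and> h < d \<longrightarrow> \<bar>(LINT t:{x..x + h}|lborel. \<phi> t) / h - \<phi> x\<bar> < e"
      using set_borel_integral_eq_integral(2)[OF int] by (simp add: divide_inverse mult.commute)
  qed
qed

text \<open>Serves to turn right difference quotients into left ones. \<open>P\<close> need not be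
  measurable, so the reflection is applied to the complement of a Borel null set outside of which
  \<open>P\<close> holds.\<close>

lemma AE_lborel_reflect:
  fixes P :: "real \<Rightarrow> bool"
  assumes "AE x in lborel. P x"
  shows "AE x in lborel. P (- x)"
proof -
  obtain N where N: "\<And>x. x \<notin> N \<Longrightarrow> P x" "N \<in> null_sets lborel"
    using AE_E3[OF assms] by auto
  have "AE x in lborel. x \<notin> N" using N(2) by (rule AE_not_in)
  then have "AE x in lborel. - x \<notin> N"
  proof -
    have "Measurable.pred borel (\<lambda>x. x \<notin> N)" using N(2) by (intro pred_intros_logic) auto
    then show ?thesis
      using AE_borel_affine[of "-1" "\<lambda>x. x \<notin> N" 0] \<open>AE x in lborel. x \<notin> N\<close> by simp
  qed
  then show ?thesis by eventually_elim (rule N(1))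
qed

text \<open>A left mean of \<open>\<phi>\<close> at \<open>x\<close> is a right mean of
  \<open>\<lambda>t. \<phi> (- t)\<close> at \<open>- x\<close>, so the one-sided theorem, applied
  to both functions, gives the two-sided derivative.\<close>

lemma AE_DERIV_of_density:
  fixes \<phi> G :: "real \<Rightarrow> real"
  assumes int: "integrable lborel \<phi>"
    and G: "\<And>x y. a \<le> x \<Longrightarrow> x \<le> y \<Longrightarrow> y \<le> b \<Longrightarrow> G y - G x = (LINT t:{x..y}|lborel. \<phi> t)"
  shows "AE x in lborel. a < x \<and> x < b \<longrightarrow> (G has_real_derivative \<phi> x) (at x)"
proof -
  have int': "integrable lborel (\<lambda>x. \<phi> (- x))"
    using lborel_integrable_real_affine[OF int, of "-1" 0] by simp
  have "AE x in lborel. \<forall>e>0. \<exists>d>0. \<forall>h. 0 < h \<and> h < d \<longrightarrow>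
    \<bar>(LINT t:{x..x + h}|lborel. \<phi> (- t)) / h - \<phi> (- x)\<bar> < e"
    by (rule AE_right_difference_quotient[OF int'])
  then have "AE x in lborel. \<forall>e>0. \<exists>d>0. \<forall>h. 0 < h \<and> h < d \<longrightarrow>
    \<bar>(LINT t:{- x..- x + h}|lborel. \<phi> (- t)) / h - \<phi> (- (- x))\<bar> < e"
    by (rule AE_lborel_reflect)
  moreover have "(LINT t:{- x..- x + h}|lborel. \<phi> (- t)) = (LINT t:{x - h..x}|lborel. \<phi> t)" for x h
  proof -
    have "(LINT t|lborel. indicator {x - h..x} t *\<^sub>R \<phi> t) =
      (LINT t|lborel. indicator {x - h..x} (- t) *\<^sub>R \<phi> (- t))"
      using lborel_integral_real_affine[of "-1" "\<lambda>t. indicator {x - h..x} t *\<^sub>R \<phi> t" 0] by simp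
    also have "\<dots> = (LINT t|lborel. indicator {- x..- x + h} t *\<^sub>R \<phi> (- t))"
      by (intro Bochner_Integration.integral_cong) (auto split: split_indicator)
    finally show ?thesis by (simp add: set_lebesgue_integral_def)
  qed
  ultimately have L: "AE x in lborel. \<forall>e>0. \<exists>d>0. \<forall>h. 0 < h \<and> h < d \<longrightarrow>
    \<bar>(LINT t:{x - h..x}|lborel. \<phi> t) / h - \<phi> x\<bar> < e" by simp
  from L AE_right_difference_quotient[OF int] show ?thesis
  proof (eventually_elim, intro impI)
    fix x assume L: "\<forall>e>0. \<exists>d>0. \<forall>h. 0 < h \<and> h < d \<longrightarrow> \<bar>(LINT t:{x - h..x}|lborel. \<phi> t) / h - \<phi> x\<bar> < e"
      and R: "\<forall>e>0. \<exists>d>0. \<forall>h. 0 < h \<and> h < d \<longrightarrow> \<bar>(LINT t:{x..x + h}|lborel. \<phi> t) / h - \<phi> x\<bar> < e"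
      and x: "a < x \<and> x < b"
    show "(G has_real_derivative \<phi> x) (at x)"
      unfolding DERIV_def
    proof (rule LIM_I)
      fix e :: real assume "0 < e"
      obtain d1 where d1: "d1 > 0" "\<And>h. 0 < h \<Longrightarrow> h < d1 \<Longrightarrow> \<bar>(LINT t:{x - h..x}|lborel. \<phi> t) / h - \<phi> x\<bar> < e"
        using L \<open>0 < e\<close> by blast
      obtain d2 where d2: "d2 > 0" "\<And>h. 0 < h \<Longrightarrow> h < d2 \<Longrightarrow> \<bar>(LINT t:{x..x + h}|lborel. \<phi> t) / h - \<phi> x\<bar> < e"
        using R \<open>0 < e\<close> by blast
      define d where "d = Min {d1, d2, x - a, b - x}"
      have d: "d > 0" "d \<le> d1" "d \<le> d2" "d \<le> x - a" "d \<le> b - x" using d1 d2 x by (auto simp: d_def)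
      show "\<exists>s>0. \<forall>h. h \<noteq> 0 \<and> norm (h - 0) < s \<longrightarrow> norm ((G (x + h) - G x) / h - \<phi> x) < e"
      proof (intro exI[of _ d] conjI allI impI)
        fix h :: real assume h: "h \<noteq> 0 \<and> norm (h - 0) < d"
        show "norm ((G (x + h) - G x) / h - \<phi> x) < e"
        proof (cases "h > 0")
          case True
          then show ?thesis using d2(2)[of h] G[of x "x + h"] h d x by simp
        next
          case False
          then have "G x - G (x + h) = (LINT t:{x - (- h)..x}|lborel. \<phi> t)"
            using G[of "x + h" x] h d x by simp
          then have eq: "(G (x + h) - G x) / h = (LINT t:{x - (- h)..x}|lborel. \<phi> t) / (- h)"
            by (metis minus_diff_eq minus_divide_divide)
          have "\<bar>(LINT t:{x - (- h)..x}|lborel. \<phi> t) / (- h) - \<phi> x\<bar> < e"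
          proof (rule d1(2))
            show "0 < - h" using False h by simp
            from h have "\<bar>h\<bar> < d" by simp
            with d(2) show "- h < d1" by linarith
          qed
          then show ?thesis unfolding eq real_norm_def .
        qed
      qed (fact d(1))
    qed
  qed
qed

text \<open>The densities on the intervals \<open>[-n, n]\<close> agree almost everywhere where they
  are comparable, because each is almost everywhere the derivative of \<open>g\<close>. Pasting them
  gives a Borel function, whereas \<open>deriv g\<close> is arbitrary where \<open>g\<close> is not
  differentiable.\<close>

theorem locally_abs_cont_FTC:
  assumes g: "locally_abs_cont_on UNIV g"
  obtains g' :: "real \<Rightarrow> real" where "g' \<in> borel_measurable borel"
    "AE x in lborel. (g has_real_derivative g' x) (at x)"
    "\<And>a b. set_integrable lborel {a..b} g'"
    "\<And>a b. a \<le> b \<Longrightarrow> (LINT t:{a..b}|lborel. g' t) = g b - g a"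
proof -
  have "\<forall>n::nat. \<exists>\<phi> :: real \<Rightarrow> real. integrable lborel \<phi> \<and>
    (\<forall>x y. - real n \<le> x \<and> x \<le> y \<and> y \<le> real n \<longrightarrow> g y - g x = (LINT t:{x..y}|lborel. \<phi> t))"
    using locally_abs_cont_density[OF g] by simp
  then obtain \<phi> :: "nat \<Rightarrow> real \<Rightarrow> real" where \<phi>: "\<And>n. integrable lborel (\<phi> n)"
    "\<And>n x y. - real n \<le> x \<Longrightarrow> x \<le> y \<Longrightarrow> y \<le> real n \<Longrightarrow> g y - g x = (LINT t:{x..y}|lborel. \<phi> n t)"
    by metis
  \<comment> \<open>Strictly above \<open>\<bar>x\<bar>\<close>, so that \<open>x\<close> is
    interior to the interval of the density chosen for it; integer-valued and measurable, so that
    the pasted function is measurable.\<close>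
  define k where "k x = nat \<lceil>\<bar>x\<bar>\<rceil> + 1" for x :: real
  define g' where "g' x = \<phi> (k x) x" for x
  have k: "\<bar>x\<bar> < real (k x)" for x unfolding k_def by linarith
  have [measurable]: "\<phi> n \<in> borel_measurable borel" for n using \<phi>(1)[of n] by auto
  have [measurable]: "k \<in> borel \<rightarrow>\<^sub>M count_space UNIV" unfolding k_def by measurable
  have meas [measurable]: "g' \<in> borel_measurable borel"
    unfolding g'_def by (rule measurable_compose_countable) measurable
  have "AE x in lborel. - real n < x \<and> x < real n \<longrightarrow> (g has_real_derivative \<phi> n x) (at x)" for n
    by (rule AE_DERIV_of_density[OF \<phi>])
  then have AE: "AE x in lborel. \<forall>n. - real n < x \<and> x < real n \<longrightarrow> (g has_real_derivative \<phi> n x) (at x)"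
    by (simp add: AE_all_countable)
  then have deriv: "AE x in lborel. (g has_real_derivative g' x) (at x)"
    by eventually_elim (use k in \<open>simp add: g'_def abs_less_iff minus_less_iff\<close>)
  have eq: "AE x in lborel. - real n < x \<and> x < real n \<longrightarrow> g' x = \<phi> n x" for n
    using AE deriv by eventually_elim (auto intro: DERIV_unique)
  have both: "set_integrable lborel {a..b} g' \<and> (LINT t:{a..b}|lborel. g' t) = g b - g a" if "a \<le> b" for a b
  proof -
    define n where "n = nat \<lceil>max \<bar>a\<bar> \<bar>b\<bar>\<rceil> + 1"
    have n: "- real n < a" "b < real n" unfolding n_def by linarith+
    have ae: "AE x in lborel. x \<in> {a..b} \<longrightarrow> \<phi> n x = g' x"
      using eq[of n] by eventually_elim (use n in auto)
    have 1: "set_integrable lborel {a..b} (\<phi> n)"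
      by (rule integrable_imp_set_integrable[OF \<phi>(1)]) simp
    have "set_integrable lborel {a..b} g'"
      using set_integrable_cong_AE[of "\<phi> n" lborel g' "{a..b}"] ae 1 by simp
    moreover have "(LINT t:{a..b}|lborel. g' t) = (LINT t:{a..b}|lborel. \<phi> n t)"
      using ae by (intro set_lebesgue_integral_cong_AE) auto
    ultimately show ?thesis using \<phi>(2)[of n a b] n that by simp
  qed
  show ?thesis
  proof (rule that[OF meas deriv])
    show "set_integrable lborel {a..b} g'" for a b
      using both[of a b] by (cases "a \<le> b") (auto simp: set_integrable_def)
  qed (use both in blast)
qed

section \<open>Integration by parts\<close>

lemma set_integrable_mult_continuous:
  fixes f G :: "real \<Rightarrow> real"
  assumes f: "set_integrable lborel {a..b} f" and G: "continuous_on {a..b} G"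
  shows "set_integrable lborel {a..b} (\<lambda>t. f t * G t)"
proof -
  have "bounded (G ` {a..b})"
    using G by (intro compact_imp_bounded compact_continuous_image) auto
  then obtain B where B: "\<And>t. t \<in> {a..b} \<Longrightarrow> \<bar>G t\<bar> \<le> B"
    unfolding bounded_iff by (metis imageI real_norm_def)
  have int: "integrable lborel (\<lambda>t. indicator {a..b} t * f t)"
    using f by (simp add: set_integrable_def)
  have "(\<lambda>t. indicator {a..b} t * G t) \<in> borel_measurable lborel"
    using borel_measurable_continuous_on_indicator[OF _ G] by simp
  then have "(\<lambda>t. (indicator {a..b} t * f t) * (indicator {a..b} t * G t)) \<in> borel_measurable lborel"
    by (rule borel_measurable_times[OF borel_measurable_integrable[OF int]])
  then have "integrable lborel (\<lambda>t. (indicator {a..b} t * f t) * (indicator {a..b} t * G t))"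
  proof (rule Bochner_Integration.integrable_bound[OF integrable_mult_left[OF int, of B]])
    show "AE t in lborel. norm (indicator {a..b} t * f t * (indicator {a..b} t * G t)) \<le>
        norm (indicator {a..b} t * f t * B)"
    proof (rule AE_I2)
      fix t
      show "norm (indicator {a..b} t * f t * (indicator {a..b} t * G t)) \<le> norm (indicator {a..b} t * f t * B)"
        using B[of t] by (cases "t \<in> {a..b}") (auto simp: abs_mult intro!: mult_left_mono)
    qed
  qed
  then show ?thesis
    unfolding set_integrable_def by (rule back_subst[of "integrable lborel"]) (auto split: split_indicator)
qed

lemma integrable_pair_product:
  fixes f g :: "real \<Rightarrow> real"
  assumes "integrable lborel f" "integrable lborel g"
  shows "integrable (lborel \<Otimes>\<^sub>M lborel) (\<lambda>(s, t). f s * g t)"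
proof (rule lborel_pair.Fubini_integrable)
  have [measurable]: "f \<in> borel_measurable borel" "g \<in> borel_measurable borel"
    using assms by auto
  show "(\<lambda>(s, t). f s * g t) \<in> borel_measurable (lborel \<Otimes>\<^sub>M lborel)" by measurable
  show "integrable lborel (\<lambda>x. \<integral>y. norm (case (x, y) of (s, t) \<Rightarrow> f s * g t) \<partial>lborel)"
    using assms by (simp add: abs_mult)
  show "AE x in lborel. integrable lborel (\<lambda>y. case (x, y) of (s, t) \<Rightarrow> f s * g t)"
    using assms by simp
qed

text \<open>Fubini for \<open>f s * g t\<close> on the triangles \<open>s \<le> t\<close> and \<open>t < s\<close>.\<close>

lemma integral_by_parts_density:
  fixes F G f g :: "real \<Rightarrow> real"
  assumes ab: "a \<le> b"
    and f: "set_integrable lborel {a..b} f" and g: "set_integrable lborel {a..b} g"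
    and F: "\<And>x. a \<le> x \<Longrightarrow> x \<le> b \<Longrightarrow> F x - F a = (LINT t:{a..x}|lborel. f t)"
    and G: "\<And>x. a \<le> x \<Longrightarrow> x \<le> b \<Longrightarrow> G x - G a = (LINT t:{a..x}|lborel. g t)"
    and Fc: "continuous_on {a..b} F" and Gc: "continuous_on {a..b} G"
  shows "(LINT t:{a..b}|lborel. f t * G t) + (LINT t:{a..b}|lborel. F t * g t) = F b * G b - F a * G a"
proof -
  define f0 where "f0 t = indicator {a..b} t * f t" for t
  define g0 where "g0 t = indicator {a..b} t * g t" for t
  have int: "integrable lborel f0" "integrable lborel g0"
    using f g by (simp_all add: f0_def[abs_def] g0_def[abs_def] set_integrable_def)
  have [measurable]: "f0 \<in> borel_measurable borel" "g0 \<in> borel_measurable borel"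
    using int by auto
  define H where "H = (\<lambda>(s, t). f0 s * g0 t)"
  define H1 where "H1 = (\<lambda>(s, t). if s \<le> t then f0 s * g0 t else 0)"
  define H2 where "H2 = (\<lambda>(s, t). if t < s then f0 s * g0 t else 0)"
  have intH: "integrable (lborel \<Otimes>\<^sub>M lborel) H"
    unfolding H_def by (rule integrable_pair_product[OF int])
  have intH1: "integrable (lborel \<Otimes>\<^sub>M lborel) H1"
    unfolding H1_def by (rule Bochner_Integration.integrable_bound[OF intH]) (auto simp: H_def)
  have intH2: "integrable (lborel \<Otimes>\<^sub>M lborel) H2"
    unfolding H2_def by (rule Bochner_Integration.integrable_bound[OF intH]) (auto simp: H_def)
  have "integral\<^sup>L (lborel \<Otimes>\<^sub>M lborel) H = integral\<^sup>L (lborel \<Otimes>\<^sub>M lborel) H1 + integral\<^sup>L (lborel \<Otimes>\<^sub>M lborel) H2"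
    unfolding Bochner_Integration.integral_add[OF intH1 intH2, symmetric]
    by (intro Bochner_Integration.integral_cong) (auto simp: H_def H1_def H2_def)
  moreover have "integral\<^sup>L (lborel \<Otimes>\<^sub>M lborel) H = (F b - F a) * (G b - G a)"
  proof -
    have "integral\<^sup>L (lborel \<Otimes>\<^sub>M lborel) H = (\<integral>s. (\<integral>t. f0 s * g0 t \<partial>lborel) \<partial>lborel)"
      unfolding lborel_pair.integral_fst'[OF intH, symmetric] by (simp add: H_def)
    also have "\<dots> = (\<integral>s. f0 s \<partial>lborel) * (\<integral>t. g0 t \<partial>lborel)" by simp
    also have "\<dots> = (F b - F a) * (G b - G a)"
      unfolding F[OF ab order_refl] G[OF ab order_refl] by (simp add: f0_def g0_def set_lebesgue_integral_def)
    finally show ?thesis .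
  qed
  moreover have "integral\<^sup>L (lborel \<Otimes>\<^sub>M lborel) H1 = (LINT t:{a..b}|lborel. g t * (F t - F a))"
  proof -
    have "integral\<^sup>L (lborel \<Otimes>\<^sub>M lborel) H1 = (\<integral>t. (\<integral>s. (if s \<le> t then f0 s * g0 t else 0) \<partial>lborel) \<partial>lborel)"
      using lborel_pair.integral_snd[of "\<lambda>s t. if s \<le> t then f0 s * g0 t else 0"] intH1 by (simp add: H1_def)
    also have "\<dots> = (LINT t:{a..b}|lborel. g t * (F t - F a))"
      unfolding set_lebesgue_integral_def
    proof (rule Bochner_Integration.integral_cong[OF refl])
      fix t
      show "(\<integral>s. (if s \<le> t then f0 s * g0 t else 0) \<partial>lborel) = indicator {a..b} t *\<^sub>R (g t * (F t - F a))"
      proof (cases "t \<in> {a..b}")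
        case True
        then have "(\<integral>s. (if s \<le> t then f0 s * g0 t else 0) \<partial>lborel) = (\<integral>s. (indicator {a..t} s *\<^sub>R f s) * g t \<partial>lborel)"
          by (intro Bochner_Integration.integral_cong) (auto simp: f0_def g0_def split: split_indicator)
        also have "\<dots> = (F t - F a) * g t"
          using F[of t] True by (simp add: set_lebesgue_integral_def)
        finally show ?thesis using True by simp
      next
        case False
        then have "g0 t = 0" by (simp add: g0_def)
        then show ?thesis using False by (simp cong: if_cong)
      qed
    qed
    finally show ?thesis .
  qed
  moreover have "integral\<^sup>L (lborel \<Otimes>\<^sub>M lborel) H2 = (LINT s:{a..b}|lborel. f s * (G s - G a))"
  proof -
    have "integral\<^sup>L (lborel \<Otimes>\<^sub>M lborel) H2 = (\<integral>s. (\<integral>t. (if t < s then f0 s * g0 t else 0) \<partial>lborel) \<partial>lborel)"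
      unfolding lborel_pair.integral_fst'[OF intH2, symmetric] by (simp add: H2_def)
    also have "\<dots> = (LINT s:{a..b}|lborel. f s * (G s - G a))"
      unfolding set_lebesgue_integral_def
    proof (rule Bochner_Integration.integral_cong[OF refl])
      fix s
      show "(\<integral>t. (if t < s then f0 s * g0 t else 0) \<partial>lborel) = indicator {a..b} s *\<^sub>R (f s * (G s - G a))"
      proof (cases "s \<in> {a..b}")
        case True
        \<comment> \<open>The triangle omits \<open>t = s\<close>, which \<open>{a..s}\<close>
          contains; a point is null.\<close>
        then have "(\<integral>t. (if t < s then f0 s * g0 t else 0) \<partial>lborel) = (\<integral>t. f s * (indicator {a..s} t *\<^sub>R g t) \<partial>lborel)"
          using AE_lborel_singleton[of s] set_borel_measurable_subset[of lborel "{a..b}" g "{a..s}"] g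
            borel_measurable_integrable[OF g[unfolded set_integrable_def]]
          by (intro integral_cong_AE) (auto simp: f0_def g0_def set_borel_measurable_def split: split_indicator)
        also have "\<dots> = f s * (G s - G a)"
          using G[of s] True by (simp add: set_lebesgue_integral_def)
        finally show ?thesis using True by simp
      next
        case False
        then have "f0 s = 0" by (simp add: f0_def)
        then show ?thesis using False by (simp cong: if_cong)
      qed
    qed
    finally show ?thesis .
  qed
  ultimately have eq: "(F b - F a) * (G b - G a) =
      (LINT t:{a..b}|lborel. g t * (F t - F a)) + (LINT s:{a..b}|lborel. f s * (G s - G a))" by simp
  have "set_integrable lborel {a..b} (\<lambda>t. g t * F t)" "set_integrable lborel {a..b} (\<lambda>t. f t * G t)"
    using set_integrable_mult_continuous f g Fc Gc by auto
  then have "(LINT t:{a..b}|lborel. g t * (F t - F a)) = (LINT t:{a..b}|lborel. F t * g t) - (G b - G a) * F a"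
    "(LINT t:{a..b}|lborel. f t * (G t - G a)) = (LINT t:{a..b}|lborel. f t * G t) - (F b - F a) * G a"
    using f g F[OF ab order_refl] G[OF ab order_refl] by (simp_all add: right_diff_distrib mult.commute)
  with eq show ?thesis by (simp add: algebra_simps)
qed

text \<open>The compact case along an exhausting sequence of intervals. The boundary values are
  limits of the product \<open>F x * G x\<close>, as the single factors may have no finite limit
  there; the integrals converge along the sequence because both integrands are integrable on the
  whole interval.\<close>

lemma integral_by_parts_einterval:
  fixes F G f g :: "real \<Rightarrow> real" and a b :: ereal
  assumes ab: "a < b"
    and f: "\<And>x y. a < ereal x \<Longrightarrow> x \<le> y \<Longrightarrow> ereal y < b \<Longrightarrow> set_integrable lborel {x..y} f \<and> F y - F x = (LINT t:{x..y}|lborel. f t)"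
    and g: "\<And>x y. a < ereal x \<Longrightarrow> x \<le> y \<Longrightarrow> ereal y < b \<Longrightarrow> set_integrable lborel {x..y} g \<and> G y - G x = (LINT t:{x..y}|lborel. g t)"
    and Fc: "continuous_on (einterval a b) F" and Gc: "continuous_on (einterval a b) G"
    and int1: "set_integrable lborel (einterval a b) (\<lambda>t. f t * G t)"
    and int2: "set_integrable lborel (einterval a b) (\<lambda>t. F t * g t)"
    and A: "(((\<lambda>x. F x * G x) \<circ> real_of_ereal) \<longlongrightarrow> A) (at_right a)"
    and B: "(((\<lambda>x. F x * G x) \<circ> real_of_ereal) \<longlongrightarrow> B) (at_left b)"
  shows "(LINT t:einterval a b|lborel. f t * G t) + (LINT t:einterval a b|lborel. F t * g t) = B - A"
proof -
  obtain u l :: "nat \<Rightarrow> real" where approx: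
    "einterval a b = (\<Union>i. {l i .. u i})" "incseq u" "decseq l" "\<And>i. l i < u i"
    "\<And>i. a < l i" "\<And>i. u i < b" "l \<longlonglongrightarrow> a" "u \<longlonglongrightarrow> b"
    by (blast intro: einterval_Icc_approximation[OF ab])
  have inc: "incseq (\<lambda>i. {l i..u i})"
  proof (rule monoI)
    fix m n :: nat assume "m \<le> n"
    then have "l n \<le> l m" "u m \<le> u n" using approx(2,3) by (auto simp: incseq_def decseq_def)
    then show "{l m..u m} \<subseteq> {l n..u n}" by auto
  qed
  have "(\<lambda>i. LINT t:{l i..u i}|lborel. f t * G t) \<longlonglongrightarrow> (LINT t:einterval a b|lborel. f t * G t)"
    using int1 unfolding approx(1) by (intro set_integral_cont_up inc) auto
  moreover have "(\<lambda>i. LINT t:{l i..u i}|lborel. F t * g t) \<longlonglongrightarrow> (LINT t:einterval a b|lborel. F t * g t)"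
    using int2 unfolding approx(1) by (intro set_integral_cont_up inc) auto
  ultimately have "(\<lambda>i. (LINT t:{l i..u i}|lborel. f t * G t) + (LINT t:{l i..u i}|lborel. F t * g t)) \<longlonglongrightarrow>
    (LINT t:einterval a b|lborel. f t * G t) + (LINT t:einterval a b|lborel. F t * g t)"
    by (rule tendsto_add)
  moreover have "(LINT t:{l i..u i}|lborel. f t * G t) + (LINT t:{l i..u i}|lborel. F t * g t)
      = F (u i) * G (u i) - F (l i) * G (l i)" for i
  proof (rule integral_by_parts_density)
    have sub: "{l i..u i} \<subseteq> einterval a b" using approx(1) by blast
    show "continuous_on {l i..u i} F" "continuous_on {l i..u i} G"
      using Fc Gc sub by (auto intro: continuous_on_subset)
    have less: "ereal x < b" if "x \<le> u i" for x
      using that approx(6)[of i] by (metis ereal_less_eq(3) order_le_less_trans)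
    show "F x - F (l i) = (LINT t:{l i..x}|lborel. f t)" "G x - G (l i) = (LINT t:{l i..x}|lborel. g t)"
      if "l i \<le> x" "x \<le> u i" for x
      using f[OF approx(5) that(1) less[OF that(2)]] g[OF approx(5) that(1) less[OF that(2)]] by auto
    show "set_integrable lborel {l i..u i} f" "set_integrable lborel {l i..u i} g"
      using f[OF approx(5) less_imp_le[OF approx(4)] approx(6)]
        g[OF approx(5) less_imp_le[OF approx(4)] approx(6)] by auto
  qed (use approx(4) less_imp_le in blast)
  moreover have "(\<lambda>i. F (u i) * G (u i)) \<longlonglongrightarrow> B"
    using B approx unfolding tendsto_at_iff_sequentially comp_def
    by (force elim!: allE[of _ "\<lambda>i. ereal (u i)"])
  moreover have "(\<lambda>i. F (l i) * G (l i)) \<longlonglongrightarrow> A"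
    using A approx unfolding tendsto_at_iff_sequentially comp_def
    by (force elim!: allE[of _ "\<lambda>i. ereal (l i)"])
  ultimately have "(\<lambda>i. F (u i) * G (u i) - F (l i) * G (l i)) \<longlonglongrightarrow>
      (LINT t:einterval a b|lborel. f t * G t) + (LINT t:einterval a b|lborel. F t * g t)"
    and "(\<lambda>i. F (u i) * G (u i) - F (l i) * G (l i)) \<longlonglongrightarrow> B - A"
    by (simp_all add: tendsto_diff)
  then show ?thesis by (rule LIMSEQ_unique)
qed

section \<open>Antiderivatives on open sets\<close>

lemma has_real_derivative_density:
  fixes f F :: "real \<Rightarrow> real"
  assumes S: "open S" "x \<in> S" and f: "continuous_on S f"
    and F: "\<And>c d. c \<le> d \<Longrightarrow> {c..d} \<subseteq> S \<Longrightarrow> F d - F c = (LINT t:{c..d}|lborel. f t)"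
  shows "(F has_real_derivative f x) (at x)"
proof -
  obtain e where e: "e > 0" "{x - e..x + e} \<subseteq> S"
    using S open_contains_cball by (metis cball_eq_atLeastAtMost)
  have cont: "continuous_on {x - e..x + e} f" using f e(2) by (rule continuous_on_subset)
  have eq: "F y = F (x - e) + integral {x - e..y} f" if "y \<in> {x - e..x + e}" for y
  proof -
    have "continuous_on {x - e..y} f" using cont that by (auto intro: continuous_on_subset)
    then have "(LINT t:{x - e..y}|lborel. f t) = integral {x - e..y} f"
      by (intro set_borel_integral_eq_integral(2) borel_integrable_atLeastAtMost')
    then show ?thesis using F[of "x - e" y] that e by fastforce
  qed
  have "((\<lambda>y. F (x - e) + integral {x - e..y} f) has_real_derivative f x) (at x within {x - e..x + e})"
    using integral_has_real_derivative[OF cont, of x] e by (auto intro!: derivative_eq_intros)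
  then have "(F has_real_derivative f x) (at x within {x - e..x + e})"
  proof (rule has_field_derivative_transform_within[OF _ zero_less_one])
    show "x \<in> {x - e..x + e}" using e by simp
    show "F (x - e) + integral {x - e..y} f = F y" if "y \<in> {x - e..x + e}" for y
      using eq[OF that] by (rule sym)
  qed
  then show ?thesis using e by (simp add: at_within_Icc_at)
qed

text \<open>Here \<open>f\<close> is only integrable on compact intervals: the tails have to be
  continuous across the points \<open>e r\<close> inside \<open>(l, u)\<close>, where
  \<open>p\<close> may jump.\<close>

lemma continuous_on_density:
  fixes f F :: "real \<Rightarrow> real"
  assumes S: "open S"
    and F: "\<And>c d. c \<le> d \<Longrightarrow> {c..d} \<subseteq> S \<Longrightarrow> set_integrable lborel {c..d} f \<and> F d - F c = (LINT t:{c..d}|lborel. f t)"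
  shows "continuous_on S F"
proof (rule continuous_at_imp_continuous_on, rule ballI)
  fix x assume "x \<in> S"
  then obtain e where e: "e > 0" "{x - e..x + e} \<subseteq> S"
    using S open_contains_cball by (metis cball_eq_atLeastAtMost)
  have int: "set_integrable lborel {x - e..y} f \<and> F y - F (x - e) = (LINT t:{x - e..y}|lborel. f t)"
    if "y \<in> {x - e..x + e}" for y
    using that e(2) by (intro F) auto
  have "f integrable_on {x - e..x + e}"
    using int[of "x + e"] e(1) by (intro set_borel_integral_eq_integral(1)) auto
  then have "continuous_on {x - e..x + e} (\<lambda>y. F (x - e) + integral {x - e..y} f)"
    by (intro continuous_intros indefinite_integral_continuous_1)
  then have "continuous_on {x - e..x + e} F"
    by (rule continuous_on_eq) (use int set_borel_integral_eq_integral(2) in force)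
  then show "isCont F x" using e(1) by (simp add: continuous_on_interior)
qed

section \<open>Iterated derivatives on open sets\<close>

text \<open>Iterated \<open>deriv\<close> depends only on the values near a point. Many identities
  used later hold on \<open>{x. 0 < p x}\<close> only, and its openness lets them be
  differentiated.\<close>

lemma higher_deriv_cong_on_open:
  fixes f g :: "real \<Rightarrow> real"
  assumes "open S" "\<And>x. x \<in> S \<Longrightarrow> f x = g x" "x \<in> S"
  shows "(deriv ^^ k) f x = (deriv ^^ k) g x"
proof -
  have "\<forall>x\<in>S. (deriv ^^ k) f x = (deriv ^^ k) g x"
  proof (induction k)
    case (Suc k)
    show ?case
    proof
      fix x assume "x \<in> S"
      then have "eventually (\<lambda>y. (deriv ^^ k) f y = (deriv ^^ k) g y) (nhds x)"
        using Suc assms(1) by (auto simp: eventually_nhds)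
      then show "(deriv ^^ Suc k) f x = (deriv ^^ Suc k) g x" by (simp add: deriv_cong_ev)
    qed
  qed (use assms in simp)
  then show ?thesis using assms(3) by blast
qed

lemma field_differentiable_cong_on_open:
  fixes f g :: "real \<Rightarrow> real"
  assumes "open S" "\<And>x. x \<in> S \<Longrightarrow> f x = g x" "x \<in> S" "f field_differentiable (at x)"
  shows "g field_differentiable (at x)"
  using assms unfolding field_differentiable_def
  by (metis has_field_derivative_transform_within_open)

lemma times_differentiable_on_cong:
  fixes f g :: "real \<Rightarrow> real"
  assumes "open S" "\<And>x. x \<in> S \<Longrightarrow> f x = g x" "times_differentiable_on n f S"
  shows "times_differentiable_on n g S"
  unfolding times_differentiable_on_def
proof (intro allI impI ballI)
  fix k x assume "k < n" "x \<in> S"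
  then have "(deriv ^^ k) f field_differentiable at x"
    using assms(3) by (simp add: times_differentiable_on_def)
  moreover have "(deriv ^^ k) f y = (deriv ^^ k) g y" if "y \<in> S" for y
    using higher_deriv_cong_on_open[OF assms(1), of f g y k] assms(2) that by blast
  ultimately show "(deriv ^^ k) g field_differentiable at x"
    using field_differentiable_cong_on_open[OF assms(1), of "(deriv ^^ k) f" "(deriv ^^ k) g" x] \<open>x \<in> S\<close>
    by blast
qed

lemma times_differentiable_on_mono:
  "times_differentiable_on n f S \<Longrightarrow> m \<le> n \<Longrightarrow> T \<subseteq> S \<Longrightarrow> times_differentiable_on m f T"
  unfolding times_differentiable_on_def by auto

lemma times_differentiable_on_0 [simp]: "times_differentiable_on 0 f S"
  by (simp add: times_differentiable_on_def)

lemma times_differentiable_on_Suc: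
  "times_differentiable_on (Suc n) f S \<longleftrightarrow>
    (\<forall>x\<in>S. f field_differentiable (at x)) \<and> times_differentiable_on n (deriv f) S"
  unfolding times_differentiable_on_def
  by (auto simp: less_Suc_eq_0_disj funpow_swap1 simp flip: funpow.simps(2)[unfolded o_def])

lemma times_differentiable_on_higher_deriv:
  "times_differentiable_on (m + n) f S \<Longrightarrow> times_differentiable_on m ((deriv ^^ n) f) S"
  unfolding times_differentiable_on_def by (simp flip: comp_apply[of "deriv ^^ _"] funpow_add)

lemma times_differentiable_on_add:
  fixes f g :: "real \<Rightarrow> real"
  assumes "open S" "times_differentiable_on n f S" "times_differentiable_on n g S"
  shows "times_differentiable_on n (\<lambda>x. f x + g x) S"
  using assms(2,3)
proof (induction n arbitrary: f g)
  case (Suc n)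
  have f: "\<And>x. x \<in> S \<Longrightarrow> f field_differentiable (at x)" "times_differentiable_on n (deriv f) S"
    and g: "\<And>x. x \<in> S \<Longrightarrow> g field_differentiable (at x)" "times_differentiable_on n (deriv g) S"
    using Suc.prems by (auto simp: times_differentiable_on_Suc)
  have "times_differentiable_on n (deriv (\<lambda>x. f x + g x)) S"
    by (rule times_differentiable_on_cong[OF assms(1) _ Suc.IH[OF f(2) g(2)]]) (simp add: f(1) g(1))
  then show ?case
    unfolding times_differentiable_on_Suc using f(1) g(1) by (blast intro: field_differentiable_add)
qed simp

lemma times_differentiable_on_mult:
  fixes f g :: "real \<Rightarrow> real"
  assumes "open S" "times_differentiable_on n f S" "times_differentiable_on n g S"
  shows "times_differentiable_on n (\<lambda>x. f x * g x) S"
  using assms(2,3)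
proof (induction n arbitrary: f g)
  case (Suc n)
  have f: "\<And>x. x \<in> S \<Longrightarrow> f field_differentiable (at x)" "times_differentiable_on n (deriv f) S"
    "times_differentiable_on n f S"
    using Suc.prems(1) times_differentiable_on_mono[OF Suc.prems(1), of n S] by (auto simp: times_differentiable_on_Suc)
  have g: "\<And>x. x \<in> S \<Longrightarrow> g field_differentiable (at x)" "times_differentiable_on n (deriv g) S"
    "times_differentiable_on n g S"
    using Suc.prems(2) times_differentiable_on_mono[OF Suc.prems(2), of n S] by (auto simp: times_differentiable_on_Suc)
  have "times_differentiable_on n (\<lambda>x. f x * deriv g x + deriv f x * g x) S"
    by (rule times_differentiable_on_add[OF assms(1) Suc.IH[OF f(3) g(2)] Suc.IH[OF f(2) g(3)]])
  then have "times_differentiable_on n (deriv (\<lambda>x. f x * g x)) S"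
    by (rule times_differentiable_on_cong[OF assms(1), rotated]) (simp add: f(1) g(1))
  then show ?case
    unfolding times_differentiable_on_Suc using f(1) g(1) by (blast intro: field_differentiable_mult)
qed simp

lemma higher_deriv_diff_on_open:
  fixes f g :: "real \<Rightarrow> real"
  assumes "open S" "times_differentiable_on n f S" "times_differentiable_on n g S" "x \<in> S"
  shows "(deriv ^^ n) (\<lambda>x. f x - g x) x = (deriv ^^ n) f x - (deriv ^^ n) g x"
  using assms(2-4)
proof (induction n arbitrary: f g)
  case (Suc n)
  have f: "\<And>x. x \<in> S \<Longrightarrow> f field_differentiable (at x)" "times_differentiable_on n (deriv f) S"
    and g: "\<And>x. x \<in> S \<Longrightarrow> g field_differentiable (at x)" "times_differentiable_on n (deriv g) S"
    using Suc.prems by (auto simp: times_differentiable_on_Suc)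
  have "(deriv ^^ n) (deriv (\<lambda>x. f x - g x)) x = (deriv ^^ n) (\<lambda>x. deriv f x - deriv g x) x"
    using f g Suc.prems(3) by (intro higher_deriv_cong_on_open[OF assms(1)]) auto
  also have "\<dots> = (deriv ^^ n) (deriv f) x - (deriv ^^ n) (deriv g) x"
    using Suc.IH[OF f(2) g(2)] Suc.prems(3) by simp
  finally show ?case by (simp add: funpow_swap1)
qed simp

section \<open>Iterated tail integrals\<close>

text \<open>A finite integral forces \<open>f\<close> to be finite almost everywhere on
  \<open>A\<close>, so there \<open>enn2real\<close> discards an infinite value only on a null
  set.\<close>

lemma set_integrable_enn2real:
  fixes f :: "real \<Rightarrow> ennreal"
  assumes f [measurable]: "f \<in> borel_measurable borel" and A [measurable]: "A \<in> sets borel"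
    and fin: "(\<integral>\<^sup>+ t\<in>A. f t \<partial>lborel) < \<infinity>"
  shows "set_integrable lborel A (\<lambda>t. enn2real (f t))"
    and "(LINT t:A|lborel. enn2real (f t)) = enn2real (\<integral>\<^sup>+ t\<in>A. f t \<partial>lborel)"
proof -
  have "AE t in lborel. f t * indicator A t \<noteq> \<infinity>"
    using fin by (intro nn_integral_noteq_infinite) auto
  then have eq: "(\<integral>\<^sup>+ t. ennreal (indicator A t *\<^sub>R enn2real (f t)) \<partial>lborel) = (\<integral>\<^sup>+ t\<in>A. f t \<partial>lborel)"
    by (intro nn_integral_cong_AE, eventually_elim) (auto simp: less_top split: split_indicator)
  show "set_integrable lborel A (\<lambda>t. enn2real (f t))"
    unfolding set_integrable_def using fin by (intro integrableI_nonneg) (auto simp only: eq, auto)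
  show "(LINT t:A|lborel. enn2real (f t)) = enn2real (\<integral>\<^sup>+ t\<in>A. f t \<partial>lborel)"
    unfolding set_lebesgue_integral_def eq[symmetric] by (intro integral_eq_nn_integral) auto
qed

lemma set_integral_Icc_eq_Ico:
  fixes f :: "real \<Rightarrow> real"
  assumes "set_integrable lborel {x..y} f"
  shows "(LINT t:{x..<y}|lborel. f t) = (LINT t:{x..y}|lborel. f t)"
    and "(LINT t:{x<..y}|lborel. f t) = (LINT t:{x..y}|lborel. f t)"
proof -
  define h where "h t = indicator {x..y} t * f t" for t
  have [measurable]: "h \<in> borel_measurable borel"
    using borel_measurable_integrable[OF assms[unfolded set_integrable_def]] by (simp add: h_def[abs_def])
  have h: "(LINT t:A|lborel. f t) = (\<integral>t. indicator A t * h t \<partial>lborel)" if "A \<subseteq> {x..y}" for A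
    unfolding set_lebesgue_integral_def h_def using that
    by (intro Bochner_Integration.integral_cong) (auto split: split_indicator)
  show "(LINT t:{x..<y}|lborel. f t) = (LINT t:{x..y}|lborel. f t)"
    using AE_lborel_singleton[of y]
    by (subst (1 2) h) (auto intro!: integral_cong_AE elim!: eventually_mono split: split_indicator)
  show "(LINT t:{x<..y}|lborel. f t) = (LINT t:{x..y}|lborel. f t)"
    using AE_lborel_singleton[of x]
    by (subst (1 2) h) (auto intro!: integral_cong_AE elim!: eventually_mono split: split_indicator)
qed

text \<open>The spare point \<open>z\<close> beyond \<open>y\<close> puts the closed interval
  \<open>{x..y}\<close> inside the domain of integrability, which the open interval ending at
  \<open>y\<close> would not.\<close>

lemma set_integral_einterval_split_lower:
  fixes f :: "real \<Rightarrow> real"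
  assumes "set_integrable lborel (einterval l (ereal z)) f" "l < ereal x" "x \<le> y" "y < z"
  shows "(LINT t:einterval l (ereal y)|lborel. f t) =
    (LINT t:einterval l (ereal x)|lborel. f t) + (LINT t:{x..y}|lborel. f t)"
proof -
  have less: "l < ereal t" if "x \<le> t" for t
    using assms(2) that by (metis ereal_less_eq(3) order_less_le_trans)
  have "einterval l (ereal y) = einterval l (ereal x) \<union> {x..<y}"
    using assms less by (auto simp: einterval_def)
  moreover have "set_integrable lborel (einterval l (ereal x)) f" "set_integrable lborel {x..y} f" "set_integrable lborel {x..<y} f"
    using assms less by (auto intro!: set_integrable_subset[OF assms(1)] simp: einterval_def)
  moreover have "einterval l (ereal x) \<inter> {x..<y} = {}" by (auto simp: einterval_def)
  ultimately show ?thesis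
    using set_integral_Un[of "einterval l (ereal x)" "{x..<y}" lborel f] set_integral_Icc_eq_Ico(1)[of x y f]
    by simp
qed

lemma set_integral_einterval_split_upper:
  fixes f :: "real \<Rightarrow> real"
  assumes "set_integrable lborel (einterval (ereal z) u) f" "z < x" "x \<le> y" "ereal y < u"
  shows "(LINT t:einterval (ereal x) u|lborel. f t) =
    (LINT t:{x..y}|lborel. f t) + (LINT t:einterval (ereal y) u|lborel. f t)"
proof -
  have less: "ereal t < u" if "t \<le> y" for t
    using assms(4) that by (metis ereal_less_eq(3) order_le_less_trans)
  have "einterval (ereal x) u = {x<..y} \<union> einterval (ereal y) u"
    using assms less by (auto simp: einterval_def)
  moreover have "set_integrable lborel (einterval (ereal y) u) f" "set_integrable lborel {x..y} f" "set_integrable lborel {x<..y} f"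
    using assms less by (auto intro!: set_integrable_subset[OF assms(1)] simp: einterval_def)
  moreover have "{x<..y} \<inter> einterval (ereal y) u = {}" by (auto simp: einterval_def)
  ultimately show ?thesis
    using set_integral_Un[of "{x<..y}" "einterval (ereal y) u" lborel f] set_integral_Icc_eq_Ico(2)[of x y f]
    by simp
qed

text \<open>The variable limit of integration is moved into the integrand as a measurable condition
  on the pair of \<open>x\<close> and \<open>t\<close>; measurability of integrals in a parameter
  then applies.\<close>

lemma lower_tail_measurable [measurable]:
  assumes [measurable]: "p \<in> borel_measurable borel"
  shows "lower_tail l p j \<in> borel_measurable borel"
proof (induction j)
  case 0
  have "lower_tail l p 0 = (\<lambda>x. ennreal (p x))" by (simp add: fun_eq_iff)
  then show ?case by simp
next
  case (Suc j)
  note [measurable] = Suc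
  have "(\<lambda>x. \<integral>\<^sup>+ t. lower_tail l p j t * (if l < ereal t \<and> t < x then 1 else 0) \<partial>lborel) \<in> borel_measurable borel"
    by measurable
  moreover have "lower_tail l p (Suc j) = (\<lambda>x. \<integral>\<^sup>+ t. lower_tail l p j t * (if l < ereal t \<and> t < x then 1 else 0) \<partial>lborel)"
    by (auto simp: fun_eq_iff einterval_def indicator_def intro!: nn_integral_cong)
  ultimately show ?case by simp
qed

lemma upper_tail_measurable [measurable]:
  assumes [measurable]: "p \<in> borel_measurable borel"
  shows "upper_tail u p j \<in> borel_measurable borel"
proof (induction j)
  case 0
  have "upper_tail u p 0 = (\<lambda>x. ennreal (p x))" by (simp add: fun_eq_iff)
  then show ?case by simp
next
  case (Suc j)
  note [measurable] = Suc
  have "(\<lambda>x. \<integral>\<^sup>+ t. upper_tail u p j t * (if x < t \<and> ereal t < u then 1 else 0) \<partial>lborel) \<in> borel_measurable borel"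
    by measurable
  moreover have "upper_tail u p (Suc j) = (\<lambda>x. \<integral>\<^sup>+ t. upper_tail u p j t * (if x < t \<and> ereal t < u then 1 else 0) \<partial>lborel)"
    by (auto simp: fun_eq_iff einterval_def indicator_def intro!: nn_integral_cong)
  ultimately show ?case by simp
qed

section \<open>Support and tails of the density\<close>

locale stein_setting = prob_space M
  for M :: "'a measure" +
  fixes Z :: "'a \<Rightarrow> real" and p w :: "real \<Rightarrow> real" and e :: "nat \<Rightarrow> ereal" and l u :: ereal and m :: nat
  assumes dist: "distributed M lborel Z (\<lambda>x. ennreal (p x))"
    and p_nonneg: "\<And>x. 0 \<le> p x"
    and l_eq: "l = e 0" and u_eq: "u = e m"
    and e_less: "\<And>r. r \<in> {1..m} \<Longrightarrow> e (r - 1) < e r"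
    and I_eq: "{x. 0 < p x} = (\<Union>r\<in>{1..m}. einterval (e (r - 1)) (e r))"
    and p_ac: "\<And>r. r \<in> {1..m} \<Longrightarrow> locally_abs_cont_on (einterval (e (r - 1)) (e r)) p"
begin

text \<open>In the paper's notation \<open>C i j\<close> is \<open>M\<close> with superscripts \<open>i, j\<close>, and \<open>P j\<close>, \<open>Q j\<close> are \<open>P\<^sub>j\<close> with a
  bar below and above.\<close>

abbreviation I :: "real set" where "I \<equiv> {x. 0 < p x}"
abbreviation P :: "nat \<Rightarrow> real \<Rightarrow> real" where "P j x \<equiv> enn2real (lower_tail l p j x)"
abbreviation Q :: "nat \<Rightarrow> real \<Rightarrow> real" where "Q j x \<equiv> enn2real (upper_tail u p j x)"
abbreviation mL :: "real \<Rightarrow> real" where "mL \<equiv> m_lower l p w"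
abbreviation mU :: "real \<Rightarrow> real" where "mU \<equiv> m_upper u p w"
abbreviation K :: "nat \<Rightarrow> nat \<Rightarrow> real \<Rightarrow> real \<Rightarrow> real" where "K \<equiv> stein_kernel l u p w"
abbreviation C :: "nat \<Rightarrow> int \<Rightarrow> real \<Rightarrow> real" where "C \<equiv> stein_coeff l u p w"

text \<open>Asked on the support only, as in the kernel hypotheses; monotonicity of the tails
  extends it to all of \<open>(l, u)\<close> for orders above zero.\<close>

definition finite_tails :: "nat \<Rightarrow> bool" where
  "finite_tails j \<longleftrightarrow> (\<forall>x\<in>I. lower_tail l p j x < \<infinity> \<and> upper_tail u p j x < \<infinity>)"

text \<open>One half of a kernel expectation without its factor: the \<open>1 / p v\<close> of the
  kernel has cancelled against the density of \<open>Z\<close>. If the integrand is not integrable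
  the value is the default 0.\<close>

definition lower_integral :: "nat \<Rightarrow> (real \<Rightarrow> real) \<Rightarrow> real \<Rightarrow> real" where
  "lower_integral j g x = (LINT t:einterval l (ereal x)|lborel. P j t * g t)"

definition upper_integral :: "nat \<Rightarrow> (real \<Rightarrow> real) \<Rightarrow> real \<Rightarrow> real" where
  "upper_integral j g x = (LINT t:einterval (ereal x) u|lborel. Q j t * g t)"

lemma p_measurable [measurable]: "p \<in> borel_measurable borel"
proof -
  have "(\<lambda>x. enn2real (ennreal (p x))) \<in> borel_measurable borel"
    using distributed_borel_measurable[OF dist] by measurable
  then show ?thesis using p_nonneg by simp
qed

lemma P_0: "P 0 x = p x" and Q_0: "Q 0 x = p x"
  using p_nonneg by simp_all

lemma open_I: "open I"
  unfolding I_eq by (intro open_UN ballI open_einterval)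

lemma p_continuous: "continuous_on I p"
proof (rule continuous_at_imp_continuous_on, rule ballI)
  fix x assume "x \<in> I"
  then obtain r where r: "r \<in> {1..m}" "x \<in> einterval (e (r - 1)) (e r)" unfolding I_eq by blast
  then show "isCont p x"
    using locally_abs_cont_on_continuous[OF p_ac[OF r(1)] open_einterval] open_einterval
    by (simp add: continuous_on_eq_continuous_at)
qed

lemma e_mono: "i \<le> j \<Longrightarrow> j \<le> m \<Longrightarrow> e i \<le> e j"
proof (induction j rule: dec_induct)
  case (step n)
  then show ?case using e_less[of "Suc n"] by simp
qed simp

lemma I_subset: "I \<subseteq> einterval l u"
proof
  fix x assume "x \<in> I"
  then obtain r where r: "r \<in> {1..m}" "x \<in> einterval (e (r - 1)) (e r)" unfolding I_eq by blast
  moreover have "e 0 \<le> e (r - 1)" "e r \<le> e m" using r(1) by (auto intro!: e_mono)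
  ultimately show "x \<in> einterval l u"
    unfolding l_eq u_eq einterval_def by (auto intro: le_less_trans less_le_trans)
qed

text \<open>A point \<open>x\<close> of \<open>(l, u)\<close> outside the support is one of the
  \<open>e r\<close>: for the least \<open>r\<close> with \<open>x\<close> below \<open>e r\<close>,
  it is not below \<open>e (r - 1)\<close>, and being above it would put \<open>x\<close> into the
  support.\<close>

lemma finite_gaps: "finite (einterval l u - I)"
proof (rule finite_subset)
  show "einterval l u - I \<subseteq> real_of_ereal ` e ` {..m}"
  proof
    fix x assume x: "x \<in> einterval l u - I"
    then have "ereal x < e m" "e 0 < ereal x" by (auto simp: einterval_def l_eq u_eq)
    define r where "r = (LEAST r. ereal x < e r)"
    have r: "ereal x < e r" and "r \<le> m"
      using \<open>ereal x < e m\<close> unfolding r_def by (auto intro: LeastI Least_le)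
    have "r \<noteq> 0" using r \<open>e 0 < ereal x\<close> by (metis order_less_asym)
    have "\<not> ereal x < e (r - 1)"
      using not_less_Least[of "r - 1" "\<lambda>r. ereal x < e r"] \<open>r \<noteq> 0\<close> by (simp add: r_def)
    moreover have "\<not> e (r - 1) < ereal x"
    proof
      assume "e (r - 1) < ereal x"
      then have "x \<in> I" unfolding I_eq using r \<open>r \<noteq> 0\<close> \<open>r \<le> m\<close> by (auto simp: einterval_def)
      with x show False by blast
    qed
    ultimately have "e (r - 1) = ereal x" by (metis linorder_neqE)
    then have "x = real_of_ereal (e (r - 1))" by simp
    then show "x \<in> real_of_ereal ` e ` {..m}" using \<open>r \<le> m\<close> by (intro image_eqI[of _ _ "e (r - 1)"]) auto
  qed
qed simp

lemma AE_in_I: "AE x in lborel. x \<in> einterval l u \<longrightarrow> x \<in> I"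
proof -
  have "einterval l u - I \<in> null_sets lborel"
    using finite_gaps by (intro finite_imp_null_set_lborel)
  then have "AE x in lborel. x \<notin> einterval l u - I" by (rule AE_not_in)
  then show ?thesis by eventually_elim blast
qed

text \<open>An open interval is infinite and loses only finitely many points to the gaps.\<close>

lemma ex_I_between:
  assumes "l \<le> ereal a" "a < b" "ereal b \<le> u"
  obtains y where "y \<in> I" "a < y" "y < b"
proof -
  have sub: "{a<..<b} \<subseteq> einterval l u"
  proof
    fix t assume "t \<in> {a<..<b}"
    then show "t \<in> einterval l u"
      using le_less_trans[OF assms(1), of "ereal t"] less_le_trans[OF _ assms(3), of "ereal t"]
      by (simp add: einterval_def)
  qed
  have "\<not> {a<..<b} \<subseteq> einterval l u - I"
    using finite_gaps infinite_Ioo[OF assms(2)] finite_subset by blast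
  then show ?thesis using sub that by auto
qed

lemma ex_above:
  assumes "x \<in> einterval l u"
  obtains y where "y \<in> I" "x < y"
proof -
  have "ereal x < u" "l < ereal x" using assms by (auto simp: einterval_def)
  then obtain b where "ereal x < ereal b" "ereal b < u" by (metis ereal_dense2)
  then show ?thesis using ex_I_between[of x b] \<open>l < ereal x\<close> that by (auto simp: less_imp_le)
qed

lemma ex_below:
  assumes "x \<in> einterval l u"
  obtains y where "y \<in> I" "y < x"
proof -
  have "ereal x < u" "l < ereal x" using assms by (auto simp: einterval_def)
  then obtain b where "ereal b < ereal x" "l < ereal b" by (metis ereal_dense2)
  then show ?thesis using ex_I_between[of b x] \<open>ereal x < u\<close> that by (auto simp: less_imp_le)
qed

text \<open>A gap point borrows finiteness from a support point to its right, where the lower tail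
  is at least as large.\<close>

lemma finite_lower_tail:
  assumes "finite_tails (Suc j)" "x \<in> einterval l u"
  shows "lower_tail l p (Suc j) x < \<infinity>"
proof -
  obtain y where y: "y \<in> I" "x < y" using ex_above[OF assms(2)] .
  have "lower_tail l p (Suc j) x \<le> lower_tail l p (Suc j) y"
    using y(2) by (auto simp: einterval_def intro!: nn_integral_mono split: split_indicator)
  then show ?thesis using assms(1) y(1) unfolding finite_tails_def by (auto intro: le_less_trans)
qed

lemma finite_upper_tail:
  assumes "finite_tails (Suc j)" "x \<in> einterval l u"
  shows "upper_tail u p (Suc j) x < \<infinity>"
proof -
  obtain y where y: "y \<in> I" "y < x" using ex_below[OF assms(2)] .
  have "upper_tail u p (Suc j) x \<le> upper_tail u p (Suc j) y"
    using y(2) by (auto simp: einterval_def intro!: nn_integral_mono split: split_indicator)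
  then show ?thesis using assms(1) y(1) unfolding finite_tails_def by (auto intro: le_less_trans)
qed

lemma P_integral:
  assumes "finite_tails (Suc j)" "x \<in> einterval l u"
  shows "set_integrable lborel (einterval l (ereal x)) (P j)"
    and "(LINT t:einterval l (ereal x)|lborel. P j t) = P (Suc j) x"
  using set_integrable_enn2real[of "lower_tail l p j" "einterval l (ereal x)"] finite_lower_tail[OF assms]
  by simp_all

lemma Q_integral:
  assumes "finite_tails (Suc j)" "x \<in> einterval l u"
  shows "set_integrable lborel (einterval (ereal x) u) (Q j)"
    and "(LINT t:einterval (ereal x) u|lborel. Q j t) = Q (Suc j) x"
  using set_integrable_enn2real[of "upper_tail u p j" "einterval (ereal x) u"] finite_upper_tail[OF assms]
  by simp_all

lemma P_diff:
  assumes fin: "finite_tails (Suc j)" and "l < ereal x" "x \<le> y" "ereal y < u"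
  shows "set_integrable lborel {x..y} (P j) \<and> P (Suc j) y - P (Suc j) x = (LINT t:{x..y}|lborel. P j t)"
proof -
  have "ereal x < u" "l < ereal y"
    using assms by (meson ereal_less_eq(3) le_less_trans less_le_trans)+
  with assms have xy: "x \<in> einterval l u" "y \<in> einterval l u" by (auto simp: einterval_def)
  obtain z where z: "z \<in> I" "y < z" using ex_above[OF xy(2)] .
  have int: "set_integrable lborel (einterval l (ereal z)) (P j)"
    using P_integral(1)[OF fin] z(1) I_subset by blast
  have "{x..y} \<subseteq> einterval l (ereal z)"
    using z(2) assms(2) by (auto simp: einterval_def intro: less_le_trans)
  with int have "set_integrable lborel {x..y} (P j)" by (intro set_integrable_subset[OF int]) simp_all
  with set_integral_einterval_split_lower[OF int assms(2,3) z(2)] show ?thesis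
    using P_integral(2)[OF fin] xy by simp
qed

text \<open>Phrased with \<open>- Q (Suc j)\<close>, the antiderivative of \<open>Q j\<close>,
  because integration by parts and the derivative rule expect an increment equal to the
  integral.\<close>

lemma Q_diff:
  assumes fin: "finite_tails (Suc j)" and "l < ereal x" "x \<le> y" "ereal y < u"
  shows "set_integrable lborel {x..y} (Q j) \<and> - Q (Suc j) y - - Q (Suc j) x = (LINT t:{x..y}|lborel. Q j t)"
proof -
  have "ereal x < u" "l < ereal y"
    using assms by (meson ereal_less_eq(3) le_less_trans less_le_trans)+
  with assms have xy: "x \<in> einterval l u" "y \<in> einterval l u" by (auto simp: einterval_def)
  obtain z where z: "z \<in> I" "z < x" using ex_below[OF xy(1)] .
  have int: "set_integrable lborel (einterval (ereal z) u) (Q j)"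
    using Q_integral(1)[OF fin] z(1) I_subset by blast
  have "{x..y} \<subseteq> einterval (ereal z) u"
    using z(2) le_less_trans[OF _ assms(4), of "ereal _"] by (auto simp: einterval_def)
  with int have "set_integrable lborel {x..y} (Q j)" by (intro set_integrable_subset[OF int]) simp_all
  with set_integral_einterval_split_upper[OF int z(2) assms(3,4)] show ?thesis
    using Q_integral(2)[OF fin] xy by simp
qed

lemma tail_continuous:
  assumes "finite_tails (Suc j)"
  shows "continuous_on (einterval l u) (P (Suc j))" "continuous_on (einterval l u) (Q (Suc j))"
proof -
  have ends: "l < ereal c \<and> ereal d < u" if "c \<le> d" "{c..d} \<subseteq> einterval l u" for c d
    using that by (auto simp: einterval_def)
  show "continuous_on (einterval l u) (P (Suc j))"
    by (rule continuous_on_density[OF open_einterval, where f="P j"]) (use P_diff[OF assms] ends in blast)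
  have "continuous_on (einterval l u) (\<lambda>x. - Q (Suc j) x)"
    by (rule continuous_on_density[OF open_einterval, where f="Q j"]) (use Q_diff[OF assms] ends in blast)
  then show "continuous_on (einterval l u) (Q (Suc j))"
    using continuous_on_minus by fastforce
qed

text \<open>For order 0 the tails are \<open>p\<close> itself, continuous on the support but perhaps
  not across the gaps; this is why the support replaces \<open>(l, u)\<close>.\<close>

lemma tail_continuous_on_I:
  assumes "finite_tails j"
  shows "continuous_on I (P j)" "continuous_on I (Q j)"
proof -
  have "continuous_on I (P j) \<and> continuous_on I (Q j)"
  proof (cases j)
    case 0
    then show ?thesis using p_continuous p_nonneg by simp
  next
    case (Suc k)
    then show ?thesis using tail_continuous[of k] assms I_subset by (auto intro: continuous_on_subset)
  qed
  then show "continuous_on I (P j)" "continuous_on I (Q j)" by auto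
qed

lemma tail_has_derivative:
  assumes "finite_tails j" "finite_tails (Suc j)" "x \<in> I"
  shows "(P (Suc j) has_real_derivative P j x) (at x)"
    and "(Q (Suc j) has_real_derivative - Q j x) (at x)"
proof -
  have ends: "l < ereal c \<and> ereal d < u" if "c \<le> d" "{c..d} \<subseteq> I" for c d
  proof -
    have "c \<in> einterval l u" "d \<in> einterval l u" using that I_subset by auto
    then show ?thesis by (auto simp: einterval_def)
  qed
  show "(P (Suc j) has_real_derivative P j x) (at x)"
    by (rule has_real_derivative_density[OF open_I assms(3) tail_continuous_on_I(1)[OF assms(1)]])
      (use P_diff[OF assms(2)] ends in blast)
  have "((\<lambda>x. - Q (Suc j) x) has_real_derivative Q j x) (at x)"
    by (rule has_real_derivative_density[OF open_I assms(3) tail_continuous_on_I(2)[OF assms(1)]])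
      (use Q_diff[OF assms(2)] ends in blast)
  from DERIV_minus[OF this] show "(Q (Suc j) has_real_derivative - Q j x) (at x)" by simp
qed

lemma nn_integral_p: "(\<integral>\<^sup>+ x. ennreal (p x) \<partial>lborel) = 1"
proof -
  interpret D: prob_space "distr M lborel Z"
    using dist by (intro prob_space_distr) (auto simp: distributed_def)
  have "emeasure (density lborel (\<lambda>x. ennreal (p x))) UNIV = 1"
    using D.emeasure_space_1 distributed_distr_eq_density[OF dist] by simp
  then show ?thesis by (simp add: emeasure_density)
qed

lemma finite_tails_0: "finite_tails 0"
  by (simp add: finite_tails_def)

lemma finite_tails_1: "finite_tails 1"
proof -
  have "lower_tail l p 1 x \<le> 1" "upper_tail u p 1 x \<le> 1" for x
    unfolding nn_integral_p[symmetric] by (auto intro!: nn_integral_mono split: split_indicator)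
  then show ?thesis unfolding finite_tails_def by (metis ennreal_one_less_top infinity_ennreal_def le_less_trans)
qed

lemma integrable_p: "integrable lborel p"
  using nn_integral_p p_nonneg by (intro integrableI_nonneg) auto

lemma AE_p_zero: "AE x in lborel. x \<notin> einterval l u \<longrightarrow> p x = 0"
  using I_subset p_nonneg by (intro AE_I2) (metis mem_Collect_eq order_less_le subsetD)

end

section \<open>Calculus of the kernels\<close>

text \<open>Applied with \<open>F\<close> a tail integral whose convergence is only known where its coefficient
  \<open>c\<close> does not vanish: if \<open>c\<close> vanishes identically, \<open>F\<close> may be a junk value.\<close>

lemma has_real_derivative_mult_guarded:
  fixes c F :: "real \<Rightarrow> real"
  assumes S: "open S" "x \<in> S" and c: "c field_differentiable (at x)"
    and F: "\<And>y. y \<in> S \<Longrightarrow> c y \<noteq> 0 \<Longrightarrow> (F has_real_derivative f) (at x)"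
  shows "((\<lambda>y. c y * F y) has_real_derivative deriv c x * F x + c x * f) (at x)"
proof (cases "\<exists>y\<in>S. c y \<noteq> 0")
  case True
  then have "(F has_real_derivative f) (at x)" using F by blast
  moreover have "(c has_real_derivative deriv c x) (at x)" using c by (simp add: field_differentiable_derivI)
  ultimately show ?thesis by (auto intro!: derivative_eq_intros)
next
  case False
  then have z: "c y = 0" if "y \<in> S" for y using that by blast
  have "(c has_real_derivative 0) (at x)"
    by (rule has_field_derivative_transform_within_open[OF DERIV_const[of 0] S]) (simp add: z)
  then have "deriv c x = 0" by (rule DERIV_imp_deriv)
  moreover have "((\<lambda>y. c y * F y) has_real_derivative 0) (at x)"
    by (rule has_field_derivative_transform_within_open[OF DERIV_const[of 0] S]) (simp add: z)
  ultimately show ?thesis using z[OF S(2)] by simp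
qed

section \<open>Kernel expectations as tail integrals\<close>

context stein_setting
begin

lemma AE_Z:
  assumes "AE x in lborel. R x"
  shows "AE \<omega> in M. R (Z \<omega>)"
proof -
  have "AE x in density lborel (\<lambda>x. ennreal (p x)). R x"
    using assms by (subst AE_density) auto
  then have "AE x in distr M lborel Z. R x"
    unfolding distributed_distr_eq_density[OF dist] .
  then show ?thesis
    using distributed_measurable[OF dist] by (rule AE_distrD[rotated])
qed

lemma kernel_measurable [measurable]: "K i j x \<in> borel_measurable borel"
  unfolding stein_kernel_def by measurable

text \<open>On either side of \<open>x\<close> the kernel is a constant times a tail over
  \<open>p v\<close>. Integrability of the whole yields that of a half only if its constant is
  nonzero, whence the conditional conclusions; the formula for the expectation holds regardless,
  since a vanishing constant suppresses its integral. \<open>g1\<close> is a Borel representative of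
  \<open>g\<close>, which may be a derivative known only almost everywhere.\<close>

lemma kernel_expectation:
  assumes x: "x \<in> I" and [measurable]: "g1 \<in> borel_measurable borel" and gg1: "AE v in lborel. g v = g1 v"
    and int: "integrable M (\<lambda>\<omega>. K i j x (Z \<omega>) * g (Z \<omega>))"
  shows "(deriv ^^ i) mU x \<noteq> 0 \<Longrightarrow> set_integrable lborel (einterval l (ereal x)) (\<lambda>v. P j v * g1 v)"
    and "(deriv ^^ i) mL x \<noteq> 0 \<Longrightarrow> set_integrable lborel (einterval (ereal x) u) (\<lambda>v. Q j v * g1 v)"
    and "(\<integral>\<omega>. K i j x (Z \<omega>) * g (Z \<omega>) \<partial>M) =
      (-1) ^ j * ((deriv ^^ i) mU x * lower_integral j g1 x) - (deriv ^^ i) mL x * upper_integral j g1 x"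
proof -
  have Zm [measurable]: "Z \<in> measurable M borel" using distributed_measurable[OF dist] by simp
  define c1 where "c1 = (-1) ^ j * (deriv ^^ i) mU x"
  define c2 where "c2 = (deriv ^^ i) mL x"
  define H where "H v = p v * (K i j x v * g1 v)" for v
  have AEZ: "AE \<omega> in M. K i j x (Z \<omega>) * g (Z \<omega>) = K i j x (Z \<omega>) * g1 (Z \<omega>)"
    using AE_Z[OF gg1] by eventually_elim simp
  have m1: "(\<lambda>\<omega>. K i j x (Z \<omega>) * g1 (Z \<omega>)) \<in> borel_measurable M" by measurable
  have "integrable M (\<lambda>\<omega>. K i j x (Z \<omega>) * g1 (Z \<omega>))"
    using integrable_cong_AE[OF borel_measurable_integrable[OF int] m1 AEZ] int by simp
  then have intH: "integrable lborel H"
    unfolding H_def using distributed_integrable[OF dist, of "\<lambda>v. K i j x v * g1 v"] p_nonneg by simp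
  have "(\<integral>\<omega>. K i j x (Z \<omega>) * g (Z \<omega>) \<partial>M) = (\<integral>\<omega>. K i j x (Z \<omega>) * g1 (Z \<omega>) \<partial>M)"
    by (rule integral_cong_AE[OF borel_measurable_integrable[OF int] m1 AEZ])
  also have "\<dots> = integral\<^sup>L lborel H"
    unfolding H_def using distributed_integral[OF dist, of "\<lambda>v. K i j x v * g1 v"] p_nonneg by simp
  finally have EH: "(\<integral>\<omega>. K i j x (Z \<omega>) * g (Z \<omega>) \<partial>M) = integral\<^sup>L lborel H" .
  \<comment> \<open>The exceptions are \<open>v = x\<close> and the gap points, all null; outside
    \<open>(l, u)\<close> the density vanishes.\<close>
  have Heq: "AE v in lborel.
      indicator {..x} v * H v = c1 * (indicator (einterval l (ereal x)) v *\<^sub>R (P j v * g1 v)) \<and>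
      indicator {x<..} v * H v = - (c2 * (indicator (einterval (ereal x) u) v *\<^sub>R (Q j v * g1 v)))"
    using AE_in_I AE_p_zero AE_lborel_singleton[of x]
  proof eventually_elim
    case (elim v)
    have "l < ereal x" "ereal x < u" using x I_subset by (auto simp: einterval_def)
    then have lx: "v < x \<Longrightarrow> ereal v < u" "x < v \<Longrightarrow> l < ereal v"
      using less_trans[of "ereal v" "ereal x" u] less_trans[of l "ereal x" "ereal v"] by simp_all
    show ?case
    proof (cases "v \<in> einterval l u")
      case True
      then have "p v \<noteq> 0" using elim by auto
      with True elim show ?thesis
        by (auto simp: H_def stein_kernel_def c1_def c2_def einterval_def split: split_indicator)
    next
      case False
      then have "v \<notin> einterval l (ereal x)" "v \<notin> einterval (ereal x) u"
        using lx by (auto simp: einterval_def)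
      with False elim show ?thesis by (simp add: H_def)
    qed
  qed
  have [measurable]: "H \<in> borel_measurable borel" using intH by auto
  have int1: "integrable lborel (\<lambda>v. indicator {..x} v * H v)" "integrable lborel (\<lambda>v. indicator {x<..} v * H v)"
    using integrable_mult_indicator[OF _ intH, of "{..x}"] integrable_mult_indicator[OF _ intH, of "{x<..}"] by simp_all
  have sum: "integral\<^sup>L lborel H = (\<integral>v. indicator {..x} v * H v \<partial>lborel) + (\<integral>v. indicator {x<..} v * H v \<partial>lborel)"
    unfolding Bochner_Integration.integral_add[OF int1, symmetric]
    by (intro Bochner_Integration.integral_cong) (auto split: split_indicator)
  have i1: "integrable lborel (\<lambda>v. c1 * (indicator (einterval l (ereal x)) v *\<^sub>R (P j v * g1 v)))"
    using integrable_cong_AE[of "\<lambda>v. indicator {..x} v * H v" lborel "\<lambda>v. c1 * (indicator (einterval l (ereal x)) v *\<^sub>R (P j v * g1 v))"]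
      int1(1) Heq by (auto elim: eventually_mono)
  have i2: "integrable lborel (\<lambda>v. - (c2 * (indicator (einterval (ereal x) u) v *\<^sub>R (Q j v * g1 v))))"
    using integrable_cong_AE[of "\<lambda>v. indicator {x<..} v * H v" lborel "\<lambda>v. - (c2 * (indicator (einterval (ereal x) u) v *\<^sub>R (Q j v * g1 v)))"]
      int1(2) Heq by (auto elim: eventually_mono)
  show "set_integrable lborel (einterval l (ereal x)) (\<lambda>v. P j v * g1 v)" if "(deriv ^^ i) mU x \<noteq> 0"
  proof -
    have "c1 \<noteq> 0" using that by (simp add: c1_def)
    then show ?thesis unfolding set_integrable_def using i1 by (simp add: integrable_mult_right_iff)
  qed
  show "set_integrable lborel (einterval (ereal x) u) (\<lambda>v. Q j v * g1 v)" if "(deriv ^^ i) mL x \<noteq> 0"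
  proof -
    have "c2 \<noteq> 0" using that by (simp add: c2_def)
    then show ?thesis unfolding set_integrable_def using i2 by (simp add: integrable_mult_right_iff)
  qed
  have "(\<integral>v. indicator {..x} v * H v \<partial>lborel) = (\<integral>v. c1 * (indicator (einterval l (ereal x)) v *\<^sub>R (P j v * g1 v)) \<partial>lborel)"
    using Heq by (intro integral_cong_AE) (auto elim: eventually_mono)
  also have "\<dots> = c1 * lower_integral j g1 x"
    by (simp add: lower_integral_def set_lebesgue_integral_def)
  finally have e1: "(\<integral>v. indicator {..x} v * H v \<partial>lborel) = c1 * lower_integral j g1 x" .
  have "(\<integral>v. indicator {x<..} v * H v \<partial>lborel) = (\<integral>v. - (c2 * (indicator (einterval (ereal x) u) v *\<^sub>R (Q j v * g1 v))) \<partial>lborel)"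
    using Heq by (intro integral_cong_AE) (auto elim: eventually_mono)
  also have "\<dots> = - (c2 * upper_integral j g1 x)"
    by (simp add: upper_integral_def set_lebesgue_integral_def)
  finally show "(\<integral>\<omega>. K i j x (Z \<omega>) * g (Z \<omega>) \<partial>M) =
      (-1) ^ j * ((deriv ^^ i) mU x * lower_integral j g1 x) - (deriv ^^ i) mL x * upper_integral j g1 x"
    unfolding EH sum e1 by (simp add: c1_def c2_def)
qed

lemma coeff_eq: "C i (int j) x = (-1) ^ j * (deriv ^^ i) mU x * P (Suc j) x - (deriv ^^ i) mL x * Q (Suc j) x"
proof -
  have "nat (int j + 1) = Suc j" by simp
  then show ?thesis by (simp only: stein_coeff_def power_int_of_nat)
qed

text \<open>The form in which boundary terms arise from differentiation in \<open>x\<close>. At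
  \<open>j = 0\<close> the second index is -1; in general the lowered index reverses the sign
  \<open>(-1) ^ j\<close>.\<close>

lemma coeff_pred_eq: "C i (int j - 1) x = - ((-1) ^ j * (deriv ^^ i) mU x * P j x) - (deriv ^^ i) mL x * Q j x"
proof -
  have "nat (int j - 1 + 1) = j" by simp
  moreover have "(-1 :: real) powi (int j - 1) = - ((-1) ^ j)" by (simp add: power_int_diff)
  ultimately show ?thesis by (simp add: stein_coeff_def)
qed

text \<open>With \<open>P (Suc j)\<close> as antiderivative of \<open>P j\<close> on
  \<open>(l, x)\<close>, the boundary term at \<open>l\<close> vanishes by \<open>lim\<close> and
  the one at \<open>x\<close> is read off by continuity.\<close>

lemma lower_integral_by_parts:
  assumes x: "x \<in> I" and fin: "finite_tails (Suc j)"
    and g: "\<And>a b. a \<le> b \<Longrightarrow> (LINT t:{a..b}|lborel. g' t) = g b - g a" "\<And>a b. set_integrable lborel {a..b} g'"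
    and gc: "continuous_on UNIV g"
    and int: "set_integrable lborel (einterval l (ereal x)) (\<lambda>v. P j v * g v)"
      "set_integrable lborel (einterval l (ereal x)) (\<lambda>v. P (Suc j) v * g' v)"
    and lim: "(((\<lambda>v. g v * P (Suc j) v) \<circ> real_of_ereal) \<longlongrightarrow> 0) (at_right l)"
  shows "lower_integral j g x = P (Suc j) x * g x - lower_integral (Suc j) g' x"
proof -
  have xI: "l < ereal x" "ereal x < u" "x \<in> einterval l u" using x I_subset by (auto simp: einterval_def)
  have "lower_integral j g x + lower_integral (Suc j) g' x = P (Suc j) x * g x - 0"
    unfolding lower_integral_def
  proof (rule integral_by_parts_einterval[OF xI(1)])
    show "set_integrable lborel {a..b} (P j) \<and> P (Suc j) b - P (Suc j) a = (LINT t:{a..b}|lborel. P j t)"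
      if "l < ereal a" "a \<le> b" "ereal b < ereal x" for a b
      using P_diff[OF fin that(1,2)] that(3) xI by (meson order.strict_trans)
    show "set_integrable lborel {a..b} g' \<and> g b - g a = (LINT t:{a..b}|lborel. g' t)" if "a \<le> b" for a b
      using g that by auto
    show "continuous_on (einterval l (ereal x)) (P (Suc j))"
      using xI less_trans[OF _ xI(2), of "ereal _"]
      by (intro continuous_on_subset[OF tail_continuous(1)[OF fin]]) (auto simp: einterval_def)
    show "continuous_on (einterval l (ereal x)) g" using gc by (rule continuous_on_subset) simp
    show "(((\<lambda>x. P (Suc j) x * g x) \<circ> real_of_ereal) \<longlongrightarrow> 0) (at_right l)"
      using lim by (simp only: mult.commute)
    have "isCont (P (Suc j)) x" "isCont g x"
      using tail_continuous(1)[OF fin] xI(3) gc by (auto simp: continuous_on_eq_continuous_at open_einterval)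
    then have "isCont (\<lambda>x. P (Suc j) x * g x) x" by (rule isCont_mult)
    then have "((\<lambda>x. P (Suc j) x * g x) \<longlongrightarrow> P (Suc j) x * g x) (at_left x)"
      unfolding isCont_def by (rule filterlim_mono[OF _ order_refl]) (simp add: at_le)
    then show "(((\<lambda>x. P (Suc j) x * g x) \<circ> real_of_ereal) \<longlongrightarrow> P (Suc j) x * g x) (at_left (ereal x))"
      by (simp only: ereal_tendsto_simps1)
  qed (use int in auto)
  then show ?thesis by simp
qed

text \<open>The antiderivative \<open>- Q (Suc j)\<close> makes the remaining integral enter with
  the sign opposite to the lower case. The alternating factor \<open>(-1) ^ j\<close> on the lower
  half of the kernel compensates for this, so that the two halves recombine into the kernel of index
  \<open>Suc j\<close>.\<close>

lemma upper_integral_by_parts: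
  assumes x: "x \<in> I" and fin: "finite_tails (Suc j)"
    and g: "\<And>a b. a \<le> b \<Longrightarrow> (LINT t:{a..b}|lborel. g' t) = g b - g a" "\<And>a b. set_integrable lborel {a..b} g'"
    and gc: "continuous_on UNIV g"
    and int: "set_integrable lborel (einterval (ereal x) u) (\<lambda>v. Q j v * g v)"
      "set_integrable lborel (einterval (ereal x) u) (\<lambda>v. Q (Suc j) v * g' v)"
    and lim: "(((\<lambda>v. g v * Q (Suc j) v) \<circ> real_of_ereal) \<longlongrightarrow> 0) (at_left u)"
  shows "upper_integral j g x = Q (Suc j) x * g x + upper_integral (Suc j) g' x"
proof -
  have xI: "l < ereal x" "ereal x < u" "x \<in> einterval l u" using x I_subset by (auto simp: einterval_def)
  have "upper_integral j g x + (LINT t:einterval (ereal x) u|lborel. - Q (Suc j) t * g' t) = 0 - (- Q (Suc j) x * g x)"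
    unfolding upper_integral_def
  proof (rule integral_by_parts_einterval[OF xI(2)])
    show "set_integrable lborel {a..b} (Q j) \<and> - Q (Suc j) b - - Q (Suc j) a = (LINT t:{a..b}|lborel. Q j t)"
      if "ereal x < ereal a" "a \<le> b" "ereal b < u" for a b
      using Q_diff[OF fin _ that(2,3)] that(1) xI by (meson order.strict_trans)
    show "set_integrable lborel {a..b} g' \<and> g b - g a = (LINT t:{a..b}|lborel. g' t)" if "a \<le> b" for a b
      using g that by auto
    show "continuous_on (einterval (ereal x) u) (\<lambda>v. - Q (Suc j) v)"
      using xI less_trans[OF xI(1), of "ereal _"]
      by (intro continuous_on_minus continuous_on_subset[OF tail_continuous(2)[OF fin]]) (auto simp: einterval_def)
    show "continuous_on (einterval (ereal x) u) g" using gc by (rule continuous_on_subset) simp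
    show "(((\<lambda>x. - Q (Suc j) x * g x) \<circ> real_of_ereal) \<longlongrightarrow> 0) (at_left u)"
      using tendsto_minus[OF lim] by (simp add: o_def mult.commute)
    have "isCont (Q (Suc j)) x" "isCont g x"
      using tail_continuous(2)[OF fin] xI(3) gc by (auto simp: continuous_on_eq_continuous_at open_einterval)
    then have "isCont (\<lambda>x. - Q (Suc j) x * g x) x" by (intro isCont_mult isCont_minus)
    then have "((\<lambda>x. - Q (Suc j) x * g x) \<longlongrightarrow> - Q (Suc j) x * g x) (at_right x)"
      unfolding isCont_def by (rule filterlim_mono[OF _ order_refl]) (simp add: at_le)
    then show "(((\<lambda>x. - Q (Suc j) x * g x) \<circ> real_of_ereal) \<longlongrightarrow> - Q (Suc j) x * g x) (at_right (ereal x))"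
      by (simp only: ereal_tendsto_simps1)
    show "set_integrable lborel (einterval (ereal x) u) (\<lambda>t. - Q (Suc j) t * g' t)"
      using set_integrable_mult_right[OF int(2), of "-1"] by simp
  qed (use int in auto)
  moreover have "(LINT t:einterval (ereal x) u|lborel. - Q (Suc j) t * g' t) = - upper_integral (Suc j) g' x"
    unfolding upper_integral_def set_lebesgue_integral_def by simp
  ultimately show ?thesis by simp
qed

lemma kernel_hypD:
  assumes "kernel_hyp M Z l u p w i j g"
  shows "finite_tails (Suc j)" "locally_abs_cont_on UNIV g" "continuous_on UNIV g"
    and "\<And>k x. k \<le> i \<Longrightarrow> x \<in> I \<Longrightarrow> (deriv ^^ k) mU field_differentiable (at x)"
    and "\<And>k x. k \<le> i \<Longrightarrow> x \<in> I \<Longrightarrow> (deriv ^^ k) mL field_differentiable (at x)"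
    and "\<And>x. x \<in> I \<Longrightarrow> integrable M (\<lambda>\<omega>. K i j x (Z \<omega>) * g (Z \<omega>))"
    and "\<And>x. x \<in> I \<Longrightarrow> integrable M (\<lambda>\<omega>. K i (Suc j) x (Z \<omega>) * deriv g (Z \<omega>))"
    and "\<And>x. x \<in> I \<Longrightarrow> integrable M (\<lambda>\<omega>. K (Suc i) j x (Z \<omega>) * g (Z \<omega>))"
    and "(((\<lambda>v. g v * P (Suc j) v) \<circ> real_of_ereal) \<longlongrightarrow> 0) (at_right l)"
    and "(((\<lambda>v. g v * Q (Suc j) v) \<circ> real_of_ereal) \<longlongrightarrow> 0) (at_left u)"
proof -
  note kh = assms[unfolded kernel_hyp_def]
  show "finite_tails (Suc j)" using kh unfolding finite_tails_def by simp
  show ac: "locally_abs_cont_on UNIV g" using kh by blast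
  show "continuous_on UNIV g" by (rule locally_abs_cont_on_continuous[OF ac]) simp
  have "(deriv ^^ k) mU field_differentiable (at x) \<and> (deriv ^^ k) mL field_differentiable (at x)"
    if k: "k \<le> i" and x: "x \<in> I" for k x
  proof -
    obtain \<epsilon> where "\<epsilon> > 0" "\<forall>\<mu>\<in>{mL, mU}. times_differentiable_on (i + 1) \<mu> (ball x \<epsilon>)"
      using kh x by blast
    then show ?thesis using k unfolding times_differentiable_on_def by simp
  qed
  then show "\<And>k x. k \<le> i \<Longrightarrow> x \<in> I \<Longrightarrow> (deriv ^^ k) mU field_differentiable (at x)"
    "\<And>k x. k \<le> i \<Longrightarrow> x \<in> I \<Longrightarrow> (deriv ^^ k) mL field_differentiable (at x)" by auto
qed (use assms[unfolded kernel_hyp_def] in simp_all)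

lemma kernel_by_parts:
  assumes kh: "kernel_hyp M Z l u p w i j g" and x: "x \<in> I"
  shows "(\<integral>\<omega>. K i j x (Z \<omega>) * g (Z \<omega>) \<partial>M) =
    (\<integral>\<omega>. K i (Suc j) x (Z \<omega>) * deriv g (Z \<omega>) \<partial>M) + C i (int j) x * g x"
proof -
  note hyp = kernel_hypD[OF kh]
  obtain g' :: "real \<Rightarrow> real" where g': "g' \<in> borel_measurable borel"
    "AE x in lborel. (g has_real_derivative g' x) (at x)"
    "\<And>a b. set_integrable lborel {a..b} g'"
    "\<And>a b. a \<le> b \<Longrightarrow> (LINT t:{a..b}|lborel. g' t) = g b - g a"
    using locally_abs_cont_FTC[OF hyp(2)] by metis
  have gm: "g \<in> borel_measurable borel" using hyp(3) by (rule borel_measurable_continuous_onI)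
  have dg: "AE v in lborel. deriv g v = g' v" using g'(2) by eventually_elim (rule DERIV_imp_deriv)
  note r1 = kernel_expectation[OF x gm AE_I2 hyp(6)[OF x], simplified]
  note r2 = kernel_expectation[OF x g'(1) dg hyp(7)[OF x]]
  \<comment> \<open>Where the factor vanishes both sides are zero; where it does not, it guarantees
    that both lower integrals converge. The identity for the upper half is obtained in the same
    way.\<close>
  have U: "(deriv ^^ i) mU x * lower_integral j g x =
      (deriv ^^ i) mU x * (P (Suc j) x * g x - lower_integral (Suc j) g' x)"
    using lower_integral_by_parts[OF x hyp(1) g'(4,3) hyp(3) r1(1) r2(1) hyp(9)] by auto
  have L: "(deriv ^^ i) mL x * upper_integral j g x =
      (deriv ^^ i) mL x * (Q (Suc j) x * g x + upper_integral (Suc j) g' x)"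
    using upper_integral_by_parts[OF x hyp(1) g'(4,3) hyp(3) r1(2) r2(2) hyp(10)] by auto
  show ?thesis
    unfolding r1(3) r2(3) coeff_eq U L by (simp add: algebra_simps)
qed

text \<open>Convergence at a single point \<open>y\<close> suffices: moving the upper limit to
  another point of the support adds or removes a compact piece, on which \<open>P j\<close> is
  integrable and \<open>g\<close> bounded.\<close>

lemma lower_integral_has_derivative:
  assumes fin: "finite_tails j" "finite_tails (Suc j)" and x: "x \<in> I" and y: "y \<in> I"
    and gc: "continuous_on UNIV g" and int: "set_integrable lborel (einterval l (ereal y)) (\<lambda>v. P j v * g v)"
  shows "(lower_integral j g has_real_derivative P j x * g x) (at x)"
proof (rule has_real_derivative_density[OF open_I x])
  show "continuous_on I (\<lambda>v. P j v * g v)"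
    using tail_continuous_on_I(1)[OF fin(1)] gc by (intro continuous_on_mult) (auto intro: continuous_on_subset)
  fix c d assume cd: "c \<le> d" "{c..d} \<subseteq> I"
  then have cdI: "c \<in> einterval l u" "d \<in> einterval l u" using I_subset by auto
  obtain z where z: "z \<in> I" "d < z" using ex_above[OF cdI(2)] .
  have zy: "l < ereal y" "ereal z < u" using y z I_subset by (auto simp: einterval_def)
  have "set_integrable lborel {y..z} (\<lambda>v. P j v * g v)"
  proof (cases "y \<le> z")
    case True
    then show ?thesis using P_diff[OF fin(2) zy(1) True zy(2)] gc
      by (intro set_integrable_mult_continuous) (auto intro: continuous_on_subset)
  qed (simp add: set_integrable_def)
  with int have "set_integrable lborel (einterval l (ereal y) \<union> {y..z}) (\<lambda>v. P j v * g v)"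
    by (intro set_integrable_Un) auto
  then have "set_integrable lborel (einterval l (ereal z)) (\<lambda>v. P j v * g v)"
    by (rule set_integrable_subset) (auto simp: einterval_def)
  then show "lower_integral j g d - lower_integral j g c = (LINT t:{c..d}|lborel. P j t * g t)"
    using set_integral_einterval_split_lower[of l z "\<lambda>v. P j v * g v" c d] cd z cdI
    by (simp add: lower_integral_def einterval_def)
qed

lemma upper_integral_has_derivative:
  assumes fin: "finite_tails j" "finite_tails (Suc j)" and x: "x \<in> I" and y: "y \<in> I"
    and gc: "continuous_on UNIV g" and int: "set_integrable lborel (einterval (ereal y) u) (\<lambda>v. Q j v * g v)"
  shows "(upper_integral j g has_real_derivative - (Q j x * g x)) (at x)"
proof -
  have "((\<lambda>x. - upper_integral j g x) has_real_derivative Q j x * g x) (at x)"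
  proof (rule has_real_derivative_density[OF open_I x])
    show "continuous_on I (\<lambda>v. Q j v * g v)"
      using tail_continuous_on_I(2)[OF fin(1)] gc by (intro continuous_on_mult) (auto intro: continuous_on_subset)
    fix c d assume cd: "c \<le> d" "{c..d} \<subseteq> I"
    then have cdI: "c \<in> einterval l u" "d \<in> einterval l u" using I_subset by auto
    obtain z where z: "z \<in> I" "z < c" using ex_below[OF cdI(1)] .
    have zy: "l < ereal z" "ereal y < u" using y z I_subset by (auto simp: einterval_def)
    have "set_integrable lborel {z..y} (\<lambda>v. Q j v * g v)"
    proof (cases "z \<le> y")
      case True
      then show ?thesis using Q_diff[OF fin(2) zy(1) True zy(2)] gc
        by (intro set_integrable_mult_continuous) (auto intro: continuous_on_subset)
    qed (simp add: set_integrable_def)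
    with int have "set_integrable lborel (einterval (ereal y) u \<union> {z..y}) (\<lambda>v. Q j v * g v)"
      by (intro set_integrable_Un) auto
    then have "set_integrable lborel (einterval (ereal z) u) (\<lambda>v. Q j v * g v)"
      by (rule set_integrable_subset) (auto simp: einterval_def)
    then show "- upper_integral j g d - - upper_integral j g c = (LINT t:{c..d}|lborel. Q j t * g t)"
      using set_integral_einterval_split_upper[of z u "\<lambda>v. Q j v * g v" c d] cd z cdI
      by (simp add: upper_integral_def einterval_def)
  qed
  from DERIV_minus[OF this] show ?thesis by simp
qed

text \<open>The product rule is applied to each factor times its tail integral. Differentiating the
  factors raises the index \<open>i\<close>; differentiating the limits of integration gives the
  boundary values at \<open>x\<close>, which together are
  \<open>- C i (int j - 1) x * g x\<close>.\<close>

lemma kernel_has_derivative: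
  assumes fin: "finite_tails j" "finite_tails (Suc j)" and x: "x \<in> I" and gc: "continuous_on UNIV g"
    and int: "\<And>y. y \<in> I \<Longrightarrow> integrable M (\<lambda>\<omega>. K i j y (Z \<omega>) * g (Z \<omega>))"
    and int': "integrable M (\<lambda>\<omega>. K (Suc i) j x (Z \<omega>) * g (Z \<omega>))"
    and U: "(deriv ^^ i) mU field_differentiable (at x)" and L: "(deriv ^^ i) mL field_differentiable (at x)"
  shows "((\<lambda>y. \<integral>\<omega>. K i j y (Z \<omega>) * g (Z \<omega>) \<partial>M) has_real_derivative
    (\<integral>\<omega>. K (Suc i) j x (Z \<omega>) * g (Z \<omega>) \<partial>M) - C i (int j - 1) x * g x) (at x)"
proof -
  have gm: "g \<in> borel_measurable borel" using gc by (rule borel_measurable_continuous_onI)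
  have rep: "(\<integral>\<omega>. K i j y (Z \<omega>) * g (Z \<omega>) \<partial>M) =
      (-1) ^ j * ((deriv ^^ i) mU y * lower_integral j g y) - (deriv ^^ i) mL y * upper_integral j g y"
    if "y \<in> I" for y
    using kernel_expectation(3)[OF that gm AE_I2 int[OF that]] by simp
  have dU: "((\<lambda>y. (deriv ^^ i) mU y * lower_integral j g y) has_real_derivative
      deriv ((deriv ^^ i) mU) x * lower_integral j g x + (deriv ^^ i) mU x * (P j x * g x)) (at x)"
  proof (rule has_real_derivative_mult_guarded[OF open_I x U])
    fix y assume y: "y \<in> I" "(deriv ^^ i) mU y \<noteq> 0"
    show "(lower_integral j g has_real_derivative P j x * g x) (at x)"
      using kernel_expectation(1)[OF y(1) gm AE_I2 int[OF y(1)] y(2)]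
      by (intro lower_integral_has_derivative[OF fin x y(1) gc]) simp
  qed
  have dL: "((\<lambda>y. (deriv ^^ i) mL y * upper_integral j g y) has_real_derivative
      deriv ((deriv ^^ i) mL) x * upper_integral j g x + (deriv ^^ i) mL x * - (Q j x * g x)) (at x)"
  proof (rule has_real_derivative_mult_guarded[OF open_I x L])
    fix y assume y: "y \<in> I" "(deriv ^^ i) mL y \<noteq> 0"
    show "(upper_integral j g has_real_derivative - (Q j x * g x)) (at x)"
      using kernel_expectation(2)[OF y(1) gm AE_I2 int[OF y(1)] y(2)]
      by (intro upper_integral_has_derivative[OF fin x y(1) gc]) simp
  qed
  have "((\<lambda>y. (-1) ^ j * ((deriv ^^ i) mU y * lower_integral j g y) - (deriv ^^ i) mL y * upper_integral j g y)
      has_real_derivative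
      (-1) ^ j * (deriv ((deriv ^^ i) mU) x * lower_integral j g x + (deriv ^^ i) mU x * (P j x * g x)) -
      (deriv ((deriv ^^ i) mL) x * upper_integral j g x + (deriv ^^ i) mL x * - (Q j x * g x))) (at x)"
    by (rule DERIV_diff[OF DERIV_cmult[OF dU] dL])
  then have "((\<lambda>y. \<integral>\<omega>. K i j y (Z \<omega>) * g (Z \<omega>) \<partial>M) has_real_derivative
      (-1) ^ j * (deriv ((deriv ^^ i) mU) x * lower_integral j g x + (deriv ^^ i) mU x * (P j x * g x)) -
      (deriv ((deriv ^^ i) mL) x * upper_integral j g x + (deriv ^^ i) mL x * - (Q j x * g x))) (at x)"
    by (rule has_field_derivative_transform_within_open[OF _ open_I x]) (simp only: rep)
  moreover have E: "(\<integral>\<omega>. K (Suc i) j x (Z \<omega>) * g (Z \<omega>) \<partial>M) =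
      (-1) ^ j * ((deriv ^^ Suc i) mU x * lower_integral j g x) - (deriv ^^ Suc i) mL x * upper_integral j g x"
    using kernel_expectation(3)[OF x gm AE_I2 int'] by simp
  ultimately show ?thesis
    unfolding E coeff_pred_eq by (elim DERIV_cong) (simp add: algebra_simps)
qed

section \<open>The solution in terms of the kernel\<close>

lemma integral_p_split:
  assumes x: "x \<in> I" and int: "integrable lborel (\<lambda>v. p v * f v)"
  shows "(\<integral>v. p v * f v \<partial>lborel) = lower_integral 0 f x + upper_integral 0 f x"
proof -
  have i: "integrable lborel (\<lambda>v. indicator (einterval l (ereal x)) v *\<^sub>R (p v * f v))"
    "integrable lborel (\<lambda>v. indicator (einterval (ereal x) u) v *\<^sub>R (p v * f v))"
    using int by (intro integrable_mult_indicator; simp)+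
  have [measurable]: "(\<lambda>v. p v * f v) \<in> borel_measurable borel" using int by auto
  have xI: "l < ereal x" "ereal x < u" using x I_subset by (auto simp: einterval_def)
  have "(\<integral>v. p v * f v \<partial>lborel) = (\<integral>v. indicator (einterval l (ereal x)) v *\<^sub>R (p v * f v) +
      indicator (einterval (ereal x) u) v *\<^sub>R (p v * f v) \<partial>lborel)"
  proof (rule integral_cong_AE)
    show "AE v in lborel. p v * f v = indicator (einterval l (ereal x)) v *\<^sub>R (p v * f v) +
      indicator (einterval (ereal x) u) v *\<^sub>R (p v * f v)"
      using AE_p_zero AE_lborel_singleton[of x]
    proof eventually_elim
      case (elim v)
      then show ?case
        by (cases "v < x") (auto simp: einterval_def split: split_indicator)
    qed
  qed (use int i in auto)
  then show ?thesis
    unfolding Bochner_Integration.integral_add[OF i] lower_integral_def upper_integral_def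
      set_lebesgue_integral_def P_0 Q_0 .
qed

lemma P_1_plus_Q_1:
  assumes x: "x \<in> I"
  shows "P 1 x + Q 1 x = 1"
proof -
  have xI: "x \<in> einterval l u" using x I_subset by blast
  have "(\<integral>v. p v * 1 \<partial>lborel) = 1"
    using integral_eq_nn_integral[of p lborel] nn_integral_p p_nonneg by simp
  moreover have "(\<integral>v. p v * 1 \<partial>lborel) = lower_integral 0 (\<lambda>_. 1) x + upper_integral 0 (\<lambda>_. 1) x"
    using integrable_p by (intro integral_p_split[OF x]) simp
  moreover have "lower_integral 0 (\<lambda>_. 1) x = P 1 x" "upper_integral 0 (\<lambda>_. 1) x = Q 1 x"
    using P_integral(2)[of 0 x] Q_integral(2)[of 0 x] finite_tails_1 xI
    by (simp_all only: lower_integral_def upper_integral_def mult_1_right One_nat_def)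
  ultimately show ?thesis by simp
qed

text \<open>The mean of \<open>h\<close> is the lower plus the upper integral, and
  \<open>P 1 + Q 1\<close> is 1. So the lower integral minus \<open>P 1 x\<close> times the mean is
  \<open>Q 1 x\<close> times the lower minus \<open>P 1 x\<close> times the upper integral, and
  division by \<open>w x * p x\<close> turns these weights into \<open>mU x\<close> and
  \<open>mL x\<close>.\<close>

lemma stein_solution_eq:
  assumes x: "x \<in> I" and h: "integrable (density lborel (\<lambda>x. ennreal (p x))) h"
    and int: "integrable M (\<lambda>\<omega>. K 0 0 x (Z \<omega>) * h (Z \<omega>))"
  shows "stein_solution M Z l p w h x = (\<integral>\<omega>. K 0 0 x (Z \<omega>) * h (Z \<omega>) \<partial>M)"
proof -
  have hm [measurable]: "h \<in> borel_measurable borel" using h by auto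
  have ph: "integrable lborel (\<lambda>v. p v * h v)"
    using h p_nonneg by (subst (asm) integrable_density) auto
  have xI: "l < ereal x" "x \<in> einterval l u" using x I_subset by (auto simp: einterval_def)
  define c where "c = (\<integral>\<omega>. h (Z \<omega>) \<partial>M)"
  have c: "c = lower_integral 0 h x + upper_integral 0 h x"
    unfolding c_def integral_p_split[OF x ph, symmetric]
    using distributed_integral[OF dist, of h] p_nonneg by simp
  have si: "set_integrable lborel (einterval l (ereal x)) (\<lambda>v. p v * h v)"
    "set_integrable lborel (einterval l (ereal x)) p"
    using ph integrable_p by (simp_all add: integrable_imp_set_integrable)
  have lp: "(LINT t:einterval l (ereal x)|lborel. p t) = P 1 x"
    using P_integral(2)[of 0 x] finite_tails_1 xI unfolding P_0 One_nat_def by simp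
  have "(LBINT t=l..ereal x. (h t - c) * p t) = (LINT t:einterval l (ereal x)|lborel. p t * h t - c * p t)"
    using xI(1) by (simp add: interval_lebesgue_integral_le_eq algebra_simps)
  also have "\<dots> = (LINT t:einterval l (ereal x)|lborel. p t * h t) - c * P 1 x"
    using si lp by (subst set_integral_diff) auto
  also have "(LINT t:einterval l (ereal x)|lborel. p t * h t) = lower_integral 0 h x"
    unfolding lower_integral_def P_0 ..
  finally have L: "(LBINT t=l..ereal x. (h t - c) * p t) = lower_integral 0 h x - c * P 1 x" .
  have "stein_solution M Z l p w h x = (lower_integral 0 h x - c * P 1 x) / (w x * p x)"
    unfolding stein_solution_def c_def[symmetric] L by simp
  also have "lower_integral 0 h x - c * P 1 x = Q 1 x * lower_integral 0 h x - P 1 x * upper_integral 0 h x"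
    unfolding c using P_1_plus_Q_1[OF x] by (simp add: algebra_simps eq_diff_eq flip: distrib_left)
  also have "\<dots> / (w x * p x) = mU x * lower_integral 0 h x - mL x * upper_integral 0 h x"
    by (simp add: m_upper_def m_lower_def diff_divide_distrib del: lower_tail.simps upper_tail.simps)
  also have "\<dots> = (\<integral>\<omega>. K 0 0 x (Z \<omega>) * h (Z \<omega>) \<partial>M)"
    using kernel_expectation(3)[OF x hm AE_I2 int] by simp
  finally show ?thesis .
qed

text \<open>With \<open>q = 1 / (w p)\<close>, \<open>mU\<close> is \<open>q\<close> times
  \<open>Q 1\<close> and \<open>mL\<close> is \<open>q\<close> times \<open>P 1\<close>. The
  contributions of the derivative of \<open>q\<close> to \<open>C 1 0\<close> cancel, and what
  remains is \<open>- p q\<close>, again because the two tails add up to 1.\<close>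

lemma coeff_0_eq_coeff_1:
  assumes x: "x \<in> I" and U: "mU field_differentiable (at x)" and L: "mL field_differentiable (at x)"
  shows "C 0 (-1) x = C 1 0 x"
proof -
  \<comment> \<open>Taken as a sum so that its differentiability follows from that of
    \<open>mU\<close> and \<open>mL\<close>, the only functions whose derivatives are given.\<close>
  define q where "q y = mU y + mL y" for y
  have q: "q y = 1 / (w y * p y)" and mU: "mU y = q y * Q 1 y" and mL: "mL y = q y * P 1 y" if "y \<in> I" for y
  proof -
    have "q y = (P 1 y + Q 1 y) / (w y * p y)"
      unfolding q_def m_upper_def m_lower_def by (simp add: add_divide_distrib)
    then show q: "q y = 1 / (w y * p y)" using P_1_plus_Q_1[OF that] by simp
    show "mU y = q y * Q 1 y" "mL y = q y * P 1 y" unfolding q m_upper_def m_lower_def by simp_all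
  qed
  obtain q' where q': "(q has_real_derivative q') (at x)"
    using field_differentiable_add[OF U L] unfolding field_differentiable_def q_def by blast
  have P1: "(P 1 has_real_derivative p x) (at x)" and Q1: "(Q 1 has_real_derivative - p x) (at x)"
    using tail_has_derivative[OF finite_tails_0 _ x] finite_tails_1 unfolding P_0 Q_0 One_nat_def by auto
  have "((\<lambda>y. q y * Q 1 y) has_real_derivative q' * Q 1 x + - p x * q x) (at x)"
    by (rule DERIV_mult[OF q' Q1])
  then have "(mU has_real_derivative q' * Q 1 x + - p x * q x) (at x)"
    by (rule has_field_derivative_transform_within_open[OF _ open_I x]) (simp only: mU)
  then have dU: "deriv mU x = q' * Q 1 x + - p x * q x" by (rule DERIV_imp_deriv)
  have "((\<lambda>y. q y * P 1 y) has_real_derivative q' * P 1 x + p x * q x) (at x)"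
    by (rule DERIV_mult[OF q' P1])
  then have "(mL has_real_derivative q' * P 1 x + p x * q x) (at x)"
    by (rule has_field_derivative_transform_within_open[OF _ open_I x]) (simp only: mL)
  then have dL: "deriv mL x = q' * P 1 x + p x * q x" by (rule DERIV_imp_deriv)
  have "C 0 (-1) x = - (mU x * p x) - mL x * p x"
    using coeff_pred_eq[of 0 0 x] P_0 Q_0 by simp
  also have "\<dots> = - (p x * q x)" by (simp add: q_def algebra_simps)
  also have "\<dots> = - (p x * q x * (P 1 x + Q 1 x))" unfolding P_1_plus_Q_1[OF x] by simp
  also have "\<dots> = deriv mU x * P 1 x - deriv mL x * Q 1 x"
    unfolding dU dL by (simp add: algebra_simps)
  also have "\<dots> = C 1 0 x"
    using coeff_eq[of 1 0 x] by (simp del: lower_tail.simps upper_tail.simps)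
  finally show ?thesis .
qed

text \<open>Differentiating the factors raises the first index, differentiating the tails lowers the
  second. The lower tail is increasing and the upper one decreasing, which matches the reversed sign
  of the lower term in \<open>C r (int r - 1)\<close>.\<close>

lemma coeff_diag_has_derivative:
  assumes "finite_tails r" "finite_tails (Suc r)" "x \<in> I"
    and U: "(deriv ^^ r) mU field_differentiable (at x)" and L: "(deriv ^^ r) mL field_differentiable (at x)"
  shows "(C r (int r) has_real_derivative C (Suc r) (int r) x - C r (int r - 1) x) (at x)"
proof -
  have U': "((deriv ^^ r) mU has_real_derivative (deriv ^^ Suc r) mU x) (at x)"
    using U by (simp add: field_differentiable_derivI)
  have L': "((deriv ^^ r) mL has_real_derivative (deriv ^^ Suc r) mL x) (at x)"
    using L by (simp add: field_differentiable_derivI)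
  have "((\<lambda>x. (-1) ^ r * ((deriv ^^ r) mU x * P (Suc r) x) - (deriv ^^ r) mL x * Q (Suc r) x) has_real_derivative
      (-1) ^ r * ((deriv ^^ Suc r) mU x * P (Suc r) x + P r x * (deriv ^^ r) mU x) -
      ((deriv ^^ Suc r) mL x * Q (Suc r) x + - Q r x * (deriv ^^ r) mL x)) (at x)"
    by (intro DERIV_diff DERIV_cmult DERIV_mult U' L' tail_has_derivative assms)
  moreover have "C r (int r) = (\<lambda>x. (-1) ^ r * ((deriv ^^ r) mU x * P (Suc r) x) - (deriv ^^ r) mL x * Q (Suc r) x)"
    unfolding coeff_eq fun_eq_iff by (simp only: mult.assoc simp_thms)
  moreover have "(-1) ^ r * ((deriv ^^ Suc r) mU x * P (Suc r) x + P r x * (deriv ^^ r) mU x) -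
      ((deriv ^^ Suc r) mL x * Q (Suc r) x + - Q r x * (deriv ^^ r) mL x) = C (Suc r) (int r) x - C r (int r - 1) x"
    unfolding coeff_pred_eq stein_coeff_def[of _ _ _ _ "Suc r"]
    by (simp add: algebra_simps nat_add_distrib del: lower_tail.simps upper_tail.simps funpow.simps)
  ultimately show ?thesis by simp
qed

end

section \<open>Derivatives of the solution\<close>

locale stein_derivatives = stein_setting M Z p w e l u m
  for M :: "'a measure" and Z p w e l u m +
  fixes h :: "real \<Rightarrow> real" and n :: nat
  assumes h_integrable: "integrable (density lborel (\<lambda>x. ennreal (p x))) h"
    and h_differentiable: "times_differentiable_on n h UNIV"
    and kernel_hyp_h: "kernel_hyp M Z l u p w 0 0 h"
    and kernel_hyp_deriv_h: "\<And>k. k \<le> n \<Longrightarrow> kernel_hyp M Z l u p w (Suc k) k ((deriv ^^ k) h)"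
    and coeff_differentiable: "\<And>r. r < n \<Longrightarrow>
      times_differentiable_on (n - r) (\<lambda>y. C (Suc r) (int r) y - C 1 0 y) I"
begin

text \<open>The index is shifted against the paper's sum: \<open>D r\<close> belongs to superscripts \<open>r + 1, r\<close>,
  and \<open>n\<close> stands for the paper's \<open>n - 1\<close>.\<close>

definition D :: "nat \<Rightarrow> real \<Rightarrow> real" where "D r y = C (Suc r) (int r) y - C 1 0 y"

text \<open>Belongs to the derivative of order \<open>k + 1\<close> of the solution: one more
  differentiation raises the outer order of every summand, and a new summand with
  \<open>r = k\<close> enters with outer order 0.\<close>

definition correction :: "nat \<Rightarrow> real \<Rightarrow> real" where
  "correction k x = (\<Sum>r<k. (deriv ^^ (k - 1 - r)) (\<lambda>y. deriv (D r) y * (deriv ^^ r) h y) x)"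

abbreviation f :: "real \<Rightarrow> real" where "f \<equiv> stein_solution M Z l p w h"

section \<open>Differentiability of the ingredients\<close>

lemma D_differentiable: "r < n \<Longrightarrow> times_differentiable_on (n - r) (D r) I"
  using coeff_differentiable[of r] by (simp add: D_def[abs_def])

lemma h_deriv_differentiable: "a + b \<le> n \<Longrightarrow> times_differentiable_on a ((deriv ^^ b) h) I"
  using times_differentiable_on_mono[OF h_differentiable, of "a + b" I]
  by (intro times_differentiable_on_higher_deriv) simp

lemma m_differentiable:
  assumes "k \<le> Suc n" "x \<in> I"
  shows "(deriv ^^ k) mU field_differentiable (at x)" "(deriv ^^ k) mL field_differentiable (at x)"
  using kernel_hypD(4,5)[OF kernel_hyp_deriv_h[OF order_refl] assms] by auto

lemma finite_tails_le: "k \<le> Suc n \<Longrightarrow> finite_tails k"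
  using kernel_hypD(1)[OF kernel_hyp_deriv_h] finite_tails_0 by (cases k) auto

lemma summand_differentiable:
  assumes "r < n"
  shows "times_differentiable_on (n - Suc r) (\<lambda>y. deriv (D r) y * (deriv ^^ r) h y) I"
proof (rule times_differentiable_on_mult[OF open_I])
  have "n - r = Suc (n - Suc r)" using assms by simp
  then show "times_differentiable_on (n - Suc r) (deriv (D r)) I"
    using D_differentiable[OF assms] times_differentiable_on_Suc by metis
  show "times_differentiable_on (n - Suc r) ((deriv ^^ r) h) I"
    using assms by (intro h_deriv_differentiable) simp
qed

lemma correction_has_derivative:
  assumes "k < n" "x \<in> I"
  shows "(correction k has_real_derivative
    (\<Sum>r<k. (deriv ^^ (k - r)) (\<lambda>y. deriv (D r) y * (deriv ^^ r) h y) x)) (at x)"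
proof -
  have "(deriv ^^ (k - 1 - r)) (\<lambda>y. deriv (D r) y * (deriv ^^ r) h y) field_differentiable (at x)" if "r < k" for r
    using summand_differentiable[of r] that assms unfolding times_differentiable_on_def by simp
  then have "(correction k has_real_derivative
      (\<Sum>r<k. deriv ((deriv ^^ (k - 1 - r)) (\<lambda>y. deriv (D r) y * (deriv ^^ r) h y)) x)) (at x)"
    unfolding correction_def[abs_def] by (intro DERIV_sum) (simp add: field_differentiable_derivI)
  moreover have "deriv ((deriv ^^ (k - 1 - r)) F) x = (deriv ^^ (k - r)) F x" if "r < k" for r F
  proof -
    have "k - r = Suc (k - 1 - r)" using that by simp
    then show ?thesis by simp
  qed
  ultimately show ?thesis by simp
qed

text \<open>Integration by parts adds \<open>C (Suc k) (int k)\<close> to the coefficient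
  \<open>- C 1 0\<close> already present, and the sum is \<open>D k\<close>.\<close>

lemma solution_by_parts:
  assumes "k \<le> n" "x \<in> I"
    and "(deriv ^^ Suc k) f x = (\<integral>\<omega>. K (Suc k) k x (Z \<omega>) * (deriv ^^ k) h (Z \<omega>) \<partial>M)
      - C 1 0 x * (deriv ^^ k) h x + correction k x"
  shows "(deriv ^^ Suc k) f x = (\<integral>\<omega>. K (Suc k) (Suc k) x (Z \<omega>) * (deriv ^^ Suc k) h (Z \<omega>) \<partial>M)
      + D k x * (deriv ^^ k) h x + correction k x"
  unfolding assms(3) kernel_by_parts[OF kernel_hyp_deriv_h[OF assms(1)] assms(2)]
  by (simp add: D_def algebra_simps)

text \<open>Differentiation yields the coefficient \<open>C 0 (-1)\<close>; rewriting it as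
  \<open>C 1 0\<close> gives the base case the boundary term that all higher orders keep.\<close>

lemma solution_has_derivative_0:
  assumes x: "x \<in> I"
  shows "(f has_real_derivative
    (\<integral>\<omega>. K 1 0 x (Z \<omega>) * h (Z \<omega>) \<partial>M) - C 1 0 x * h x) (at x)"
proof -
  note kh = kernel_hypD[OF kernel_hyp_h]
  have "((\<lambda>y. \<integral>\<omega>. K 0 0 y (Z \<omega>) * h (Z \<omega>) \<partial>M) has_real_derivative
    (\<integral>\<omega>. K (Suc 0) 0 x (Z \<omega>) * h (Z \<omega>) \<partial>M) - C 0 (int 0 - 1) x * h x) (at x)"
    by (rule kernel_has_derivative[OF finite_tails_0 kh(1) x kh(3,6) kh(8)[OF x]])
      (use m_differentiable[of 0] x in simp_all)
  then have "(f has_real_derivative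
    (\<integral>\<omega>. K (Suc 0) 0 x (Z \<omega>) * h (Z \<omega>) \<partial>M) - C 0 (int 0 - 1) x * h x) (at x)"
    by (rule has_field_derivative_transform_within_open[OF _ open_I x])
      (simp only: stein_solution_eq[OF _ h_integrable kh(6)])
  then show ?thesis
    using coeff_0_eq_coeff_1[OF x] m_differentiable[of 0] x by simp
qed

text \<open>The expectation contributes the boundary coefficient \<open>- C (Suc k) (int k)\<close>,
  that is \<open>- D k - C 1 0\<close>. Its part \<open>- D k\<close> cancels the term of the
  product rule in which the derivative of \<open>h\<close> is differentiated once more. Left are
  \<open>- C 1 0\<close> and the new correction, \<open>deriv (D k)\<close> times the derivative of
  order \<open>k\<close> of \<open>h\<close>.\<close>

lemma solution_has_derivative_Suc:
  assumes "k < n" and x: "x \<in> I"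
    and eq: "\<And>y. y \<in> I \<Longrightarrow> (deriv ^^ Suc k) f y = (\<integral>\<omega>. K (Suc k) (Suc k) y (Z \<omega>) * (deriv ^^ Suc k) h (Z \<omega>) \<partial>M)
      + D k y * (deriv ^^ k) h y + correction k y"
  shows "((deriv ^^ Suc k) f has_real_derivative
    (\<integral>\<omega>. K (Suc (Suc k)) (Suc k) x (Z \<omega>) * (deriv ^^ Suc k) h (Z \<omega>) \<partial>M)
      - C 1 0 x * (deriv ^^ Suc k) h x + correction (Suc k) x) (at x)"
proof -
  note kh = kernel_hypD[OF kernel_hyp_deriv_h[of k]]
  note kh' = kernel_hypD[OF kernel_hyp_deriv_h[of "Suc k"]]
  have k: "k \<le> n" "Suc k \<le> n" using assms(1) by auto
  have E: "((\<lambda>y. \<integral>\<omega>. K (Suc k) (Suc k) y (Z \<omega>) * (deriv ^^ Suc k) h (Z \<omega>) \<partial>M) has_real_derivative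
    (\<integral>\<omega>. K (Suc (Suc k)) (Suc k) x (Z \<omega>) * (deriv ^^ Suc k) h (Z \<omega>) \<partial>M)
      - C (Suc k) (int (Suc k) - 1) x * (deriv ^^ Suc k) h x) (at x)"
  proof (rule kernel_has_derivative[OF _ kh'(1)[OF k(2)] x kh'(3)[OF k(2)]])
    show "finite_tails (Suc k)" by (rule kh(1)[OF k(1)])
    \<comment> \<open>This comes from the kernel hypothesis at index \<open>k\<close>, in its clause
      on \<open>deriv g\<close>; the next integrability comes from the hypothesis at
      \<open>Suc k\<close>.\<close>
    show "integrable M (\<lambda>\<omega>. K (Suc k) (Suc k) y (Z \<omega>) * (deriv ^^ Suc k) h (Z \<omega>))" if "y \<in> I" for y
      using kh(7)[OF k(1) that] by simp
    show "integrable M (\<lambda>\<omega>. K (Suc (Suc k)) (Suc k) x (Z \<omega>) * (deriv ^^ Suc k) h (Z \<omega>))"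
      by (rule kh'(6)[OF k(2) x])
  qed (use m_differentiable[of "Suc k"] k x in auto)
  have dD: "(D k has_real_derivative deriv (D k) x) (at x)"
    using D_differentiable[OF assms(1)] assms(1) x unfolding times_differentiable_on_def
    by (intro field_differentiable_derivI) (metis funpow_0 zero_less_diff)
  have dh: "((deriv ^^ k) h has_real_derivative (deriv ^^ Suc k) h x) (at x)"
    using h_differentiable assms(1) unfolding times_differentiable_on_def
    by (simp add: field_differentiable_derivI)
  have "((\<lambda>y. (\<integral>\<omega>. K (Suc k) (Suc k) y (Z \<omega>) * (deriv ^^ Suc k) h (Z \<omega>) \<partial>M)
      + D k y * (deriv ^^ k) h y + correction k y) has_real_derivative
      ((\<integral>\<omega>. K (Suc (Suc k)) (Suc k) x (Z \<omega>) * (deriv ^^ Suc k) h (Z \<omega>) \<partial>M)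
      - C (Suc k) (int (Suc k) - 1) x * (deriv ^^ Suc k) h x)
      + (deriv (D k) x * (deriv ^^ k) h x + (deriv ^^ Suc k) h x * D k x)
      + (\<Sum>r<k. (deriv ^^ (k - r)) (\<lambda>y. deriv (D r) y * (deriv ^^ r) h y) x)) (at x)"
    by (intro DERIV_add E DERIV_mult dD dh correction_has_derivative assms)
  then have "((deriv ^^ Suc k) f has_real_derivative
      ((\<integral>\<omega>. K (Suc (Suc k)) (Suc k) x (Z \<omega>) * (deriv ^^ Suc k) h (Z \<omega>) \<partial>M)
      - C (Suc k) (int (Suc k) - 1) x * (deriv ^^ Suc k) h x)
      + (deriv (D k) x * (deriv ^^ k) h x + (deriv ^^ Suc k) h x * D k x)
      + (\<Sum>r<k. (deriv ^^ (k - r)) (\<lambda>y. deriv (D r) y * (deriv ^^ r) h y) x)) (at x)"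
    by (rule has_field_derivative_transform_within_open[OF _ open_I x]) (simp only: eq)
  then show ?thesis
  proof (rule DERIV_cong)
    have "C (Suc k) (int (Suc k) - 1) x = D k x + C 1 0 x" by (simp add: D_def)
    then show "(\<integral>\<omega>. K (Suc (Suc k)) (Suc k) x (Z \<omega>) * (deriv ^^ Suc k) h (Z \<omega>) \<partial>M)
      - C (Suc k) (int (Suc k) - 1) x * (deriv ^^ Suc k) h x
      + (deriv (D k) x * (deriv ^^ k) h x + (deriv ^^ Suc k) h x * D k x)
      + (\<Sum>r<k. (deriv ^^ (k - r)) (\<lambda>y. deriv (D r) y * (deriv ^^ r) h y) x) =
      (\<integral>\<omega>. K (Suc (Suc k)) (Suc k) x (Z \<omega>) * (deriv ^^ Suc k) h (Z \<omega>) \<partial>M)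
      - C 1 0 x * (deriv ^^ Suc k) h x + correction (Suc k) x"
      by (simp add: correction_def algebra_simps del: funpow.simps)
  qed
qed

text \<open>Each step differentiates the previous formula, which must therefore hold on the whole
  open support. Differentiability is carried along because \<open>deriv\<close> is total, so that a
  formula for it does not show that a derivative exists.\<close>

lemma solution_higher_deriv:
  assumes "k \<le> n"
  shows "times_differentiable_on (Suc k) f I \<and> (\<forall>x\<in>I. (deriv ^^ Suc k) f x =
    (\<integral>\<omega>. K (Suc k) k x (Z \<omega>) * (deriv ^^ k) h (Z \<omega>) \<partial>M)
      - C 1 0 x * (deriv ^^ k) h x + correction k x)"
  using assms
proof (induction k)
  case 0
  have d: "(f has_real_derivative (\<integral>\<omega>. K 1 0 x (Z \<omega>) * h (Z \<omega>) \<partial>M) - C 1 0 x * h x) (at x)" if "x \<in> I" for x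
    by (rule solution_has_derivative_0[OF that])
  then have "times_differentiable_on (Suc 0) f I"
    unfolding times_differentiable_on_def field_differentiable_def by auto
  then show ?case using d by (auto simp: correction_def DERIV_imp_deriv)
next
  case (Suc k)
  then have IH: "times_differentiable_on (Suc k) f I"
    "\<And>x. x \<in> I \<Longrightarrow> (deriv ^^ Suc k) f x = (\<integral>\<omega>. K (Suc k) k x (Z \<omega>) * (deriv ^^ k) h (Z \<omega>) \<partial>M)
      - C 1 0 x * (deriv ^^ k) h x + correction k x" by auto
  have d: "((deriv ^^ Suc k) f has_real_derivative
    (\<integral>\<omega>. K (Suc (Suc k)) (Suc k) x (Z \<omega>) * (deriv ^^ Suc k) h (Z \<omega>) \<partial>M)
      - C 1 0 x * (deriv ^^ Suc k) h x + correction (Suc k) x) (at x)" if "x \<in> I" for x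
    using Suc.prems that by (intro solution_has_derivative_Suc solution_by_parts IH(2)) auto
  have "times_differentiable_on (Suc (Suc k)) f I"
    unfolding times_differentiable_on_def
  proof (intro allI impI ballI)
    fix j x assume "j < Suc (Suc k)" "x \<in> I"
    then show "(deriv ^^ j) f field_differentiable (at x)"
      using IH(1) d[of x] unfolding times_differentiable_on_def field_differentiable_def
      by (cases "j = Suc k") auto
  qed
  moreover have "(deriv ^^ Suc (Suc k)) f x = (\<integral>\<omega>. K (Suc (Suc k)) (Suc k) x (Z \<omega>) * (deriv ^^ Suc k) h (Z \<omega>) \<partial>M)
      - C 1 0 x * (deriv ^^ Suc k) h x + correction (Suc k) x" if "x \<in> I" for x
    using DERIV_imp_deriv[OF d[OF that]] by simp
  ultimately show ?case by blast
qed

section \<open>Telescoping of the corrections\<close>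

lemma coeff_diag_deriv:
  assumes x: "x \<in> I"
  shows "deriv (C 0 (int 0)) x = 0"
    and "r < n \<Longrightarrow> finite_tails (Suc (Suc r)) \<Longrightarrow> deriv (C (Suc r) (int (Suc r))) x = D (Suc r) x - D r x"
proof -
  \<comment> \<open>The derivative is \<open>C 1 0\<close> minus \<open>C 0 (-1)\<close>, which
    coincide.\<close>
  show "deriv (C 0 (int 0)) x = 0"
    using DERIV_imp_deriv[OF coeff_diag_has_derivative[of 0 x]] finite_tails_0 finite_tails_1 x
      m_differentiable[of 0 x] coeff_0_eq_coeff_1[OF x] by simp
  assume r: "r < n" and fin: "finite_tails (Suc (Suc r))"
  have "deriv (C (Suc r) (int (Suc r))) x = C (Suc (Suc r)) (int (Suc r)) x - C (Suc r) (int (Suc r) - 1) x"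
    using r x by (intro DERIV_imp_deriv coeff_diag_has_derivative finite_tails_le fin m_differentiable) auto
  then show "deriv (C (Suc r) (int (Suc r))) x = D (Suc r) x - D r x" by (simp add: D_def)
qed

lemma D_0: "D 0 y = 0"
  by (simp add: D_def)

text \<open>By the product rule for \<open>D r\<close> times the derivative of order
  \<open>r\<close> of \<open>h\<close>, the correction summands are \<open>U r - V r\<close>, and
  the diagonal summands are \<open>U (Suc r) - V r\<close>. The \<open>V r\<close> agree, and the
  \<open>U r\<close> telescope from \<open>U 0 = 0\<close> to \<open>U n\<close>, which has outer
  order 0 and is the boundary term.\<close>

lemma correction_telescope:
  assumes h: "times_differentiable_on (Suc n) h UNIV" and x: "x \<in> I"
  shows "D n x * (deriv ^^ n) h x + correction n x =
    (\<Sum>r<Suc n. (deriv ^^ (n - r)) (\<lambda>y. deriv (C r (int r)) y * (deriv ^^ r) h y) x)"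
proof -
  define U where "U r = (deriv ^^ (n - r)) (\<lambda>y. D r y * (deriv ^^ r) h y) x" for r
  define V where "V r = (deriv ^^ (n - Suc r)) (\<lambda>y. D r y * (deriv ^^ Suc r) h y) x" for r
  have hd: "times_differentiable_on a ((deriv ^^ b) h) I" if "a + b \<le> Suc n" for a b
    using times_differentiable_on_mono[OF h that] by (intro times_differentiable_on_higher_deriv) simp
  have DV: "times_differentiable_on (n - Suc r) (\<lambda>y. D r y * (deriv ^^ Suc r) h y) I" if "r < n" for r
  proof (rule times_differentiable_on_mult[OF open_I])
    show "times_differentiable_on (n - Suc r) (D r) I"
      by (rule times_differentiable_on_mono[OF D_differentiable[OF that]]) auto
    show "times_differentiable_on (n - Suc r) ((deriv ^^ Suc r) h) I" using that by (intro hd) simp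
  qed
  \<comment> \<open>At \<open>r = n\<close> the order is 0, so no derivative of \<open>D n\<close>
    enters.\<close>
  have DU: "times_differentiable_on (n - r) (\<lambda>y. D r y * (deriv ^^ r) h y) I" if "r \<le> n" for r
  proof (cases "r < n")
    case True
    then show ?thesis by (intro times_differentiable_on_mult[OF open_I] D_differentiable hd) auto
  qed (use that in simp)
  have G: "(deriv ^^ (n - 1 - r)) (\<lambda>y. deriv (D r) y * (deriv ^^ r) h y) x = U r - V r" if r: "r < n" for r
  proof -
    have nr: "n - r = Suc (n - Suc r)" using r by simp
    have fd: "D r field_differentiable (at y)" "(deriv ^^ r) h field_differentiable (at y)" if "y \<in> I" for y
      using D_differentiable[OF r] hd[of 1 r] r that unfolding nr times_differentiable_on_Suc by (auto simp: times_differentiable_on_Suc)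
    have "(deriv ^^ (n - Suc r)) (\<lambda>y. deriv (D r) y * (deriv ^^ r) h y) x =
        (deriv ^^ (n - Suc r)) (\<lambda>y. deriv (\<lambda>y. D r y * (deriv ^^ r) h y) y - D r y * (deriv ^^ Suc r) h y) x"
      by (rule higher_deriv_cong_on_open[OF open_I _ x]) (simp add: fd)
    also have "\<dots> = (deriv ^^ (n - Suc r)) (deriv (\<lambda>y. D r y * (deriv ^^ r) h y)) x - V r"
      unfolding V_def using DU[of r] r nr times_differentiable_on_Suc
      by (intro higher_deriv_diff_on_open[OF open_I _ DV[OF r] x]) auto
    also have "(deriv ^^ (n - Suc r)) (deriv (\<lambda>y. D r y * (deriv ^^ r) h y)) x = U r"
      unfolding U_def nr by (simp add: funpow_swap1)
    finally show ?thesis by simp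
  qed
  have T: "(deriv ^^ (n - Suc r)) (\<lambda>y. deriv (C (Suc r) (int (Suc r))) y * (deriv ^^ Suc r) h y) x = U (Suc r) - V r"
    if r: "r < n" for r
  proof -
    have "(deriv ^^ (n - Suc r)) (\<lambda>y. deriv (C (Suc r) (int (Suc r))) y * (deriv ^^ Suc r) h y) x =
      (deriv ^^ (n - Suc r)) (\<lambda>y. D (Suc r) y * (deriv ^^ Suc r) h y - D r y * (deriv ^^ Suc r) h y) x"
      using r by (intro higher_deriv_cong_on_open[OF open_I _ x])
        (simp add: coeff_diag_deriv(2) finite_tails_le left_diff_distrib del: funpow.simps of_nat_Suc)
    also have "\<dots> = U (Suc r) - V r"
      unfolding U_def V_def using r by (intro higher_deriv_diff_on_open[OF open_I DU DV x]) auto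
    finally show ?thesis .
  qed
  \<comment> \<open>Both sides are iterated derivatives of functions that vanish on the
    support.\<close>
  have T0: "(deriv ^^ n) (\<lambda>y. deriv (C 0 (int 0)) y * (deriv ^^ 0) h y) x = U 0"
    unfolding U_def using coeff_diag_deriv(1) by (simp add: D_0) (intro higher_deriv_cong_on_open[OF open_I _ x], simp)
  have "U 0 = 0"
  proof -
    have "(deriv ^^ k) (\<lambda>y. 0 :: real) = (\<lambda>y. 0)" for k
      by (induction k) (simp, simp only: funpow.simps o_apply deriv_const)
    then show ?thesis by (simp add: U_def D_0)
  qed
  have "D n x * (deriv ^^ n) h x + correction n x = U n + (\<Sum>r<n. U r - V r)"
  proof -
    have "correction n x = (\<Sum>r<n. U r - V r)"
      unfolding correction_def by (rule sum.cong) (simp_all only: G lessThan_iff)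
    then show ?thesis by (simp add: U_def)
  qed
  also have "\<dots> = (\<Sum>r<n. U (Suc r) - V r)"
    using sum_lessThan_telescope[of U n] \<open>U 0 = 0\<close> by (simp add: sum_subtractf)
  also have "\<dots> = (\<Sum>r<Suc n. (deriv ^^ (n - r)) (\<lambda>y. deriv (C r (int r)) y * (deriv ^^ r) h y) x)"
    unfolding sum.lessThan_Suc_shift using T T0 \<open>U 0 = 0\<close> by (simp del: funpow.simps of_nat_Suc)
  finally show ?thesis .
qed

end

theorem theorem2p28:
  fixes M :: "'a measure" and Z :: "'a \<Rightarrow> real" and p w h :: "real \<Rightarrow> real"
    and e :: "nat \<Rightarrow> ereal" and l u :: ereal and m n :: nat
  defines "K \<equiv> stein_kernel l u p w"
    and "C \<equiv> stein_coeff l u p w"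
    and "f \<equiv> stein_solution M Z l p w h"
    and "I \<equiv> {x. 0 < p x}"
  assumes "prob_space M"
    and "distributed M lborel Z (\<lambda>x. ennreal (p x))"
    and "\<forall>x. 0 \<le> p x"
    and "1 \<le> m"
    and "l = e 0" and "u = e m"
    and "\<forall>r\<in>{1..m}. e (r - 1) < e r"
    and "I = (\<Union>r\<in>{1..m}. einterval (e (r - 1)) (e r))"
    and "\<forall>r\<in>{1..m}. locally_abs_cont_on (einterval (e (r - 1)) (e r)) p"
    and "\<forall>x\<in>I. w x \<noteq> 0"
    and "\<forall>r\<in>{1..m}. locally_abs_cont_on (einterval (e (r - 1)) (e r)) (\<lambda>x. w x * p x)"
    and "1 \<le> n"
    and "integrable (density lborel (\<lambda>x. ennreal (p x))) h"
    and "times_differentiable_on (n - 1) h UNIV"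
    and "locally_abs_cont_on UNIV ((deriv ^^ (n - 1)) h)"
    and "kernel_hyp M Z l u p w 0 0 h"
    and "\<forall>k\<in>{1..n}. kernel_hyp M Z l u p w k (k - 1) ((deriv ^^ (k - 1)) h)"
    and "\<forall>k\<in>{1..n - 1}. kernel_hyp M Z l u p w (k + 1) (k - 1) ((deriv ^^ (k - 1)) h)"
    and "\<forall>r<n - 1. times_differentiable_on (n - 1 - r) (\<lambda>y. C (r + 1) (int r) y - C 1 0 y) I"
  shows "times_differentiable_on n f I \<and>
    (\<forall>x\<in>I.
      (deriv ^^ n) f x =
        (\<integral>\<omega>. K n (n - 1) x (Z \<omega>) * (deriv ^^ (n - 1)) h (Z \<omega>) \<partial>M)
        - C 1 0 x * (deriv ^^ (n - 1)) h x
        + (\<Sum>r<n - 1. (deriv ^^ (n - 2 - r))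
            (\<lambda>y. deriv (\<lambda>z. C (r + 1) (int r) z - C 1 0 z) y * (deriv ^^ r) h y) x)) \<and>
    (\<forall>x\<in>I.
      (deriv ^^ n) f x =
        (\<integral>\<omega>. K n n x (Z \<omega>) * (deriv ^^ n) h (Z \<omega>) \<partial>M)
        + (C n (int n - 1) x - C 1 0 x) * (deriv ^^ (n - 1)) h x
        + (\<Sum>r<n - 1. (deriv ^^ (n - 2 - r))
            (\<lambda>y. deriv (\<lambda>z. C (r + 1) (int r) z - C 1 0 z) y * (deriv ^^ r) h y) x)) \<and>
    (times_differentiable_on n h UNIV \<and>
     locally_abs_cont_on UNIV ((deriv ^^ n) h) \<and>
     kernel_hyp M Z l u p w n n ((deriv ^^ n) h) \<and>
     (\<forall>r<n. times_differentiable_on (n - r) (C r (int r)) I) \<longrightarrow>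
     (\<forall>x\<in>I.
       (deriv ^^ n) f x =
         (\<integral>\<omega>. K n (n + 1) x (Z \<omega>) * (deriv ^^ (n + 1)) h (Z \<omega>) \<partial>M)
         + C n (int n) x * (deriv ^^ n) h x
         + (\<Sum>r<n. (deriv ^^ (n - 1 - r))
             (\<lambda>y. deriv (C r (int r)) y * (deriv ^^ r) h y) x)))"
proof -
  \<comment> \<open>The locale counts by the order of the derivative of \<open>h\<close> in the
    first formula, which is one below the order for the solution.\<close>
  obtain N where n: "n = Suc N" using \<open>1 \<le> n\<close> by (cases n) auto
  interpret prob_space M by fact
  interpret S: stein_derivatives M Z p w e l u m h N
  proof unfold_locales
    show "times_differentiable_on N h UNIV"
      using \<open>times_differentiable_on (n - 1) h UNIV\<close> n by simp
    show "kernel_hyp M Z l u p w (Suc k) k ((deriv ^^ k) h)" if "k \<le> N" for k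
      using \<open>\<forall>k\<in>{1..n}. kernel_hyp M Z l u p w k (k - 1) ((deriv ^^ (k - 1)) h)\<close>[rule_format, of "Suc k"] n that
      by simp
    show "times_differentiable_on (N - r) (\<lambda>y. stein_coeff l u p w (Suc r) (int r) y - stein_coeff l u p w 1 0 y) {x. 0 < p x}"
      if "r < N" for r
      using \<open>\<forall>r<n - 1. times_differentiable_on (n - 1 - r) (\<lambda>y. C (r + 1) (int r) y - C 1 0 y) I\<close>[rule_format, of r]
        n that by (simp add: C_def I_def)
  qed (use assms in \<open>auto simp: I_def\<close>)
  \<comment> \<open>With \<open>n = Suc N\<close> the truncated exponent \<open>n - 2 - r\<close> is
    \<open>N - 1 - r\<close>; for \<open>N = 0\<close> the sum is empty.\<close>
  have corr: "(\<Sum>r<n - 1. (deriv ^^ (n - 2 - r))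
      (\<lambda>y. deriv (\<lambda>z. C (r + 1) (int r) z - C 1 0 z) y * (deriv ^^ r) h y) x) = S.correction N x" for x
    by (simp add: n S.correction_def S.D_def[abs_def] C_def)
  have td: "times_differentiable_on n f I"
    and eq1: "\<And>x. x \<in> I \<Longrightarrow> (deriv ^^ n) f x = (\<integral>\<omega>. K n (n - 1) x (Z \<omega>) * (deriv ^^ (n - 1)) h (Z \<omega>) \<partial>M)
        - C 1 0 x * (deriv ^^ (n - 1)) h x + S.correction N x"
    using S.solution_higher_deriv[OF order_refl] by (auto simp: n f_def I_def K_def C_def simp del: funpow.simps)
  have eq2: "(deriv ^^ n) f x = (\<integral>\<omega>. K n n x (Z \<omega>) * (deriv ^^ n) h (Z \<omega>) \<partial>M)
      + S.D N x * (deriv ^^ (n - 1)) h x + S.correction N x" if "x \<in> I" for x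
    using S.solution_by_parts[OF order_refl, of x] eq1[OF that] that
    by (simp add: n f_def I_def K_def C_def del: funpow.simps)
  have D: "S.D N x = C n (int n - 1) x - C 1 0 x" for x by (simp add: S.D_def n C_def)
  \<comment> \<open>One further integration by parts, now with equal indices, is applied to the
    expectation in the second formula. The boundary term with \<open>S.D N\<close> and the
    corrections then merge by telescoping into a sum with one more term.\<close>
  have eq3: "(deriv ^^ n) f x = (\<integral>\<omega>. K n (n + 1) x (Z \<omega>) * (deriv ^^ (n + 1)) h (Z \<omega>) \<partial>M)
      + C n (int n) x * (deriv ^^ n) h x
      + (\<Sum>r<n. (deriv ^^ (n - 1 - r)) (\<lambda>y. deriv (C r (int r)) y * (deriv ^^ r) h y) x)"
    if "times_differentiable_on n h UNIV" "kernel_hyp M Z l u p w n n ((deriv ^^ n) h)" "x \<in> I" for x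
    using eq2[OF that(3)] S.kernel_by_parts[OF that(2), of x] S.correction_telescope[of x] that
    by (simp add: n I_def K_def C_def del: funpow.simps of_nat_Suc sum.lessThan_Suc) simp
  show ?thesis
    unfolding corr using td eq1 eq2[unfolded D] eq3 by blast
qed

end
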